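(* Let $X=\{X_t\}_{t\ge 0}$ be a transient Hunt process on $\mathbb{R}$ satisfying the standing assumptions listed in the context, let $g:\mathbb{R}\to[0,\infty)$ be a continuous reward function, and let $r\ge 0$ be a discount rate such that $$\mathbf{E}_x\Big(\sup_{t\ge 0}e^{-rt}g(X_t)\Big)<\infty,\qquad x\in\mathbb{R}.$$ Assume that there exist real numbers $x_*<x^*$ and a positive Radon measure $\sigma$ with support on the set $S=(-\infty,x_*]\cup[x^*,\infty)$ such that the function $$V(x):=\int_S G_r(x,y)\,\sigma(dy)=\int_{(-\infty,x_*]}G_r(x,y)\,\sigma(dy)+\int_{[x^*,\infty)}G_r(x,y)\,\sigma(dy),\qquad x\in\mathbb{R},$$ satisfies the following conditions: (a) $V$ is continuous; (b) $V(x)=g(x)$ when $x\in S$; (c) $V(x)\ge g(x)$ when $x\notin S$. Let $\tau^*=\inf\{t\ge 0: X_t\in S\}$. Then $\tau^*$ is an optimal stopping time and $V$ is the value function of the optimal stopping problem for $X$ with reward function $g$ and discount rate $r$, that is, $$V(x)=\sup_{\tau\in\mathcal{M}}\mathbf{E}_x\big(e^{-r\tau}g(X_\tau)\big)=\mathbf{E}_x\big(e^{-r\tau^*}g(X_{\tau^*})\big),\qquad x\in\mathbb{R}.$$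
   Context: Standing assumptions on $X$. $X=\{X_t\}_{t\ge0}$ is a transient Hunt process with values in $\mathbb{R}$ (a strong Markov process, quasi-left-continuous on $[0,\infty)$, with right-continuous sample paths having left limits). $\mathbf{P}_x,\mathbf{E}_x$ denote probability and expectation when $X_0=x$. The resolvent is $G_r(x,A)=\int_0^\infty e^{-rt}\mathbf{P}_x(X_t\in A)\,dt$ for $r\ge 0$, $x\in\mathbb{R}$, $A$ Borel, and $G_rf(x)=\int f(y)\,G_r(x,dy)$. Let $\mathcal{B}_o$ be the set of bounded measurable functions with compact support. It is assumed that there are a $\sigma$-finite measure $m$ on $\mathbb{R}$ (the duality measure) and a dual resolvent $\{\widehat G_r: r\ge 0\}$, i.e. $\int m(dx) f(x)G_rg(x)=\int m(dx)\,\widehat G_rf(x)\,g(x)$ for all $f,g\in\mathcal{B}_o$, $r\ge 0$, and that $\{\widehat G_r\}$ is the resolvent of a transient Hunt process $\widehat X$ on $\mathbb{R}$. Moreover: (h1) $G_r(x,dy)=G_r(x,y)\,m(dy)$; (h2) $\sup_{x\in A}G_0(x,B)<\infty$ for all compact $A,B$; (h3) $x\mapsto\widehat G_rf(x)$ is continuous and finite for every $f\in\mathcal{B}_o$. The density $G_r(x,y)$ is the Green (potential) kernel: for each $r\ge0$, $(x,y)\mapsto G_r(x,y)$ is jointly measurable, $\widehat G_r(y,dx)=G_r(x,y)\,m(dx)$, $x\mapsto G_r(x,y)$ is $r$-excessive for $X$ for each $y$, and $y\mapsto G_r(x,y)$ is $r$-excessive for $\widehat X$ for each $x$. A measurable $f:\mathbb{R}\to[0,+\infty]$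 is $r$-excessive for $X$ if for all $x$: $e^{-rt}\mathbf{E}_x(f(X_t))\le f(x)$ for all $t\ge 0$, and $e^{-rt}\mathbf{E}_x(f(X_t))\to f(x)$ as $t\to 0$ (analogously for $\widehat X$). $\mathcal{M}$ is the set of all stopping times (values in $[0,+\infty]$) with respect to the natural filtration generated by $X$. On $\{\tau=+\infty\}$ one sets $e^{-r\tau}g(X_\tau):=\limsup_{t\to\infty}e^{-rt}g(X_t)$. *)

theory Defs
  imports "HOL-Probability.Probability"
begin

text \<open>
  A process is given by a sample space \<open>\<Omega>\<close>, paths \<open>X t \<omega>\<close> with \<open>t\<close> real (only \<open>t \<ge> 0\<close> is ever used)
  and a family \<open>P x\<close> of laws on \<open>\<sigma>(X s, s \<ge> 0)\<close>. Filtrations and stopping times are indexed by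
  \<^typ>\<open>ennreal\<close>, i.e. by \<open>[0, \<infinity>]\<close>, the index \<open>\<infinity>\<close> standing for \<open>\<sigma>(X s, s \<ge> 0)\<close>.
\<close>

definition raw_filtration :: "'a set \<Rightarrow> (real \<Rightarrow> 'a \<Rightarrow> real) \<Rightarrow> ennreal \<Rightarrow> 'a measure" where
  "raw_filtration \<Omega> X t =
     sigma \<Omega> {X s -` B \<inter> \<Omega> | s B. 0 \<le> s \<and> ennreal s \<le> t \<and> B \<in> sets borel}"

text \<open>
  The natural filtration of a Hunt process, in the usual sense of Markov process theory: a set
  belongs to it at time \<open>t\<close> iff for every initial law \<open>\<mu>\<close> it differs from an event of the raw
  right-limit \<open>\<Inter>u>t. \<sigma>(X s, s \<le> u)\<close> by a set that is null for \<open>P\<^sub>\<mu> = \<integral> \<mu>(dx) P\<^sub>x\<close>. The augmentation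
  cannot be dropped: for paths with jumps the entrance time of a closed set is in general not a
  stopping time of the raw filtration. The conjunct \<open>B \<in> raw_filtration \<Omega> X \<infinity>\<close> only matters
  at \<open>t = \<infinity>\<close>, where the intersection over \<open>u > t\<close> is empty.
\<close>

definition natural_filtration ::
  "'a set \<Rightarrow> (real \<Rightarrow> 'a \<Rightarrow> real) \<Rightarrow> (real \<Rightarrow> 'a measure) \<Rightarrow> ennreal \<Rightarrow> 'a measure" where
  "natural_filtration \<Omega> X P t =
     sigma \<Omega> {A. A \<subseteq> \<Omega> \<and>
       (\<forall>\<mu>::real measure. prob_space \<mu> \<and> sets \<mu> = sets borel \<longrightarrow>
         (\<exists>B. B \<in> sets (raw_filtration \<Omega> X \<infinity>) \<and> (\<forall>u>t. B \<in> sets (raw_filtration \<Omega> X u)) \<and>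
              (A - B) \<union> (B - A) \<in> null_sets (completion (\<mu> \<bind> P))))}"

lemma space_raw_filtration: "space (raw_filtration \<Omega> X t) = \<Omega>"
  unfolding raw_filtration_def by (rule space_measure_of) auto

lemma sets_natural_filtration:
  "sets (natural_filtration \<Omega> X P t) = {A. A \<subseteq> \<Omega> \<and>
     (\<forall>\<mu>::real measure. prob_space \<mu> \<and> sets \<mu> = sets borel \<longrightarrow>
       (\<exists>B. B \<in> sets (raw_filtration \<Omega> X \<infinity>) \<and> (\<forall>u>t. B \<in> sets (raw_filtration \<Omega> X u)) \<and>
            (A - B) \<union> (B - A) \<in> null_sets (completion (\<mu> \<bind> P))))}" (is "_ = ?F")
proof -
  have "sigma_algebra \<Omega> ?F"
    unfolding sigma_algebra_iff2
  proof (intro conjI ballI allI impI)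
    show "?F \<subseteq> Pow \<Omega>" by auto
    show "{} \<in> ?F" by (auto intro!: exI[of _ "{}"])
  next
    fix A assume A: "A \<in> ?F"
    show "\<Omega> - A \<in> ?F"
    proof (intro CollectI conjI allI impI)
      fix \<mu> :: "real measure" assume "prob_space \<mu> \<and> sets \<mu> = sets borel"
      with A obtain B where B: "B \<in> sets (raw_filtration \<Omega> X \<infinity>)"
        "\<forall>u>t. B \<in> sets (raw_filtration \<Omega> X u)"
        "(A - B) \<union> (B - A) \<in> null_sets (completion (\<mu> \<bind> P))" by blast
      have "B \<subseteq> \<Omega>" using sets.sets_into_space[OF B(1)] by (simp add: space_raw_filtration)
      then have "((\<Omega> - A) - (\<Omega> - B)) \<union> ((\<Omega> - B) - (\<Omega> - A)) = (A - B) \<union> (B - A)"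
        using A by auto
      moreover have "\<Omega> - B \<in> sets (raw_filtration \<Omega> X u)" if "B \<in> sets (raw_filtration \<Omega> X u)" for u
        using sets.compl_sets[OF that] by (simp add: space_raw_filtration)
      ultimately show "\<exists>B. B \<in> sets (raw_filtration \<Omega> X \<infinity>) \<and>
          (\<forall>u>t. B \<in> sets (raw_filtration \<Omega> X u)) \<and>
          ((\<Omega> - A) - B) \<union> (B - (\<Omega> - A)) \<in> null_sets (completion (\<mu> \<bind> P))"
        using B by (intro exI[of _ "\<Omega> - B"]) auto
    qed auto
  next
    fix A :: "nat \<Rightarrow> 'a set" assume A: "range A \<subseteq> ?F"
    show "(\<Union>i. A i) \<in> ?F"
    proof (intro CollectI conjI allI impI)
      fix \<mu> :: "real measure" assume \<mu>: "prob_space \<mu> \<and> sets \<mu> = sets borel"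
      have "\<forall>i. \<exists>B. B \<in> sets (raw_filtration \<Omega> X \<infinity>) \<and> (\<forall>u>t. B \<in> sets (raw_filtration \<Omega> X u)) \<and>
            (A i - B) \<union> (B - A i) \<in> null_sets (completion (\<mu> \<bind> P))"
        using A \<mu> by blast
      then obtain B where B: "\<And>i. B i \<in> sets (raw_filtration \<Omega> X \<infinity>)"
        "\<And>i. \<forall>u>t. B i \<in> sets (raw_filtration \<Omega> X u)"
        "\<And>i. (A i - B i) \<union> (B i - A i) \<in> null_sets (completion (\<mu> \<bind> P))"
        by metis
      have "(\<Union>i. (A i - B i) \<union> (B i - A i)) \<in> null_sets (completion (\<mu> \<bind> P))"
        using B(3) by (rule null_sets_UN)
      then have "((\<Union>i. A i) - (\<Union>i. B i)) \<union> ((\<Union>i. B i) - (\<Union>i. A i))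
          \<in> null_sets (completion (\<mu> \<bind> P))"
        by (rule null_sets_completion_subset[rotated]) auto
      then show "\<exists>B. B \<in> sets (raw_filtration \<Omega> X \<infinity>) \<and>
          (\<forall>u>t. B \<in> sets (raw_filtration \<Omega> X u)) \<and>
          ((\<Union>i. A i) - B) \<union> (B - (\<Union>i. A i)) \<in> null_sets (completion (\<mu> \<bind> P))"
        using B by (intro exI[of _ "\<Union>i. B i"]) auto
    qed (use A in auto)
  qed
  then show ?thesis
    unfolding natural_filtration_def by (rule sigma_algebra.sets_measure_of_eq)
qed

lemma filtration_natural_filtration: "filtration \<Omega> (natural_filtration \<Omega> X P)"
proof
  show "space (natural_filtration \<Omega> X P t) = \<Omega>" for t
    unfolding natural_filtration_def by (rule space_measure_of) auto
  show "sets (natural_filtration \<Omega> X P s) \<subseteq> sets (natural_filtration \<Omega> X P t)" if "s \<le> t" for s t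
  proof -
    have *: "u > s" if "u > t" for u using \<open>s \<le> t\<close> that by simp
    show ?thesis
      unfolding sets_natural_filtration
      by (rule Collect_mono, intro impI conjI, (elim conjE, assumption), (elim conjE))
         (use * in \<open>meson order_refl\<close>)
  qed
qed

locale hunt_process =
  fixes \<Omega> :: "'a set" and X :: "real \<Rightarrow> 'a \<Rightarrow> real" and P :: "real \<Rightarrow> 'a measure"
  assumes kernel: "P \<in> borel \<rightarrow>\<^sub>M prob_algebra (raw_filtration \<Omega> X \<infinity>)"
    and normal: "AE \<omega> in P x. X 0 \<omega> = x"
    and right_continuous_paths: "\<lbrakk>\<omega> \<in> \<Omega>; 0 \<le> t\<rbrakk> \<Longrightarrow> continuous (at_right t) (\<lambda>s. X s \<omega>)"
    and left_limits: "\<lbrakk>\<omega> \<in> \<Omega>; 0 < t\<rbrakk> \<Longrightarrow> \<exists>l. ((\<lambda>s. X s \<omega>) \<longlongrightarrow> l) (at_left t)"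
    and strong_markov:
      "\<lbrakk>stopping_time (natural_filtration \<Omega> X P) T;
        A \<in> sets (filtration.pre_sigma \<Omega> (natural_filtration \<Omega> X P) T);
        0 \<le> t; (f :: real \<Rightarrow> ennreal) \<in> borel_measurable borel\<rbrakk> \<Longrightarrow>
       (\<integral>\<^sup>+\<omega>\<in>A \<inter> {\<omega>. T \<omega> < \<infinity>}. f (X (enn2real (T \<omega>) + t) \<omega>) \<partial>completion (P x)) =
       (\<integral>\<^sup>+\<omega>\<in>A \<inter> {\<omega>. T \<omega> < \<infinity>}. (\<integral>\<^sup>+\<eta>. f (X t \<eta>) \<partial>P (X (enn2real (T \<omega>)) \<omega>)) \<partial>completion (P x))"
    and quasi_left_continuous:
      "\<lbrakk>\<And>n. stopping_time (natural_filtration \<Omega> X P) (T' n);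
        \<And>n \<omega>. \<omega> \<in> \<Omega> \<Longrightarrow> T' n \<omega> \<le> T' (Suc n) \<omega>\<rbrakk> \<Longrightarrow>
       AE \<omega> in P x. (SUP n. T' n \<omega>) < \<infinity> \<longrightarrow>
         (\<lambda>n::nat. X (enn2real (T' n \<omega>)) \<omega>) \<longlonglongrightarrow> X (enn2real (SUP n. T' n \<omega>)) \<omega>"

definition resolvent ::
  "'a set \<Rightarrow> (real \<Rightarrow> 'a \<Rightarrow> real) \<Rightarrow> (real \<Rightarrow> 'a measure) \<Rightarrow> real \<Rightarrow> real \<Rightarrow> real measure" where
  "resolvent \<Omega> X P r x = measure_of UNIV (sets borel)
     (\<lambda>A. \<integral>\<^sup>+t\<in>{0..}. ennreal (exp (- r * t)) * emeasure (P x) {\<omega> \<in> \<Omega>. X t \<omega> \<in> A} \<partial>lborel)"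

lemma (in hunt_process) X_measurable:
  assumes "0 \<le> t" shows "X t \<in> borel_measurable (P x)"
proof -
  have "P x \<in> space (prob_algebra (raw_filtration \<Omega> X \<infinity>))"
    using measurable_space[OF kernel] by simp
  then have *: "sets (P x) = sets (raw_filtration \<Omega> X \<infinity>)"
    by (simp add: space_prob_algebra)
  have "X t \<in> borel_measurable (raw_filtration \<Omega> X \<infinity>)"
  proof (rule measurableI)
    fix A :: "real set" assume "A \<in> sets borel"
    then show "X t -` A \<inter> space (raw_filtration \<Omega> X \<infinity>) \<in> sets (raw_filtration \<Omega> X \<infinity>)"
      using assms unfolding space_raw_filtration
      by (subst raw_filtration_def) (auto intro!: sigma_sets.Basic exI[of _ t] exI[of _ A])
  qed simp
  then show ?thesis using * by (simp cong: measurable_cong_sets)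
qed

lemma (in hunt_process) space_P: "space (P x) = \<Omega>"
proof -
  have "P x \<in> space (prob_algebra (raw_filtration \<Omega> X \<infinity>))"
    using measurable_space[OF kernel] by simp
  then have "sets (P x) = sets (raw_filtration \<Omega> X \<infinity>)"
    by (simp add: space_prob_algebra)
  then show ?thesis
    by (metis sets_eq_imp_space_eq space_raw_filtration)
qed

lemma (in hunt_process) X_jointly_measurable:
  "(\<lambda>(t, \<omega>). X (max 0 t) \<omega>) \<in> borel_measurable (borel \<Otimes>\<^sub>M P x)"
proof -
  define q :: "nat \<Rightarrow> real \<Rightarrow> real"
    where "q n t = (of_int \<lfloor>max 0 t * (real n + 1)\<rfloor> + 1) / (real n + 1)" for n t
  have q_gt: "max 0 t < q n t" for n t
  proof -
    have "max 0 t * (real n + 1) < of_int \<lfloor>max 0 t * (real n + 1)\<rfloor> + 1" by (rule real_of_int_floor_add_one_gt)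
    then show ?thesis unfolding q_def by (subst pos_less_divide_eq) auto
  qed
  have q_le: "q n t \<le> max 0 t + 1 / (real n + 1)" for n t
    unfolding q_def add_divide_distrib
    by (intro add_right_mono, subst pos_divide_le_eq) (simp, rule of_int_floor_le)
  have q_lim: "(\<lambda>n. q n t) \<longlonglongrightarrow> max 0 t" for t :: real
  proof (rule tendsto_sandwich[of "\<lambda>n. max 0 t" _ _ "\<lambda>n. max 0 t + 1 / (real n + 1)"])
    have "(\<lambda>n. 1 / (real n + 1)) \<longlonglongrightarrow> 0"
      using LIMSEQ_inverse_real_of_nat by (simp add: inverse_eq_divide add.commute)
    from tendsto_add[OF tendsto_const[of "max 0 t"] this]
    show "(\<lambda>n. max 0 t + 1 / (real n + 1)) \<longlonglongrightarrow> max 0 t" by simp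
  qed (simp_all only: always_eventually less_imp_le[OF q_gt] q_le tendsto_const simp_thms)
  show ?thesis
  proof (rule borel_measurable_LIMSEQ_real)
    fix z :: "real \<times> _" assume "z \<in> space (borel \<Otimes>\<^sub>M P x)"
    then obtain t \<omega> where z: "z = (t, \<omega>)" "\<omega> \<in> \<Omega>"
      by (auto simp: space_pair_measure space_P)
    have "continuous (at_right (max 0 t)) (\<lambda>s. X s \<omega>)"
      using z by (intro right_continuous_paths) auto
    then have "((\<lambda>s. X s \<omega>) \<longlongrightarrow> X (max 0 t) \<omega>) (at_right (max 0 t))"
      by (simp add: continuous_within)
    moreover have "filterlim (\<lambda>n. q n t) (at_right (max 0 t)) sequentially"
      by (rule tendsto_imp_filterlim_at_right[OF q_lim]) (intro always_eventually allI q_gt)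
    ultimately have "(\<lambda>n. X (q n t) \<omega>) \<longlonglongrightarrow> X (max 0 t) \<omega>"
      by (rule filterlim_compose)
    then show "(\<lambda>n. (\<lambda>(t, \<omega>). X (q n t) \<omega>) z) \<longlonglongrightarrow> (case z of (t, \<omega>) \<Rightarrow> X (max 0 t) \<omega>)"
      using z by simp
  next
    fix n
    define F where "F k z = X ((of_int (max 0 k) + 1) / (real n + 1)) (snd z)" for k :: int and z :: "real \<times> 'a"
    have "F k \<in> borel_measurable (borel \<Otimes>\<^sub>M P x)" for k
      unfolding F_def by (rule measurable_compose[OF measurable_snd X_measurable]) auto
    moreover have "(\<lambda>z. \<lfloor>max 0 (fst z) * (real n + 1)\<rfloor>) \<in> borel \<Otimes>\<^sub>M P x \<rightarrow>\<^sub>M count_space UNIV"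
      by measurable
    ultimately have "(\<lambda>z. F \<lfloor>max 0 (fst z) * (real n + 1)\<rfloor> z) \<in> borel_measurable (borel \<Otimes>\<^sub>M P x)"
      by (rule measurable_compose_countable)
    then show "(\<lambda>(t, \<omega>). X (q n t) \<omega>) \<in> borel_measurable (borel \<Otimes>\<^sub>M P x)"
      by (rule measurable_cong[THEN iffD1, rotated]) (auto simp: F_def q_def max_def split_beta)
  qed
qed

lemma (in hunt_process) emeasure_resolvent:
  assumes "A \<in> sets borel"
  shows "emeasure (resolvent \<Omega> X P r x) A =
    (\<integral>\<^sup>+t\<in>{0..}. ennreal (exp (- r * t)) * emeasure (P x) {\<omega> \<in> \<Omega>. X t \<omega> \<in> A} \<partial>lborel)"
proof -
  define h where "h A t = ennreal (exp (- r * t)) * emeasure (P x) {\<omega> \<in> \<Omega>. X t \<omega> \<in> A} * indicator {0..} t"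
    for A t
  have "prob_space (P x)"
    using measurable_space[OF kernel, of x] by (simp add: space_prob_algebra)
  then interpret prob_space "P x" .
  have h_meas: "h A \<in> borel_measurable lborel" if [measurable]: "A \<in> sets borel" for A
  proof -
    have [measurable]: "(\<lambda>(t, \<omega>). X (max 0 t) \<omega>) \<in> borel_measurable (borel \<Otimes>\<^sub>M P x)"
      by (rule X_jointly_measurable)
    have "{z \<in> space (borel \<Otimes>\<^sub>M P x). (case z of (t, \<omega>) \<Rightarrow> X (max 0 t) \<omega>) \<in> A} \<in> sets (borel \<Otimes>\<^sub>M P x)"
      by measurable
    from measurable_emeasure_Pair[OF this]
    have [measurable]: "(\<lambda>t. emeasure (P x) {\<omega> \<in> \<Omega>. X (max 0 t) \<omega> \<in> A}) \<in> borel_measurable borel"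
      by (simp add: space_pair_measure space_P vimage_def)
    have "h A = (\<lambda>t. ennreal (exp (- r * t)) * emeasure (P x) {\<omega> \<in> \<Omega>. X (max 0 t) \<omega> \<in> A} * indicator {0..} t)"
      by (auto simp: h_def fun_eq_iff max_def indicator_def)
    then show ?thesis by simp
  qed
  have "emeasure (resolvent \<Omega> X P r x) A = (\<lambda>A. \<integral>\<^sup>+t. h A t \<partial>lborel) A"
    unfolding resolvent_def h_def[symmetric]
  proof (rule emeasure_measure_of_sigma)
    show "sigma_algebra UNIV (sets (borel :: real measure))"
      using sets.sigma_algebra_axioms[of "borel :: real measure"] by simp
    show "positive (sets borel) (\<lambda>A. \<integral>\<^sup>+t. h A t \<partial>lborel)"
      by (simp add: positive_def h_def)
    show "countably_additive (sets borel) (\<lambda>A. \<integral>\<^sup>+t. h A t \<partial>lborel)"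
      unfolding countably_additive_def
    proof (intro allI impI)
      fix B :: "nat \<Rightarrow> real set" assume B: "range B \<subseteq> sets borel" "disjoint_family B"
      have "(\<Sum>i. \<integral>\<^sup>+t. h (B i) t \<partial>lborel) = (\<integral>\<^sup>+t. (\<Sum>i. h (B i) t) \<partial>lborel)"
        using B h_meas by (intro nn_integral_suminf[symmetric]) auto
      also have "\<dots> = (\<integral>\<^sup>+t. h (\<Union>i. B i) t \<partial>lborel)"
      proof (rule nn_integral_cong)
        fix t :: real
        show "(\<Sum>i. h (B i) t) = h (\<Union>i. B i) t"
        proof (cases "0 \<le> t")
          case True
          have "{\<omega> \<in> \<Omega>. X t \<omega> \<in> B i} \<in> sets (P x)" for i
            using measurable_sets[OF X_measurable[OF True], of "B i"] B(1)
            by (auto simp: space_P vimage_def Int_def conj_commute)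
          then have "(\<Sum>i. emeasure (P x) {\<omega> \<in> \<Omega>. X t \<omega> \<in> B i}) =
              emeasure (P x) (\<Union>i. {\<omega> \<in> \<Omega>. X t \<omega> \<in> B i})"
            using B(2) by (intro suminf_emeasure) (auto simp: disjoint_family_on_def)
          also have "(\<Union>i. {\<omega> \<in> \<Omega>. X t \<omega> \<in> B i}) = {\<omega> \<in> \<Omega>. X t \<omega> \<in> (\<Union>i. B i)}" by auto
          finally show ?thesis using True by (simp add: h_def)
        qed (simp add: h_def)
      qed
      finally show "(\<Sum>i. \<integral>\<^sup>+t. h (B i) t \<partial>lborel) = (\<integral>\<^sup>+t. h (\<Union>i. B i) t \<partial>lborel)" .
    qed
  qed (rule assms)
  then show ?thesis by (simp add: h_def)
qed

text \<open>Transience in the potential-theoretic sense: the expected time spent in a compact set is finite.\<close>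

definition transient :: "'a set \<Rightarrow> (real \<Rightarrow> 'a \<Rightarrow> real) \<Rightarrow> (real \<Rightarrow> 'a measure) \<Rightarrow> bool" where
  "transient \<Omega> X P \<longleftrightarrow> (\<forall>x K. compact K \<longrightarrow> emeasure (resolvent \<Omega> X P 0 x) K < \<infinity>)"

definition excessive ::
  "(real \<Rightarrow> 'a \<Rightarrow> real) \<Rightarrow> (real \<Rightarrow> 'a measure) \<Rightarrow> real \<Rightarrow> (real \<Rightarrow> ennreal) \<Rightarrow> bool" where
  "excessive X P r f \<longleftrightarrow> f \<in> borel_measurable borel \<and>
     (\<forall>x. (\<forall>t\<ge>0. ennreal (exp (- r * t)) * (\<integral>\<^sup>+\<omega>. f (X t \<omega>) \<partial>P x) \<le> f x) \<and>
          ((\<lambda>t. ennreal (exp (- r * t)) * (\<integral>\<^sup>+\<omega>. f (X t \<omega>) \<partial>P x)) \<longlongrightarrow> f x) (at_right 0))"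

definition B\<^sub>o :: "(real \<Rightarrow> real) set" where
  "B\<^sub>o = {f \<in> borel_measurable borel. bounded (range f) \<and> compact (closure {x. f x \<noteq> 0})}"

text \<open>
  The duality relation is stated for nonnegative \<open>f\<close> and \<open>g\<close>, where both sides are always
  meaningful; the signed case follows by linearity whenever the integrals exist.
\<close>

locale green_duality =
  X: hunt_process \<Omega> X P + dual: hunt_process \<Omega>' X' P'
  for \<Omega> :: "'a set" and X :: "real \<Rightarrow> 'a \<Rightarrow> real" and P :: "real \<Rightarrow> 'a measure"
  and \<Omega>' :: "'b set" and X' :: "real \<Rightarrow> 'b \<Rightarrow> real" and P' :: "real \<Rightarrow> 'b measure" +
  fixes m :: "real measure" and G :: "real \<Rightarrow> real \<Rightarrow> real \<Rightarrow> ennreal"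
  assumes transient: "transient \<Omega> X P"
    and dual_transient: "transient \<Omega>' X' P'"
    and sigma_finite_m: "sigma_finite_measure m" and sets_m: "sets m = sets borel"
    and duality: "\<lbrakk>0 \<le> r; f \<in> B\<^sub>o; g \<in> B\<^sub>o; \<And>x. 0 \<le> f x; \<And>x. 0 \<le> g x\<rbrakk> \<Longrightarrow>
      (\<integral>\<^sup>+x. ennreal (f x) * (\<integral>\<^sup>+y. ennreal (g y) \<partial>resolvent \<Omega> X P r x) \<partial>m) =
      (\<integral>\<^sup>+x. (\<integral>\<^sup>+y. ennreal (f y) \<partial>resolvent \<Omega>' X' P' r x) * ennreal (g x) \<partial>m)"
    and h1: "0 \<le> r \<Longrightarrow> resolvent \<Omega> X P r x = density m (\<lambda>y. G r x y)"
    and h2: "\<lbrakk>compact A; compact B\<rbrakk> \<Longrightarrow> (SUP x\<in>A. emeasure (resolvent \<Omega> X P 0 x) B) < \<infinity>"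
    and h3: "\<lbrakk>0 \<le> r; f \<in> B\<^sub>o\<rbrakk> \<Longrightarrow>
      (\<forall>x. integrable (resolvent \<Omega>' X' P' r x) f) \<and>
      continuous_on UNIV (\<lambda>x. \<integral>y. f y \<partial>resolvent \<Omega>' X' P' r x)"
    and green_measurable: "0 \<le> r \<Longrightarrow> (\<lambda>(x, y). G r x y) \<in> borel_measurable (borel \<Otimes>\<^sub>M borel)"
    and green_dual: "0 \<le> r \<Longrightarrow> resolvent \<Omega>' X' P' r y = density m (\<lambda>x. G r x y)"
    and green_excessive: "0 \<le> r \<Longrightarrow> excessive X P r (\<lambda>x. G r x y)"
    and green_coexcessive: "0 \<le> r \<Longrightarrow> excessive X' P' r (\<lambda>y. G r x y)"

text \<open>Every locally finite Borel measure on the line is regular, so local finiteness suffices.\<close>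

definition radon_measure :: "real measure \<Rightarrow> bool" where
  "radon_measure \<sigma> \<longleftrightarrow> sets \<sigma> = sets borel \<and> (\<forall>K. compact K \<longrightarrow> emeasure \<sigma> K < \<infinity>)"

definition stopping_times ::
  "'a set \<Rightarrow> (real \<Rightarrow> 'a \<Rightarrow> real) \<Rightarrow> (real \<Rightarrow> 'a measure) \<Rightarrow> ('a \<Rightarrow> ennreal) set" where
  "stopping_times \<Omega> X P = {\<tau>. stopping_time (natural_filtration \<Omega> X P) \<tau>}"

definition entrance_time :: "(real \<Rightarrow> 'a \<Rightarrow> real) \<Rightarrow> real set \<Rightarrow> 'a \<Rightarrow> ennreal" where
  "entrance_time X S \<omega> = Inf {ennreal t | t. 0 \<le> t \<and> X t \<omega> \<in> S}"

definition discounted_reward ::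
  "(real \<Rightarrow> 'a \<Rightarrow> real) \<Rightarrow> real \<Rightarrow> (real \<Rightarrow> real) \<Rightarrow> ('a \<Rightarrow> ennreal) \<Rightarrow> 'a \<Rightarrow> ennreal" where
  "discounted_reward X r g \<tau> \<omega> =
     (if \<tau> \<omega> = \<infinity> then Limsup at_top (\<lambda>t::real. ennreal (exp (- r * t) * g (X t \<omega>)))
      else ennreal (exp (- r * enn2real (\<tau> \<omega>)) * g (X (enn2real (\<tau> \<omega>)) \<omega>)))"

text \<open>
  For a stopping time of the augmented filtration the reward is measurable only with respect to the
  completion of \<open>P x\<close>.
\<close>

definition expected_reward ::
  "(real \<Rightarrow> 'a \<Rightarrow> real) \<Rightarrow> (real \<Rightarrow> 'a measure) \<Rightarrow> real \<Rightarrow> (real \<Rightarrow> real) \<Rightarrow> real \<Rightarrow>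
   ('a \<Rightarrow> ennreal) \<Rightarrow> ennreal" where
  "expected_reward X P r g x \<tau> = (\<integral>\<^sup>+\<omega>. discounted_reward X r g \<tau> \<omega> \<partial>completion (P x))"

end

theory Submission
  imports Defs
begin

text \<open>
The discounted process \<open>e\<^sup>-\<^sup>r\<^sup>t V (X t)\<close> is a nonnegative supermartingale,
because \<open>G r x y\<close> is excessive in \<open>x\<close> and \<open>V\<close> is a mixture of these functions. As \<open>V \<ge> g\<close>,
optional stopping bounds every expected reward by \<open>V x\<close>. On the event that the stopping time is
infinite the reward is an upper limit at infinity, and there one stops instead, at a late time, when
\<open>e\<^sup>-\<^sup>r\<^sup>t g (X t)\<close> comes close to a prediction of that upper limit (\<open>optional_stopping\<close>,
\<open>stopped_or_truncated_limsup_le\<close>, \<open>expected_reward_le\<close>).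

For the converse, \<open>V\<close> has to be reproduced by stopping at the entrance into \<open>S\<close>. Since \<open>\<sigma>\<close>
lives on \<open>S\<close>, it is enough to reproduce \<open>G r x y\<close> for \<open>y \<in> S\<close>. This can fail for the entrance into
\<open>S\<close> itself when \<open>y\<close> is a boundary point that is irregular for the dual process, but it holds for the
entrance time \<open>T\<close> into any open \<open>U \<supseteq> S\<close>: the strong Markov property gives
\<open>G r x y = E x [e\<^sup>-\<^sup>r\<^sup>T G r (X T) y]\<close> for \<open>m\<close>-almost every \<open>y \<in> U\<close>, and the inequality \<open>\<le>\<close> then extends
to every \<open>y \<in> U\<close>, because the left-hand side is coexcessive in \<open>y\<close>, hence lower semicontinuous, and
the right-hand side is cosupermedian (\<open>coexcessive_lower_semicontinuous\<close>,
\<open>coexcessive_domination_on_open\<close>, \<open>green_kernel_le_at_debut\<close>, \<open>potential_le_at_debut\<close>). The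
dual process enters in this step only.

Finally \<open>U\<close> shrinks to \<open>S\<close>. By quasi-left-continuity the entrance times and positions converge to
those of \<open>S\<close>, almost surely on the event that \<open>S\<close> is entered; this also shows that the entrance time
is a stopping time (\<open>entrance_time_stopping_time\<close>). Continuity of \<open>V\<close> and \<open>V = g\<close> on \<open>S\<close> turn the
limit of the stopped values into the reward, and the reverse Fatou lemma applies because \<open>V - g\<close> is
bounded and the supremum of the discounted reward is integrable (\<open>reward_at_entrance_ge\<close>).
\<close>

section \<open>Measurability and the Markov property\<close>

context hunt_process
begin

abbreviation raw :: "ennreal \<Rightarrow> 'a measure" where
  "raw \<equiv> raw_filtration \<Omega> X"

abbreviation natural :: "ennreal \<Rightarrow> 'a measure" where
  "natural \<equiv> natural_filtration \<Omega> X P"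

lemma kernel_subprob: "P \<in> borel \<rightarrow>\<^sub>M subprob_algebra (raw \<infinity>)"
  using kernel by (rule measurable_prob_algebraD)

lemma prob_space_P: "prob_space (P x)"
  using measurable_space[OF kernel, of x] by (simp add: space_prob_algebra)

lemma sets_P: "sets (P x) = sets (raw \<infinity>)"
  using measurable_space[OF kernel, of x] by (simp add: space_prob_algebra)

lemma raw_mono: "s \<le> t \<Longrightarrow> sets (raw s) \<subseteq> sets (raw t)"
  unfolding raw_filtration_def
  by (subst (1 2) sets_measure_of) (auto intro!: sigma_sets_mono' intro: order_trans)

lemma X_raw_measurable:
  assumes "0 \<le> s" "ennreal s \<le> t" shows "X s \<in> borel_measurable (raw t)"
proof (rule measurableI)
  fix A :: "real set" assume "A \<in> sets borel"
  then show "X s -` A \<inter> space (raw t) \<in> sets (raw t)"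
    using assms unfolding space_raw_filtration
    by (subst raw_filtration_def) (auto intro!: sigma_sets.Basic exI[of _ s] exI[of _ A])
qed simp

lemma raw_measurable_mono:
  "f \<in> raw s \<rightarrow>\<^sub>M N \<Longrightarrow> s \<le> t \<Longrightarrow> f \<in> raw t \<rightarrow>\<^sub>M N"
  using raw_mono[of s t] unfolding measurable_def by (auto simp: space_raw_filtration)

text \<open>
A set of the augmented filtration is a raw event up to a null set for every initial law; the Dirac
mass at \<open>x\<close> is the law that yields \<open>P x\<close>.
\<close>

lemma sets_natural_subset_completion: "sets (natural t) \<subseteq> sets (completion (P x))"
proof
  fix A assume "A \<in> sets (natural t)"
  moreover have "prob_space (return borel x)" "sets (return borel x) = sets (borel :: real measure)"
    by (auto intro: prob_space_return)
  ultimately obtain B where B: "B \<in> sets (raw \<infinity>)"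
    "(A - B) \<union> (B - A) \<in> null_sets (completion (return borel x \<bind> P))"
    unfolding sets_natural_filtration by blast
  have "return borel x \<bind> P = P x"
    by (rule bind_return[OF kernel_subprob]) simp
  with B have "A - B \<in> null_sets (completion (P x))" "B - A \<in> null_sets (completion (P x))"
    by (auto intro: null_sets_completion_subset)
  moreover have "B \<in> sets (completion (P x))"
    using B by (auto simp: sets_P)
  moreover have "A = (B - (B - A)) \<union> (A - B)" by auto
  ultimately show "A \<in> sets (completion (P x))"
    by (metis null_setsD2 sets.Diff sets.Un)
qed

lemma space_natural: "space (natural t) = \<Omega>"
  using filtration_natural_filtration[of \<Omega> X P] by (simp add: filtration_def)

lemma natural_stopping_time_measurable:
  assumes "stopping_time natural T"
  shows "T \<in> borel_measurable (completion (P x))"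
  by (rule measurable_stopping_time[OF assms])
     (auto simp: sets_natural_subset_completion[THEN subsetD] space_natural space_P)

lemma sets_natural_of_raw:
  assumes "A \<in> sets (raw \<infinity>)" "\<And>u. t < u \<Longrightarrow> A \<in> sets (raw u)"
  shows "A \<in> sets (natural t)"
  using assms sets.sets_into_space[OF assms(1)]
  unfolding sets_natural_filtration space_raw_filtration
  by (auto intro!: exI[of _ A])

lemma X_jointly_raw_measurable:
  "(\<lambda>(t, \<omega>). X (max 0 t) \<omega>) \<in> borel_measurable (borel \<Otimes>\<^sub>M raw \<infinity>)"
  using X_jointly_measurable[of 0]
  by (simp cong: measurable_cong_sets sets_pair_measure_cong add: sets_pair_measure_cong[OF refl sets_P])

lemma X_at_random_time_raw:
  assumes T[measurable]: "T \<in> borel_measurable (raw \<infinity>)" and nonneg: "\<And>\<omega>. \<omega> \<in> \<Omega> \<Longrightarrow> 0 \<le> T \<omega>"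
  shows "(\<lambda>\<omega>. X (T \<omega>) \<omega>) \<in> borel_measurable (raw \<infinity>)"
proof -
  note [measurable] = X_jointly_raw_measurable
  have "(\<lambda>\<omega>. (\<lambda>(t, \<omega>). X (max 0 t) \<omega>) (T \<omega>, \<omega>)) \<in> borel_measurable (raw \<infinity>)"
    by measurable
  then show ?thesis
    by (rule measurable_cong[THEN iffD1, rotated]) (auto simp: space_raw_filtration nonneg max_def)
qed

lemma X_at_random_time:
  assumes T[measurable]: "T \<in> borel_measurable (completion (P x))"
    and nonneg: "\<And>\<omega>. \<omega> \<in> \<Omega> \<Longrightarrow> 0 \<le> T \<omega>"
  shows "(\<lambda>\<omega>. X (T \<omega>) \<omega>) \<in> borel_measurable (completion (P x))"
proof -
  note [measurable] = X_jointly_measurable[of x]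
  have [measurable]: "(\<lambda>\<omega>. \<omega>) \<in> completion (P x) \<rightarrow>\<^sub>M P x"
    by (rule measurable_completion) simp
  have "(\<lambda>\<omega>. (\<lambda>(t, \<omega>). X (max 0 t) \<omega>) (T \<omega>, \<omega>)) \<in> borel_measurable (completion (P x))"
    by measurable
  then show ?thesis
    by (rule measurable_cong[THEN iffD1, rotated]) (auto simp: space_P nonneg max_def)
qed

lemma transition_measurable_joint:
  assumes [measurable]: "f \<in> borel_measurable borel"
  shows "(\<lambda>(z, t). \<integral>\<^sup>+\<eta>. f (X (max 0 t) \<eta>) \<partial>P z) \<in> borel_measurable (borel \<Otimes>\<^sub>M (borel :: real measure))"
proof -
  have "(\<lambda>p. \<integral>\<^sup>+\<eta>. f (X (max 0 (snd p)) \<eta>) \<partial>P (fst p)) \<in> borel_measurable (borel \<Otimes>\<^sub>M (borel :: real measure))"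
  proof (rule nn_integral_measurable_subprob_algebra2[where N="raw \<infinity>"])
    show "(\<lambda>p. P (fst p)) \<in> borel \<Otimes>\<^sub>M borel \<rightarrow>\<^sub>M subprob_algebra (raw \<infinity>)"
      by (rule measurable_compose[OF measurable_fst kernel_subprob])
    have [measurable]: "(\<lambda>q. X (max 0 (fst q)) (snd q)) \<in> borel_measurable (borel \<Otimes>\<^sub>M raw \<infinity>)"
      using X_jointly_raw_measurable by (simp add: split_beta')
    have "(\<lambda>q. (\<lambda>q. X (max 0 (fst q)) (snd q)) (snd (fst q), snd q))
        \<in> borel_measurable ((borel \<Otimes>\<^sub>M borel) \<Otimes>\<^sub>M raw \<infinity>)"
      by measurable
    then show "(\<lambda>(p, \<eta>). f (X (max 0 (snd p)) \<eta>))
        \<in> borel_measurable ((borel \<Otimes>\<^sub>M borel) \<Otimes>\<^sub>M raw \<infinity>)"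
      using measurable_compose[OF _ assms] by (fastforce simp: split_beta')
  qed
  then show ?thesis by (simp add: split_beta')
qed

lemma transition_measurable:
  assumes "f \<in> borel_measurable borel" "0 \<le> t"
  shows "(\<lambda>z. \<integral>\<^sup>+\<eta>. f (X t \<eta>) \<partial>P z) \<in> borel_measurable borel"
proof -
  have "(\<lambda>z. (\<lambda>(z, t). \<integral>\<^sup>+\<eta>. f (X (max 0 t) \<eta>) \<partial>P z) (z, t)) \<in> borel_measurable borel"
    by (rule measurable_compose[OF _ transition_measurable_joint[OF assms(1)]]) simp
  then show ?thesis using assms(2) by simp
qed

text \<open>
The strong Markov property for events in the \<open>\<sigma>\<close>-algebra of the past of \<open>T\<close> extends, by a monotone
class argument, to weights that are functions of \<open>T\<close>. The discount factor is such a weight.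
\<close>

lemma strong_markov_weighted:
  assumes T: "stopping_time natural T" and t: "0 \<le> t"
    and f[measurable]: "(f :: real \<Rightarrow> ennreal) \<in> borel_measurable borel"
    and w: "(w :: ennreal \<Rightarrow> ennreal) \<in> borel_measurable borel"
  shows "(\<integral>\<^sup>+\<omega>. w (T \<omega>) * (f (X (enn2real (T \<omega>) + t) \<omega>) * indicator {\<omega>. T \<omega> < \<infinity>} \<omega>) \<partial>completion (P x)) =
    (\<integral>\<^sup>+\<omega>. w (T \<omega>) * ((\<integral>\<^sup>+\<eta>. f (X t \<eta>) \<partial>P (X (enn2real (T \<omega>)) \<omega>)) * indicator {\<omega>. T \<omega> < \<infinity>} \<omega>) \<partial>completion (P x))"
proof -
  interpret filtration \<Omega> natural by (rule filtration_natural_filtration)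
  have [measurable]: "T \<in> borel_measurable (completion (P x))"
    by (rule natural_stopping_time_measurable[OF T])
  have [measurable]: "(\<lambda>\<omega>. X (enn2real (T \<omega>) + t) \<omega>) \<in> borel_measurable (completion (P x))"
    "(\<lambda>\<omega>. X (enn2real (T \<omega>)) \<omega>) \<in> borel_measurable (completion (P x))"
    using t by (auto intro!: X_at_random_time)
  note [measurable] = transition_measurable[OF f t]
  define F where "F \<omega> = f (X (enn2real (T \<omega>) + t) \<omega>) * indicator {\<omega>. T \<omega> < \<infinity>} \<omega>" for \<omega>
  define H where "H \<omega> = (\<integral>\<^sup>+\<eta>. f (X t \<eta>) \<partial>P (X (enn2real (T \<omega>)) \<omega>)) * indicator {\<omega>. T \<omega> < \<infinity>} \<omega>" for \<omega>
  have [measurable]: "F \<in> borel_measurable (completion (P x))" "H \<in> borel_measurable (completion (P x))"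
    unfolding F_def H_def by measurable
  from w have "(\<integral>\<^sup>+\<omega>. w (T \<omega>) * F \<omega> \<partial>completion (P x)) = (\<integral>\<^sup>+\<omega>. w (T \<omega>) * H \<omega> \<partial>completion (P x))"
  proof (induction w rule: borel_measurable_induct)
    case (cong f g)
    then show ?case by simp
  next
    case (set B)
    have "T -` B \<inter> \<Omega> \<in> sets (pre_sigma T)"
      using measurable_sets[OF measurable_stopping_time_pre_sigma[OF T] set]
      by (simp add: space_pre_sigma)
    from strong_markov[OF T this t f, of x] have
      "(\<integral>\<^sup>+\<omega>. F \<omega> * indicator (T -` B \<inter> \<Omega>) \<omega> \<partial>completion (P x)) =
       (\<integral>\<^sup>+\<omega>. H \<omega> * indicator (T -` B \<inter> \<Omega>) \<omega> \<partial>completion (P x))"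
      unfolding F_def H_def by (simp add: indicator_inter_arith ac_simps)
    moreover have "(\<integral>\<^sup>+\<omega>. indicator B (T \<omega>) * K \<omega> \<partial>completion (P x)) =
       (\<integral>\<^sup>+\<omega>. K \<omega> * indicator (T -` B \<inter> \<Omega>) \<omega> \<partial>completion (P x))" for K
      by (rule nn_integral_cong) (auto simp: space_P indicator_def)
    ultimately show ?case by simp
  next
    case (mult u c)
    note [measurable] = mult(2)
    show ?case using mult(4) by (simp add: mult.assoc nn_integral_cmult)
  next
    case (add u v)
    note [measurable] = add.hyps(1,3)
    show ?case using add by (simp add: distrib_right nn_integral_add)
  next
    case (seq U)
    note [measurable] = seq(1)
    have mono: "incseq (\<lambda>i \<omega>. U i (T \<omega>) * K \<omega>)" for K
      using seq(3) by (auto simp: incseq_def le_fun_def intro!: mult_right_mono)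
    have lim: "(\<integral>\<^sup>+\<omega>. (SUP i. U i) (T \<omega>) * K \<omega> \<partial>completion (P x)) =
        (SUP i. \<integral>\<^sup>+\<omega>. U i (T \<omega>) * K \<omega> \<partial>completion (P x))"
      if [measurable]: "K \<in> borel_measurable (completion (P x))" for K
      unfolding SUP_apply SUP_mult_right_ennreal
      by (rule nn_integral_monotone_convergence_SUP[OF mono]) measurable
    have "F \<in> borel_measurable (completion (P x))" "H \<in> borel_measurable (completion (P x))"
      by measurable
    with seq.IH show ?case by (simp only: lim)
  qed
  then show ?thesis unfolding F_def H_def .
qed

lemma markov:
  assumes A: "A \<in> sets (natural (ennreal t))" and t: "0 \<le> t" "0 \<le> s"
    and f: "(f :: real \<Rightarrow> ennreal) \<in> borel_measurable borel"
  shows "(\<integral>\<^sup>+\<omega>\<in>A. f (X (t + s) \<omega>) \<partial>completion (P x)) =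
    (\<integral>\<^sup>+\<omega>\<in>A. (\<integral>\<^sup>+\<eta>. f (X s \<eta>) \<partial>P (X t \<omega>)) \<partial>completion (P x))"
proof -
  interpret filtration \<Omega> natural by (rule filtration_natural_filtration)
  have T: "stopping_time natural (\<lambda>_. ennreal t)" by (rule stopping_time_const)
  have "A \<in> sets (pre_sigma (\<lambda>_. ennreal t))"
  proof (rule sets_pre_sigmaI[OF T])
    fix u show "{\<omega> \<in> A. ennreal t \<le> u} \<in> sets (natural u)"
      using A sets_F_mono[of "ennreal t" u] by (cases "ennreal t \<le> u") auto
  qed
  from strong_markov[OF T this t(2) f] t show ?thesis by simp
qed

end

section \<open>Debuts of right-continuous processes\<close>

text \<open>
The first time, not before \<open>k\<close>, at which \<open>W\<close> is positive. Entrance times into an open set are the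
case in which \<open>W\<close> is a continuous function of the position that is positive exactly on that set.
\<close>

definition debut :: "real \<Rightarrow> (real \<Rightarrow> 'a \<Rightarrow> real) \<Rightarrow> 'a \<Rightarrow> ennreal" where
  "debut k W \<omega> = Inf {ennreal t | t. k \<le> t \<and> 0 < W t \<omega>}"

lemma debut_ge: "ennreal k \<le> debut k W \<omega>"
  unfolding debut_def by (rule Inf_greatest) (auto intro: ennreal_leI)

lemma debut_le: "k \<le> t \<Longrightarrow> 0 < W t \<omega> \<Longrightarrow> debut k W \<omega> \<le> ennreal t"
  unfolding debut_def by (rule Inf_lower) auto

text \<open>
A right-continuous path that is positive at some time stays positive for a short while, so a rational
time is a witness as well. Hence the event on the left is a countable union of observable events.
\<close>

lemma debut_less_iff:
  assumes k: "0 \<le> k"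
    and rc: "\<And>t. k \<le> t \<Longrightarrow> continuous (at_right t) (\<lambda>s. W s \<omega>)"
  shows "debut k W \<omega> < u \<longleftrightarrow> (\<exists>q\<in>\<rat>. k \<le> q \<and> ennreal q < u \<and> 0 < W q \<omega>)"
proof
  assume "debut k W \<omega> < u"
  then obtain t where t: "k \<le> t" "0 < W t \<omega>" "ennreal t < u"
    unfolding debut_def Inf_less_iff by auto
  have "((\<lambda>s. W s \<omega>) \<longlongrightarrow> W t \<omega>) (at_right t)"
    using rc[OF t(1)] by (simp add: continuous_within)
  then have "\<forall>\<^sub>F s in at_right t. 0 < W s \<omega>"
    using t(2) by (rule order_tendstoD)
  moreover have "((\<lambda>s. ennreal s) \<longlongrightarrow> ennreal t) (at_right t)"
    by (intro tendsto_intros)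
  then have "\<forall>\<^sub>F s in at_right t. ennreal s < u"
    using t(3) by (rule order_tendstoD)
  ultimately have "\<forall>\<^sub>F s in at_right t. 0 < W s \<omega> \<and> ennreal s < u"
    by eventually_elim simp
  then obtain b where b: "t < b" "\<And>s. t < s \<Longrightarrow> s < b \<Longrightarrow> 0 < W s \<omega> \<and> ennreal s < u"
    unfolding eventually_at_right_field by auto
  from Rats_dense_in_real[OF b(1)] obtain q where "q \<in> \<rat>" "t < q" "q < b" by auto
  with b(2)[of q] t(1) show "\<exists>q\<in>\<rat>. k \<le> q \<and> ennreal q < u \<and> 0 < W q \<omega>"
    by (intro bexI[of _ q]) auto
next
  assume "\<exists>q\<in>\<rat>. k \<le> q \<and> ennreal q < u \<and> 0 < W q \<omega>"
  then show "debut k W \<omega> < u"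
    using debut_le[of k _ W \<omega>] by (meson le_less_trans)
qed

text \<open>
If \<open>W\<close> were negative at the debut, it would stay negative for a short while, so that the infimum would
be larger. The value may be zero: the debut is an infimum that need not be attained.
\<close>

lemma debut_value_nonneg:
  assumes k: "0 \<le> k"
    and rc: "\<And>t. k \<le> t \<Longrightarrow> continuous (at_right t) (\<lambda>s. W s \<omega>)"
    and fin: "debut k W \<omega> < \<infinity>"
  shows "0 \<le> W (enn2real (debut k W \<omega>)) \<omega>"
proof (rule ccontr)
  define T where "T = enn2real (debut k W \<omega>)"
  have T: "debut k W \<omega> = ennreal T" "0 \<le> T"
    using fin by (auto simp: T_def less_top)
  have "k \<le> T"
    using debut_ge[of k W \<omega>] T k by (simp add: ennreal_le_iff)
  assume "\<not> 0 \<le> W (enn2real (debut k W \<omega>)) \<omega>"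
  then have neg: "W T \<omega> < 0" by (simp add: T_def)
  have "((\<lambda>s. W s \<omega>) \<longlongrightarrow> W T \<omega>) (at_right T)"
    using rc[OF \<open>k \<le> T\<close>] by (simp add: continuous_within)
  then have "\<forall>\<^sub>F s in at_right T. W s \<omega> < 0"
    using neg by (rule order_tendstoD)
  then obtain b where b: "T < b" "\<And>s. T < s \<Longrightarrow> s < b \<Longrightarrow> W s \<omega> < 0"
    unfolding eventually_at_right_field by auto
  have "ennreal b \<le> debut k W \<omega>"
    unfolding debut_def
  proof (rule Inf_greatest, clarify)
    fix t assume t: "k \<le> t" "0 < W t \<omega>"
    then have "T \<le> t"
      using debut_le[of k t W \<omega>] T k by simp
    with b(2)[of t] neg t show "ennreal b \<le> ennreal t"
      by (intro ennreal_leI) (cases "T = t", auto simp: not_le[symmetric])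
  qed
  with T b show False by simp
qed

context hunt_process
begin

context
  fixes k :: real and W :: "real \<Rightarrow> 'a \<Rightarrow> real"
  assumes k: "0 \<le> k"
    and adapted: "\<And>t. k \<le> t \<Longrightarrow> W t \<in> borel_measurable (raw (ennreal t))"
    and rc: "\<And>\<omega> t. \<omega> \<in> \<Omega> \<Longrightarrow> k \<le> t \<Longrightarrow> continuous (at_right t) (\<lambda>s. W s \<omega>)"
begin

lemma debut_less_raw: "{\<omega> \<in> \<Omega>. debut k W \<omega> < u} \<in> sets (raw u)"
proof -
  have "debut k W \<omega> < u \<longleftrightarrow> (\<exists>q\<in>\<rat>. k \<le> q \<and> ennreal q < u \<and> 0 < W q \<omega>)" if "\<omega> \<in> \<Omega>" for \<omega>
    using rc[OF that] by (rule debut_less_iff[OF k])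
  then have "{\<omega> \<in> \<Omega>. debut k W \<omega> < u} =
      (\<Union>q\<in>{q\<in>\<rat>. k \<le> q \<and> ennreal q < u}. {\<omega> \<in> space (raw u). 0 < W q \<omega>})"
    by (auto simp: space_raw_filtration)
  moreover have "{\<omega> \<in> space (raw u). 0 < W q \<omega>} \<in> sets (raw u)" if "k \<le> q" "ennreal q < u" for q
  proof -
    have [measurable]: "W q \<in> borel_measurable (raw u)"
      by (rule raw_measurable_mono[OF adapted[OF that(1)] less_imp_le[OF that(2)]])
    show ?thesis by measurable
  qed
  moreover have "countable {q\<in>\<rat>. k \<le> q \<and> ennreal q < u}"
    by (rule countable_subset[OF _ countable_rat]) auto
  ultimately show ?thesis
    by (simp only:) (rule sets.countable_UN'', auto)
qed

lemma debut_measurable_raw: "debut k W \<in> borel_measurable (raw \<infinity>)"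
proof (rule borel_measurableI_less)
  fix u
  show "{\<omega> \<in> space (raw \<infinity>). debut k W \<omega> < u} \<in> sets (raw \<infinity>)"
    using debut_less_raw[of u] raw_mono[of u \<infinity>] by (auto simp: space_raw_filtration)
qed

text \<open>
Whether the debut occurs at time \<open>t\<close> exactly is decided only after an infinitesimal look into the
future; this is why \<open>u > t\<close> is required, and why the right limits of the raw filtration suffice.
\<close>

lemma debut_le_raw:
  assumes "t < u"
  shows "{\<omega> \<in> \<Omega>. debut k W \<omega> \<le> t} \<in> sets (raw u)"
proof -
  obtain v where v: "\<And>n::nat. t < v n" "v \<longlonglongrightarrow> t"
    using approx_from_above_dense_linorder[OF assms] by auto
  have "{\<omega> \<in> \<Omega>. debut k W \<omega> \<le> t} = (\<Inter>n. {\<omega> \<in> \<Omega>. debut k W \<omega> < min u (v n)})"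
  proof safe
    fix \<omega> n assume "debut k W \<omega> \<le> t"
    then show "debut k W \<omega> < min u (v n)" using v(1)[of n] assms by auto
  next
    fix \<omega> assume "\<omega> \<in> (\<Inter>n. {\<omega> \<in> \<Omega>. debut k W \<omega> < min u (v n)})"
    then have "debut k W \<omega> \<le> v n" for n by (auto intro: less_imp_le)
    then show "debut k W \<omega> \<le> t" by (intro LIMSEQ_le_const[OF v(2)]) auto
  qed auto
  moreover have "{\<omega> \<in> \<Omega>. debut k W \<omega> < min u (v n)} \<in> sets (raw u)" for n
    using debut_less_raw[of "min u (v n)"] raw_mono[of "min u (v n)" u] by auto
  ultimately show ?thesis by auto
qed

lemma debut_stopping_time: "stopping_time natural (debut k W)"
proof (rule stopping_timeI)
  fix t
  have "{\<omega> \<in> space (raw \<infinity>). debut k W \<omega> \<le> t} \<in> sets (raw \<infinity>)"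
    using debut_measurable_raw by measurable
  then have "{\<omega> \<in> \<Omega>. debut k W \<omega> \<le> t} \<in> sets (natural t)"
    by (intro sets_natural_of_raw[OF _ debut_le_raw]) (simp_all add: space_raw_filtration)
  then show "Measurable.pred (natural t) (\<lambda>\<omega>. debut k W \<omega> \<le> t)"
    by (simp add: pred_def space_natural)
qed

end

context
  fixes \<phi> :: "real \<Rightarrow> real"
  assumes \<phi>: "continuous_on UNIV \<phi>"
begin

lemma continuous_image_adapted: "0 \<le> t \<Longrightarrow> (\<lambda>\<omega>. \<phi> (X t \<omega>)) \<in> borel_measurable (raw (ennreal t))"
  using borel_measurable_continuous_onI[OF \<phi>] X_raw_measurable[OF _ order_refl]
  by (rule measurable_compose[rotated])

lemma continuous_image_right_continuous:
  assumes "\<omega> \<in> \<Omega>" "0 \<le> t"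
  shows "continuous (at_right t) (\<lambda>s. \<phi> (X s \<omega>))"
proof -
  have "((\<lambda>s. X s \<omega>) \<longlongrightarrow> X t \<omega>) (at_right t)"
    using right_continuous_paths[OF assms] by (simp add: continuous_within)
  then show ?thesis
    unfolding continuous_within by (rule continuous_on_tendsto_compose[OF \<phi>]) auto
qed

lemma entrance_measurable_raw: "debut 0 (\<lambda>t \<omega>. \<phi> (X t \<omega>)) \<in> borel_measurable (raw \<infinity>)"
  by (intro debut_measurable_raw order_refl continuous_image_adapted continuous_image_right_continuous)

lemma entrance_stopping_time: "stopping_time natural (debut 0 (\<lambda>t \<omega>. \<phi> (X t \<omega>)))"
  by (intro debut_stopping_time order_refl continuous_image_adapted continuous_image_right_continuous)

lemma entrance_position_measurable_raw:
  "(\<lambda>\<omega>. X (enn2real (debut 0 (\<lambda>t \<omega>. \<phi> (X t \<omega>)) \<omega>)) \<omega>) \<in> borel_measurable (raw \<infinity>)"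
  by (intro X_at_random_time_raw measurable_compose[OF entrance_measurable_raw]) auto

lemma entrance_position_nonneg:
  assumes "\<omega> \<in> \<Omega>" "debut 0 (\<lambda>t \<omega>. \<phi> (X t \<omega>)) \<omega> < \<infinity>"
  shows "0 \<le> \<phi> (X (enn2real (debut 0 (\<lambda>t \<omega>. \<phi> (X t \<omega>)) \<omega>)) \<omega>)"
  using assms
  by (intro debut_value_nonneg[where W="\<lambda>t \<omega>. \<phi> (X t \<omega>)"] order_refl continuous_image_right_continuous)

end

section \<open>Optional stopping of discounted supermedian functions\<close>

context
  fixes r :: real and V :: "real \<Rightarrow> ennreal"
  assumes V_cont: "continuous_on UNIV V"
    and supermedian: "\<And>x t. 0 \<le> t \<Longrightarrow> ennreal (exp (- r * t)) * (\<integral>\<^sup>+\<omega>. V (X t \<omega>) \<partial>P x) \<le> V x"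
begin

lemma V_borel: "V \<in> borel_measurable borel"
  using V_cont by (rule borel_measurable_continuous_onI)

lemma discounted_supermartingale:
  assumes A: "A \<in> sets (natural (ennreal t))" and t: "0 \<le> t" "0 \<le> s"
  shows "(\<integral>\<^sup>+\<omega>\<in>A. ennreal (exp (- r * (t + s))) * V (X (t + s) \<omega>) \<partial>completion (P x)) \<le>
    (\<integral>\<^sup>+\<omega>\<in>A. ennreal (exp (- r * t)) * V (X t \<omega>) \<partial>completion (P x))"
proof -
  note [measurable] = V_borel transition_measurable[OF V_borel t(2)]
  have [measurable]: "A \<in> sets (completion (P x))"
    using A sets_natural_subset_completion by blast
  have [measurable]: "X (t + s) \<in> borel_measurable (completion (P x))" "X t \<in> borel_measurable (completion (P x))"
    using t by (auto intro!: measurable_completion X_measurable)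
  have exp: "ennreal (exp (- r * (t + s))) = ennreal (exp (- r * t)) * ennreal (exp (- r * s))"
    by (simp add: ennreal_mult[symmetric] exp_add[symmetric] algebra_simps)
  have "(\<integral>\<^sup>+\<omega>\<in>A. ennreal (exp (- r * (t + s))) * V (X (t + s) \<omega>) \<partial>completion (P x)) =
      ennreal (exp (- r * (t + s))) * (\<integral>\<^sup>+\<omega>\<in>A. V (X (t + s) \<omega>) \<partial>completion (P x))"
    by (simp add: mult.assoc nn_integral_cmult)
  also have "\<dots> = ennreal (exp (- r * (t + s))) * (\<integral>\<^sup>+\<omega>\<in>A. (\<integral>\<^sup>+\<eta>. V (X s \<eta>) \<partial>P (X t \<omega>)) \<partial>completion (P x))"
    by (simp add: markov[OF A t V_borel])
  also have "\<dots> = (\<integral>\<^sup>+\<omega>\<in>A. ennreal (exp (- r * t)) *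
      (ennreal (exp (- r * s)) * (\<integral>\<^sup>+\<eta>. V (X s \<eta>) \<partial>P (X t \<omega>))) \<partial>completion (P x))"
    unfolding exp by (simp add: mult.assoc nn_integral_cmult)
  also have "\<dots> \<le> (\<integral>\<^sup>+\<omega>\<in>A. ennreal (exp (- r * t)) * V (X t \<omega>) \<partial>completion (P x))"
    by (intro nn_integral_mono mult_mono supermedian t) auto
  finally show ?thesis .
qed

text \<open>
Discretising the stopping time upwards to the next multiple of \<open>\<delta>\<close>. The induction keeps track of the
mass already stopped and of the mass still running, the latter evaluated at the current grid time;
one step of the grid lowers the total by the supermartingale inequality.
\<close>

lemma optional_stopping_grid:
  fixes \<delta> :: real
  assumes T: "stopping_time natural T" and \<delta>: "0 < \<delta>"
  defines "Y \<equiv> \<lambda>t \<omega>. ennreal (exp (- r * t)) * V (X t \<omega>)"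
  defines "A \<equiv> \<lambda>j::nat. {\<omega> \<in> \<Omega>. ennreal (real j * \<delta>) \<le> T \<omega> \<and> T \<omega> < ennreal (real (Suc j) * \<delta>)}"
  shows "(\<integral>\<^sup>+\<omega>. (\<Sum>j. Y (real (Suc j) * \<delta>) \<omega> * indicator (A j) \<omega>) \<partial>completion (P x)) \<le> V x"
proof -
  interpret filtration \<Omega> natural by (rule filtration_natural_filtration)
  note [measurable] = V_borel natural_stopping_time_measurable[OF T, of x]
  have [measurable]: "X (real j * \<delta>) \<in> borel_measurable (completion (P x))" for j :: nat
    using \<delta> by (intro measurable_completion X_measurable) simp
  have Y[measurable]: "Y (real j * \<delta>) \<in> borel_measurable (completion (P x))" for j :: nat
    unfolding Y_def by measurable
  note Y' = Y[of "Suc _"]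
  define B where "B j = {\<omega> \<in> \<Omega>. ennreal (real j * \<delta>) \<le> T \<omega>}" for j :: nat
  have B_natural: "B j \<in> sets (natural (ennreal (real j * \<delta>)))" for j
  proof -
    have "Measurable.pred (natural (ennreal (real j * \<delta>))) (\<lambda>\<omega>. \<not> T \<omega> < ennreal (real j * \<delta>))"
      by (intro pred_intros_logic stopping_time_less_const[OF T])
    then show ?thesis by (simp add: pred_def space_natural B_def not_less)
  qed
  have [measurable]: "B j \<in> sets (completion (P x))" for j
    using B_natural sets_natural_subset_completion by blast
  have B_step: "B (Suc j) \<subseteq> B j" for j
    using \<delta> by (auto simp: B_def elim!: order_trans[rotated] intro!: ennreal_leI)
  have A_eq: "A j = B j - B (Suc j)" for j
    by (auto simp: A_def B_def)
  then have [measurable]: "A j \<in> sets (completion (P x))" for j by simp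
  have partial: "(\<Sum>j<n. \<integral>\<^sup>+\<omega>\<in>A j. Y (real (Suc j) * \<delta>) \<omega> \<partial>completion (P x)) +
      (\<integral>\<^sup>+\<omega>\<in>B n. Y (real n * \<delta>) \<omega> \<partial>completion (P x)) \<le> V x" for n
  proof (induction n)
    case 0
    have "(\<integral>\<^sup>+\<omega>\<in>B 0. Y (real 0 * \<delta>) \<omega> \<partial>completion (P x)) \<le> (\<integral>\<^sup>+\<omega>. V x \<partial>P x)"
      unfolding nn_integral_completion
      by (rule nn_integral_mono_AE) (use normal[of x] in eventually_elim, auto simp: Y_def indicator_def)
    also have "\<dots> = V x"
      using prob_space.emeasure_space_1[OF prob_space_P] by simp
    finally show ?case by simp
  next
    case (Suc n)
    have "(\<integral>\<^sup>+\<omega>\<in>A n. Y (real (Suc n) * \<delta>) \<omega> \<partial>completion (P x)) +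
        (\<integral>\<^sup>+\<omega>\<in>B (Suc n). Y (real (Suc n) * \<delta>) \<omega> \<partial>completion (P x)) =
        (\<integral>\<^sup>+\<omega>. (Y (real (Suc n) * \<delta>) \<omega> * indicator (A n) \<omega> +
          Y (real (Suc n) * \<delta>) \<omega> * indicator (B (Suc n)) \<omega>) \<partial>completion (P x))"
      using Y'[of n] by (subst nn_integral_add) auto
    also have "\<dots> = (\<integral>\<^sup>+\<omega>\<in>B n. Y (real n * \<delta> + \<delta>) \<omega> \<partial>completion (P x))"
      using B_step[of n]
      by (intro nn_integral_cong) (auto simp: A_eq indicator_def algebra_simps)
    also have "\<dots> \<le> (\<integral>\<^sup>+\<omega>\<in>B n. Y (real n * \<delta>) \<omega> \<partial>completion (P x))"
      unfolding Y_def using \<delta> by (intro discounted_supermartingale B_natural) auto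
    finally show ?case
      using Suc by (simp add: add.assoc) (meson add_left_mono order_trans)
  qed
  have "(\<integral>\<^sup>+\<omega>. (\<Sum>j. Y (real (Suc j) * \<delta>) \<omega> * indicator (A j) \<omega>) \<partial>completion (P x)) =
      (\<Sum>j. \<integral>\<^sup>+\<omega>\<in>A j. Y (real (Suc j) * \<delta>) \<omega> \<partial>completion (P x))"
    using Y' by (intro nn_integral_suminf) auto
  also have "\<dots> \<le> V x"
  proof (rule suminf_le_const)
    show "(\<Sum>j<n. \<integral>\<^sup>+\<omega>\<in>A j. Y (real (Suc j) * \<delta>) \<omega> \<partial>completion (P x)) \<le> V x" for n
      using partial[of n] by (meson add_increasing2 order_refl order_trans zero_le)
  qed simp
  finally show ?thesis .
qed

text \<open>
The upward discretisations decrease to \<open>T\<close>, so right-continuous paths and continuity of \<open>V\<close> make the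
stopped values converge, and the Fatou lemma preserves the bound.
\<close>

lemma optional_stopping:
  assumes T: "stopping_time natural T"
  shows "(\<integral>\<^sup>+\<omega>\<in>{\<omega>. T \<omega> < \<infinity>}. ennreal (exp (- r * enn2real (T \<omega>))) * V (X (enn2real (T \<omega>)) \<omega>)
    \<partial>completion (P x)) \<le> V x"
proof -
  note [measurable] = V_borel natural_stopping_time_measurable[OF T, of x]
  define Y where "Y t \<omega> = ennreal (exp (- r * t)) * V (X t \<omega>)" for t \<omega>
  define \<delta> where "\<delta> n = 1 / (real n + 1)" for n :: nat
  have \<delta>: "0 < \<delta> n" for n by (simp add: \<delta>_def)
  define A where "A n j = {\<omega> \<in> \<Omega>. ennreal (real j * \<delta> n) \<le> T \<omega> \<and> T \<omega> < ennreal (real (Suc j) * \<delta> n)}"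
    for n j :: nat
  define u where "u n \<omega> = (\<Sum>j. Y (real (Suc j) * \<delta> n) \<omega> * indicator (A n j) \<omega>)" for n \<omega>
  have u_meas: "u n \<in> borel_measurable (completion (P x))" for n
  proof -
    have [measurable]: "X (real (Suc j) * \<delta> n) \<in> borel_measurable (completion (P x))" for j
      using \<delta>[of n] by (intro measurable_completion X_measurable) simp
    have [measurable]: "Y (real (Suc j) * \<delta> n) \<in> borel_measurable (completion (P x))" for j
      unfolding Y_def by measurable
    have "A n j = {\<omega> \<in> space (completion (P x)). ennreal (real j * \<delta> n) \<le> T \<omega> \<and> T \<omega> < ennreal (real (Suc j) * \<delta> n)}" for j
      by (simp add: A_def space_P)
    then have [measurable]: "A n j \<in> sets (completion (P x))" for j
      by (simp only:) measurable
    show ?thesis unfolding u_def[abs_def] by measurable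
  qed
  have "Y (enn2real (T \<omega>)) \<omega> * indicator {\<omega>. T \<omega> < \<infinity>} \<omega> \<le> liminf (\<lambda>n. u n \<omega>)" if \<omega>: "\<omega> \<in> \<Omega>" for \<omega>
  proof (cases "T \<omega> < \<infinity>")
    case True
    define s where "s = enn2real (T \<omega>)"
    have s: "T \<omega> = ennreal s" "0 \<le> s" using True by (auto simp: s_def less_top)
    define q where "q n = real (Suc (nat \<lfloor>s / \<delta> n\<rfloor>)) * \<delta> n" for n
    have j: "real (nat \<lfloor>s / \<delta> n\<rfloor>) = of_int \<lfloor>s / \<delta> n\<rfloor>" for n
      using s \<delta>[of n] by (simp add: less_imp_le)
    have q_gt: "s < q n" for n
    proof -
      have "s / \<delta> n < real (Suc (nat \<lfloor>s / \<delta> n\<rfloor>))" using j[of n] by linarith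
      then show ?thesis unfolding q_def using \<delta>[of n] by (simp add: pos_divide_less_eq)
    qed
    have j_le: "real (nat \<lfloor>s / \<delta> n\<rfloor>) * \<delta> n \<le> s" for n
    proof -
      have "real (nat \<lfloor>s / \<delta> n\<rfloor>) \<le> s / \<delta> n" using j[of n] by linarith
      then show ?thesis using \<delta>[of n] by (simp add: pos_le_divide_eq)
    qed
    have "Y (q n) \<omega> \<le> u n \<omega>" for n
    proof -
      have "\<omega> \<in> A n (nat \<lfloor>s / \<delta> n\<rfloor>)"
        using \<omega> j_le[of n] q_gt[of n] s
        by (simp add: A_def q_def ennreal_leI) (rule ennreal_lessI, auto)
      then have "Y (q n) \<omega> = (\<Sum>j\<in>{nat \<lfloor>s / \<delta> n\<rfloor>}. Y (real (Suc j) * \<delta> n) \<omega> * indicator (A n j) \<omega>)"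
        by (simp add: q_def)
      also have "\<dots> \<le> u n \<omega>"
        unfolding u_def by (rule sum_le_suminf) auto
      finally show ?thesis .
    qed
    then have "liminf (\<lambda>n. Y (q n) \<omega>) \<le> liminf (\<lambda>n. u n \<omega>)"
      by (intro Liminf_mono) auto
    moreover have "(\<lambda>n. Y (q n) \<omega>) \<longlonglongrightarrow> Y s \<omega>"
    proof -
      have "q n \<le> s + \<delta> n" for n
        using j_le[of n] by (simp add: q_def algebra_simps)
      moreover have "\<delta> \<longlonglongrightarrow> 0"
        using LIMSEQ_inverse_real_of_nat by (simp add: \<delta>_def[abs_def] inverse_eq_divide add.commute)
      from tendsto_add[OF tendsto_const[of s] this] have "(\<lambda>n. s + \<delta> n) \<longlonglongrightarrow> s" by simp
      ultimately have q_lim: "q \<longlonglongrightarrow> s"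
        using q_gt by (intro tendsto_sandwich[of "\<lambda>_. s" q _ "\<lambda>n. s + \<delta> n"]) (auto intro: always_eventually less_imp_le)
      then have "filterlim q (at_right s) sequentially"
        by (rule tendsto_imp_filterlim_at_right) (auto intro: always_eventually q_gt)
      moreover have "((\<lambda>t. X t \<omega>) \<longlongrightarrow> X s \<omega>) (at_right s)"
        using right_continuous_paths[OF \<omega> s(2)] by (simp add: continuous_within)
      ultimately have "(\<lambda>n. X (q n) \<omega>) \<longlonglongrightarrow> X s \<omega>"
        by (rule filterlim_compose[rotated])
      then have "(\<lambda>n. V (X (q n) \<omega>)) \<longlonglongrightarrow> V (X s \<omega>)"
        by (rule continuous_on_tendsto_compose[OF V_cont]) auto
      then show ?thesis
        unfolding Y_def by (intro tendsto_mult_ennreal tendsto_ennrealI tendsto_intros q_lim) auto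
    qed
    then have "liminf (\<lambda>n. Y (q n) \<omega>) = Y s \<omega>"
      by (intro lim_imp_Liminf) auto
    ultimately show ?thesis using True by (simp add: s_def)
  qed simp
  then have "(\<integral>\<^sup>+\<omega>\<in>{\<omega>. T \<omega> < \<infinity>}. Y (enn2real (T \<omega>)) \<omega> \<partial>completion (P x)) \<le>
      (\<integral>\<^sup>+\<omega>. liminf (\<lambda>n. u n \<omega>) \<partial>completion (P x))"
    by (intro nn_integral_mono) (simp add: space_P)
  also have "\<dots> \<le> liminf (\<lambda>n. \<integral>\<^sup>+\<omega>. u n \<omega> \<partial>completion (P x))"
    by (rule nn_integral_liminf[OF u_meas])
  also have "\<dots> \<le> V x"
    using optional_stopping_grid[OF T \<delta>] unfolding u_def A_def Y_def
    by (intro Liminf_le) (auto intro: always_eventually)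
  finally show ?thesis unfolding Y_def .
qed

end

end

section \<open>Rewards at infinity\<close>

text \<open>
Makes suprema over a continuum of times measurable.
\<close>

lemma SUP_right_continuous_rational:
  fixes f :: "real \<Rightarrow> ennreal"
  assumes rc: "\<And>t. a \<le> t \<Longrightarrow> continuous (at_right t) f"
  shows "(SUP t\<in>{a..}. f t) = (SUP q\<in>\<rat> \<inter> {a..}. f q)"
proof (rule antisym)
  show "(SUP t\<in>{a..}. f t) \<le> (SUP q\<in>\<rat> \<inter> {a..}. f q)"
  proof (rule SUP_least, rule ccontr)
    fix t assume t: "t \<in> {a..}" and "\<not> f t \<le> (SUP q\<in>\<rat> \<inter> {a..}. f q)"
    then have less: "(SUP q\<in>\<rat> \<inter> {a..}. f q) < f t" by simp
    have "(f \<longlongrightarrow> f t) (at_right t)"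
      using rc[of t] t by (simp add: continuous_within)
    then have "\<forall>\<^sub>F s in at_right t. (SUP q\<in>\<rat> \<inter> {a..}. f q) < f s"
      using less by (rule order_tendstoD)
    then obtain b where b: "t < b" "\<And>s. t < s \<Longrightarrow> s < b \<Longrightarrow> (SUP q\<in>\<rat> \<inter> {a..}. f q) < f s"
      unfolding eventually_at_right_field by auto
    from Rats_dense_in_real[OF b(1)] obtain q where q: "q \<in> \<rat>" "t < q" "q < b" by auto
    with t have "f q \<le> (SUP q\<in>\<rat> \<inter> {a..}. f q)" by (intro SUP_upper) auto
    with b(2)[of q] q show False by simp
  qed
qed (auto intro: SUP_subset_mono)

lemma Limsup_at_top_eq_INF_SUP:
  fixes f :: "real \<Rightarrow> ennreal"
  shows "Limsup at_top f = (INF n::nat. SUP t\<in>{real n..}. f t)"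
proof (rule antisym)
  show "Limsup at_top f \<le> (INF n::nat. SUP t\<in>{real n..}. f t)"
  proof (rule INF_greatest)
    fix n :: nat
    have "\<forall>\<^sub>F t in at_top. f t \<le> (SUP t\<in>{real n..}. f t)"
      using eventually_ge_at_top[of "real n"] by eventually_elim (auto intro: SUP_upper)
    then show "Limsup at_top f \<le> (SUP t\<in>{real n..}. f t)" by (rule Limsup_bounded)
  qed
  show "(INF n::nat. SUP t\<in>{real n..}. f t) \<le> Limsup at_top f"
    unfolding Limsup_def
  proof (rule INF_greatest, clarify)
    fix Q :: "real \<Rightarrow> bool" assume "eventually Q at_top"
    then obtain b where b: "\<And>t. b \<le> t \<Longrightarrow> Q t" by (auto simp: eventually_at_top_linorder)
    obtain n :: nat where "b \<le> real n" using real_arch_simple by blast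
    then have "(SUP t\<in>{real n..}. f t) \<le> Sup (f ` Collect Q)"
      using b by (intro SUP_subset_mono) auto
    then show "(INF n::nat. SUP t\<in>{real n..}. f t) \<le> Sup (f ` Collect Q)"
      by (rule INF_lower2[rotated]) simp
  qed
qed

context hunt_process
begin

text \<open>
The events that can be approximated form a \<open>\<sigma>\<close>-algebra that contains the generators.
\<close>

lemma approximate_event:
  assumes "A \<in> sets (raw \<infinity>)" "0 < e"
  shows "\<exists>k::nat. \<exists>B\<in>sets (raw (ennreal (real k))). measure (P x) ((A - B) \<union> (B - A)) < e"
proof -
  interpret prob_space "P x" by (rule prob_space_P)
  define gens where "gens = {X s -` B \<inter> \<Omega> | s B. 0 \<le> s \<and> ennreal s \<le> \<infinity> \<and> B \<in> sets borel}"
  have raw_inf: "sets (raw \<infinity>) = sigma_sets \<Omega> gens"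
    unfolding raw_filtration_def gens_def by (rule sets_measure_of) auto
  have in_P: "B \<in> events" if "B \<in> sets (raw t)" for B t
    using that raw_mono[of t \<infinity>] by (auto simp: sets_P)
  have raw_nat_mono: "B \<in> sets (raw (ennreal (real l)))" if "B \<in> sets (raw (ennreal (real k)))" "k \<le> l" for B k l
    using that raw_mono[of "ennreal (real k)" "ennreal (real l)"] by (auto simp: ennreal_leI)
  from assms(1) have "A \<in> sigma_sets \<Omega> gens" unfolding raw_inf .
  from this assms(2) show ?thesis
  proof (induction A arbitrary: e rule: sigma_sets.induct)
    case (Basic A)
    then obtain s B where A: "A = X s -` B \<inter> \<Omega>" "0 \<le> s" "B \<in> sets borel"
      by (auto simp: gens_def)
    obtain k :: nat where "s \<le> real k" using real_arch_simple by blast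
    then have "A \<in> sets (raw (ennreal (real k)))"
      using measurable_sets[OF X_raw_measurable[of s "ennreal (real k)"] A(3)] A
      by (simp add: space_raw_filtration ennreal_leI)
    with Basic show ?case by (intro exI[of _ k] bexI[of _ A]) auto
  next
    case Empty
    then show ?case by (intro exI[of _ 0] bexI[of _ "{}"]) auto
  next
    case (Compl A)
    then obtain k B where B: "B \<in> sets (raw (ennreal (real k)))" "measure (P x) ((A - B) \<union> (B - A)) < e"
      by blast
    have "A \<subseteq> \<Omega>" "B \<subseteq> \<Omega>"
      using sets.sets_into_space[OF Compl(1)[folded raw_inf]] sets.sets_into_space[OF B(1)]
      by (simp_all add: space_raw_filtration)
    then have "((\<Omega> - A) - (\<Omega> - B)) \<union> ((\<Omega> - B) - (\<Omega> - A)) = (A - B) \<union> (B - A)" by auto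
    moreover have "\<Omega> - B \<in> sets (raw (ennreal (real k)))"
      using sets.compl_sets[OF B(1)] by (simp add: space_raw_filtration)
    ultimately show ?case using B by (intro exI[of _ k] bexI[of _ "\<Omega> - B"]) auto
  next
    case (Union A)
    have A[measurable]: "A i \<in> events" for i
      using Union(1)[of i, folded raw_inf] by (simp add: sets_P)
    have "(\<lambda>n. prob (\<Union>i<n. A i)) \<longlonglongrightarrow> prob (\<Union>n. \<Union>i<n. A i)"
    proof (rule finite_Lim_measure_incseq)
      show "incseq (\<lambda>n. \<Union>i<n. A i)"
        by (intro monoI UN_mono) auto
    qed auto
    moreover have "(\<Union>n. \<Union>i<n. A i) = (\<Union>i. A i)" by auto
    ultimately have "\<forall>\<^sub>F n in sequentially. prob (\<Union>i. A i) - e / 2 < prob (\<Union>i<n. A i)"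
      using \<open>0 < e\<close> by (intro order_tendstoD(1)[where y="prob (\<Union>i. A i)"]) auto
    then obtain n where n: "prob (\<Union>i. A i) - e / 2 < prob (\<Union>i<n. A i)"
      by (auto simp: eventually_sequentially)
    define e' where "e' = e / (2 * real (Suc n))"
    have "0 < e'" using \<open>0 < e\<close> by (simp add: e'_def)
    from Union(2)[OF this] obtain k B where
      B: "\<And>i. B i \<in> sets (raw (ennreal (real (k i))))" "\<And>i. prob ((A i - B i) \<union> (B i - A i)) < e'"
      by metis
    note [measurable] = in_P[OF B(1)]
    define K where "K = Max (k ` {..n})"
    have "(\<Union>i<n. B i) \<in> sets (raw (ennreal (real K)))"
      by (intro sets.finite_UN) (auto intro!: raw_nat_mono[OF B(1)] Max_ge simp: K_def)
    moreover have "prob (((\<Union>i. A i) - (\<Union>i<n. B i)) \<union> ((\<Union>i<n. B i) - (\<Union>i. A i))) < e"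
    proof -
      have "prob (((\<Union>i. A i) - (\<Union>i<n. B i)) \<union> ((\<Union>i<n. B i) - (\<Union>i. A i))) \<le>
          prob (((\<Union>i. A i) - (\<Union>i<n. A i)) \<union> (\<Union>i<n. (A i - B i) \<union> (B i - A i)))"
        by (rule finite_measure_mono) auto
      also have "\<dots> \<le> prob ((\<Union>i. A i) - (\<Union>i<n. A i)) + prob (\<Union>i<n. (A i - B i) \<union> (B i - A i))"
        by (rule measure_Un_le) auto
      also have "prob ((\<Union>i. A i) - (\<Union>i<n. A i)) = prob (\<Union>i. A i) - prob (\<Union>i<n. A i)"
        by (rule finite_measure_Diff) auto
      also have "prob (\<Union>i<n. (A i - B i) \<union> (B i - A i)) \<le> (\<Sum>i<n. prob ((A i - B i) \<union> (B i - A i)))"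
        by (rule finite_measure_subadditive_finite) auto
      also have "\<dots> \<le> (\<Sum>i<n. e')"
        by (intro sum_mono less_imp_le B)
      also have "\<dots> \<le> e / 2"
        using \<open>0 < e\<close> by (simp add: e'_def field_simps)
      finally show ?thesis using n by simp
    qed
    ultimately show ?case by blast
  qed
qed

text \<open>
What happens at infinity can be predicted, up to an error that is small in mean, from the observation
of the process up to a finite time. This takes the place of a martingale convergence theorem in the
treatment of the upper limit of the discounted reward.
\<close>

lemma approximate_random_variable:
  fixes f :: "'a \<Rightarrow> real"
  assumes "integrable (P x) f" "0 < e"
  shows "\<exists>k::nat. \<exists>\<xi>\<in>borel_measurable (raw (ennreal (real k))). (\<integral>\<^sup>+\<omega>. ennreal \<bar>f \<omega> - \<xi> \<omega>\<bar> \<partial>P x) < ennreal e"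
proof -
  interpret prob_space "P x" by (rule prob_space_P)
  have in_P: "h \<in> borel_measurable (P x)" if "h \<in> borel_measurable (raw t)" for t and h :: "'a \<Rightarrow> real"
    using raw_measurable_mono[OF that, of \<infinity>] by (simp cong: measurable_cong_sets add: sets_P)
  have raw_nat_mono: "h \<in> borel_measurable (raw (ennreal (real l)))"
    if "h \<in> borel_measurable (raw (ennreal (real k)))" "k \<le> l" for k l and h :: "'a \<Rightarrow> real"
    using that by (intro raw_measurable_mono[OF that(1)]) (simp add: ennreal_leI)
  from assms show ?thesis
  proof (induction arbitrary: e rule: integrable_induct)
    case (base A c)
    have "0 < e / (\<bar>c\<bar> + 1)" using base by simp
    then obtain k B where B: "B \<in> sets (raw (ennreal (real k)))"
      "prob ((A - B) \<union> (B - A)) < e / (\<bar>c\<bar> + 1)"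
      using approximate_event[of A "e / (\<bar>c\<bar> + 1)" x] base(1) by (auto simp: sets_P)
    have [measurable]: "A \<in> events" "B \<in> events"
      using base(1) B(1) raw_mono[of "ennreal (real k)" \<infinity>] by (auto simp: sets_P)
    have "(\<integral>\<^sup>+\<omega>. ennreal \<bar>indicator A \<omega> *\<^sub>R c - indicator B \<omega> * c\<bar> \<partial>P x) =
        (\<integral>\<^sup>+\<omega>. ennreal \<bar>c\<bar> * indicator ((A - B) \<union> (B - A)) \<omega> \<partial>P x)"
      by (intro nn_integral_cong) (auto simp: indicator_def)
    also have "\<dots> = ennreal (\<bar>c\<bar> * prob ((A - B) \<union> (B - A)))"
      by (simp add: nn_integral_cmult_indicator emeasure_eq_measure ennreal_mult)
    also have "\<dots> < ennreal e"
    proof (rule ennreal_lessI)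
      have "\<bar>c\<bar> * prob ((A - B) \<union> (B - A)) \<le> (\<bar>c\<bar> + 1) * prob ((A - B) \<union> (B - A))"
        by (intro mult_right_mono) auto
      also have "\<dots> < e"
        using B(2) by (subst (asm) pos_less_divide_eq) (auto simp: mult.commute)
      finally show "\<bar>c\<bar> * prob ((A - B) \<union> (B - A)) < e" .
    qed (use base in simp)
    finally show ?case
      using B(1) by (intro exI[of _ k] bexI[of _ "\<lambda>\<omega>. indicator B \<omega> * c"]) auto
  next
    case (add f g)
    have "0 < e / 2" using add by simp
    from add.IH(1)[OF this] add.IH(2)[OF this] obtain k l \<xi> \<zeta> where
      \<xi>: "\<xi> \<in> borel_measurable (raw (ennreal (real k)))" "(\<integral>\<^sup>+\<omega>. ennreal \<bar>f \<omega> - \<xi> \<omega>\<bar> \<partial>P x) < ennreal (e / 2)" and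
      \<zeta>: "\<zeta> \<in> borel_measurable (raw (ennreal (real l)))" "(\<integral>\<^sup>+\<omega>. ennreal \<bar>g \<omega> - \<zeta> \<omega>\<bar> \<partial>P x) < ennreal (e / 2)"
      by blast
    have [measurable]: "f \<in> borel_measurable (P x)" "g \<in> borel_measurable (P x)"
      using add by auto
    note [measurable] = in_P[OF \<xi>(1)] in_P[OF \<zeta>(1)]
    have "(\<integral>\<^sup>+\<omega>. ennreal \<bar>f \<omega> + g \<omega> - (\<xi> \<omega> + \<zeta> \<omega>)\<bar> \<partial>P x) \<le>
        (\<integral>\<^sup>+\<omega>. ennreal \<bar>f \<omega> - \<xi> \<omega>\<bar> + ennreal \<bar>g \<omega> - \<zeta> \<omega>\<bar> \<partial>P x)"
      by (intro nn_integral_mono) (auto simp: ennreal_plus[symmetric] simp del: ennreal_plus intro!: ennreal_leI)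
    also have "\<dots> = (\<integral>\<^sup>+\<omega>. ennreal \<bar>f \<omega> - \<xi> \<omega>\<bar> \<partial>P x) + (\<integral>\<^sup>+\<omega>. ennreal \<bar>g \<omega> - \<zeta> \<omega>\<bar> \<partial>P x)"
      by (rule nn_integral_add) auto
    also have "\<dots> < ennreal (e / 2) + ennreal (e / 2)"
      by (rule add_strict_mono[OF \<xi>(2) \<zeta>(2)])
    also have "\<dots> = ennreal e"
      using add by (simp add: ennreal_plus[symmetric] del: ennreal_plus)
    finally show ?case
      using raw_nat_mono[OF \<xi>(1), of "max k l"] raw_nat_mono[OF \<zeta>(1), of "max k l"]
      by (intro exI[of _ "max k l"] bexI[of _ "\<lambda>\<omega>. \<xi> \<omega> + \<zeta> \<omega>"]) auto
  next
    case (lim f s)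
    have [measurable]: "f \<in> borel_measurable (P x)" "s i \<in> borel_measurable (P x)" for i
      using lim by auto
    have "(\<lambda>i. \<integral>\<^sup>+\<omega>. ennreal (norm (f \<omega> - s i \<omega>)) \<partial>P x) \<longlonglongrightarrow> 0"
    proof (rule nn_integral_dominated_convergence_norm[where w="\<lambda>\<omega>. 2 * norm (f \<omega>)"])
      show "(\<integral>\<^sup>+\<omega>. ennreal (2 * norm (f \<omega>)) \<partial>P x) < \<infinity>"
        using integrableD(2)[OF integrable_mult_right[OF integrable_norm[OF lim.hyps(4)], of 2]]
        by (simp add: top.not_eq_extremum abs_mult)
    qed (use lim in auto)
    moreover have "0 < ennreal (e / 2)" using lim by simp
    ultimately have "\<forall>\<^sub>F i in sequentially. (\<integral>\<^sup>+\<omega>. ennreal (norm (f \<omega> - s i \<omega>)) \<partial>P x) < ennreal (e / 2)"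
      by (rule order_tendstoD)
    then obtain i where i: "(\<integral>\<^sup>+\<omega>. ennreal \<bar>f \<omega> - s i \<omega>\<bar> \<partial>P x) < ennreal (e / 2)"
      by (auto simp: eventually_sequentially)
    have "0 < e / 2" using lim by simp
    from lim.IH[OF this, of i] obtain k \<xi> where \<xi>: "\<xi> \<in> borel_measurable (raw (ennreal (real k)))"
      "(\<integral>\<^sup>+\<omega>. ennreal \<bar>s i \<omega> - \<xi> \<omega>\<bar> \<partial>P x) < ennreal (e / 2)" by blast
    note [measurable] = in_P[OF \<xi>(1)]
    have "(\<integral>\<^sup>+\<omega>. ennreal \<bar>f \<omega> - \<xi> \<omega>\<bar> \<partial>P x) \<le>
        (\<integral>\<^sup>+\<omega>. ennreal \<bar>f \<omega> - s i \<omega>\<bar> + ennreal \<bar>s i \<omega> - \<xi> \<omega>\<bar> \<partial>P x)"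
      by (intro nn_integral_mono) (auto simp: ennreal_plus[symmetric] simp del: ennreal_plus intro!: ennreal_leI)
    also have "\<dots> = (\<integral>\<^sup>+\<omega>. ennreal \<bar>f \<omega> - s i \<omega>\<bar> \<partial>P x) + (\<integral>\<^sup>+\<omega>. ennreal \<bar>s i \<omega> - \<xi> \<omega>\<bar> \<partial>P x)"
      by (rule nn_integral_add) auto
    also have "\<dots> < ennreal (e / 2) + ennreal (e / 2)"
      by (rule add_strict_mono[OF i \<xi>(2)])
    also have "\<dots> = ennreal e"
      using lim by (simp add: ennreal_plus[symmetric] del: ennreal_plus)
    finally show ?case using \<xi>(1) by blast
  qed
qed

context
  fixes r :: real and g :: "real \<Rightarrow> real"
  assumes g_cont: "continuous_on UNIV g"
begin

lemma discounted_right_continuous: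
  assumes "\<omega> \<in> \<Omega>" "0 \<le> t"
  shows "continuous (at_right t) (\<lambda>s. exp (- r * s) * g (X s \<omega>))"
  using continuous_image_right_continuous[OF g_cont assms] by (intro continuous_intros)

lemma SUP_discounted_measurable:
  assumes "0 \<le> a"
  shows "(\<lambda>\<omega>. SUP t\<in>{a..}. ennreal (exp (- r * t) * g (X t \<omega>))) \<in> borel_measurable (P x)"
proof -
  have [measurable]: "g \<in> borel_measurable borel"
    using g_cont by (rule borel_measurable_continuous_onI)
  have "(\<lambda>\<omega>. SUP q\<in>\<rat> \<inter> {a..}. ennreal (exp (- r * q) * g (X q \<omega>))) \<in> borel_measurable (P x)"
  proof (rule borel_measurable_SUP)
    show "countable (\<rat> \<inter> {a..})" by (rule countable_subset[OF _ countable_rat]) auto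
    fix q assume "q \<in> \<rat> \<inter> {a..}"
    then have [measurable]: "X q \<in> borel_measurable (P x)" using assms by (intro X_measurable) auto
    show "(\<lambda>\<omega>. ennreal (exp (- r * q) * g (X q \<omega>))) \<in> borel_measurable (P x)" by measurable
  qed
  moreover have "(SUP t\<in>{a..}. ennreal (exp (- r * t) * g (X t \<omega>))) =
      (SUP q\<in>\<rat> \<inter> {a..}. ennreal (exp (- r * q) * g (X q \<omega>)))" if "\<omega> \<in> \<Omega>" for \<omega>
  proof (rule SUP_right_continuous_rational)
    fix t assume "a \<le> t"
    then show "continuous (at_right t) (\<lambda>s. ennreal (exp (- r * s) * g (X s \<omega>)))"
      using discounted_right_continuous[OF that, of t] assms
      unfolding continuous_within by (intro tendsto_ennrealI) auto
  qed
  ultimately show ?thesis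
    by (subst measurable_cong) (auto simp: space_P)
qed

lemma Limsup_discounted_measurable:
  "(\<lambda>\<omega>. Limsup at_top (\<lambda>t. ennreal (exp (- r * t) * g (X t \<omega>)))) \<in> borel_measurable (P x)"
  unfolding Limsup_at_top_eq_INF_SUP
  using SUP_discounted_measurable by (intro borel_measurable_INF) auto

context
  fixes V :: "real \<Rightarrow> ennreal"
  assumes g_nonneg: "\<And>x. 0 \<le> g x"
    and V_cont: "continuous_on UNIV V"
    and supermedian: "\<And>x t. 0 \<le> t \<Longrightarrow> ennreal (exp (- r * t)) * (\<integral>\<^sup>+\<omega>. V (X t \<omega>) \<partial>P x) \<le> V x"
    and majorant: "\<And>x. ennreal (g x) \<le> V x"
begin

text \<open>
The upper limit at infinity is exchanged for the reward of a genuine stopping time. Let \<open>z\<close> be the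
truncated upper limit and \<open>\<xi>\<close> a prediction of \<open>z\<close> that is known at time \<open>l \<ge> k\<close>. If \<open>T\<close> is infinite
and the prediction is good, then the discounted reward exceeds \<open>\<xi> - \<epsilon>\<close> at some time after \<open>l\<close>, and
stopping there yields almost \<open>z\<close>. If the prediction is bad, then \<open>z \<le> k\<close> is dominated by a multiple
of the prediction error. Waiting until \<open>l\<close> does not disturb stopping on the event \<open>T \<le> k\<close>.
\<close>

lemma stopped_or_truncated_limsup_le:
  assumes T: "stopping_time natural T"
  defines "Y \<equiv> \<lambda>t \<omega>. exp (- r * t) * g (X t \<omega>)"
  shows "(\<integral>\<^sup>+\<omega>. ennreal (Y (enn2real (T \<omega>)) \<omega>) * indicator {\<omega>. T \<omega> \<le> ennreal (real k)} \<omega> +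
      min (Limsup at_top (\<lambda>t. ennreal (Y t \<omega>))) (ennreal (real k)) * indicator {\<omega>. T \<omega> = \<infinity>} \<omega>
      \<partial>completion (P x)) \<le> V x"
proof (rule ennreal_le_epsilon)
  fix e :: real assume e: "0 < e"
  interpret prob_space "P x" by (rule prob_space_P)
  \<comment> \<open>The factor \<open>c\<close> bounds the loss per unit of prediction error, whether the prediction is good or bad;
     the accuracy \<open>\<epsilon> / c\<close> makes the expected loss at most \<open>\<epsilon>\<close>.\<close>
  define \<epsilon> where "\<epsilon> = e / 2"
  define c where "c = 1 + real k / \<epsilon>"
  have \<epsilon>: "0 < \<epsilon>" and c: "0 < c" "1 \<le> c" using e by (auto simp: \<epsilon>_def c_def add_pos_nonneg)
  define Z where "Z \<omega> = Limsup at_top (\<lambda>t. ennreal (Y t \<omega>))" for \<omega>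
  have [measurable]: "Z \<in> borel_measurable (P x)"
    unfolding Z_def[abs_def] Y_def by (rule Limsup_discounted_measurable)
  define z where "z \<omega> = enn2real (min (Z \<omega>) (ennreal (real k)))" for \<omega>
  have z: "min (Z \<omega>) (ennreal (real k)) = ennreal (z \<omega>)" "0 \<le> z \<omega>" "z \<omega> \<le> real k" for \<omega>
  proof -
    have "min (Z \<omega>) (ennreal (real k)) < top" by (simp add: min_less_iff_disj)
    then show *: "min (Z \<omega>) (ennreal (real k)) = ennreal (z \<omega>)" by (simp add: z_def less_top)
    show "0 \<le> z \<omega>" by (simp add: z_def)
    have "ennreal (z \<omega>) \<le> ennreal (real k)" unfolding *[symmetric] by simp
    then show "z \<omega> \<le> real k" by (subst (asm) ennreal_le_iff) auto
  qed
  have [measurable]: "z \<in> borel_measurable (P x)" unfolding z_def[abs_def] by measurable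
  have "integrable (P x) z"
    using z(2,3) by (intro integrable_const_bound[of _ "real k"]) auto
  moreover have "0 < \<epsilon> / c" using \<epsilon> c by simp
  ultimately obtain k0 \<xi> where \<xi>: "\<xi> \<in> borel_measurable (raw (ennreal (real k0)))"
    "(\<integral>\<^sup>+\<omega>. ennreal \<bar>z \<omega> - \<xi> \<omega>\<bar> \<partial>P x) < ennreal (\<epsilon> / c)"
    using approximate_random_variable by blast
  have [measurable]: "\<xi> \<in> borel_measurable (P x)"
    using raw_measurable_mono[OF \<xi>(1), of \<infinity>] by (simp cong: measurable_cong_sets add: sets_P)
  define l where "l = real (max k k0)"
  define W where "W t \<omega> = Y t \<omega> - \<xi> \<omega> + \<epsilon>" for t \<omega>
  \<comment> \<open>The first time after \<open>l\<close> at which the discounted reward exceeds \<open>\<xi> - \<epsilon>\<close>.\<close>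
  define H where "H = debut l W"
  define U where "U \<omega> = min (T \<omega>) (H \<omega>)" for \<omega>
  have [measurable]: "g \<in> borel_measurable borel"
    using g_cont by (rule borel_measurable_continuous_onI)
  have W_adapted: "W t \<in> borel_measurable (raw (ennreal t))" if "l \<le> t" for t
  proof -
    have [measurable]: "\<xi> \<in> borel_measurable (raw (ennreal t))"
      using that by (intro raw_measurable_mono[OF \<xi>(1)]) (auto simp: l_def intro!: ennreal_leI)
    have [measurable]: "X t \<in> borel_measurable (raw (ennreal t))"
      using that by (intro X_raw_measurable) (auto simp: l_def)
    show ?thesis unfolding W_def[abs_def] Y_def by measurable
  qed
  have W_rc: "continuous (at_right t) (\<lambda>s. W s \<omega>)" if "\<omega> \<in> \<Omega>" "l \<le> t" for \<omega> t
    unfolding W_def Y_def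
    using that by (intro continuous_intros discounted_right_continuous) (auto simp: l_def)
  have l: "0 \<le> l" by (simp add: l_def)
  have U: "stopping_time natural U"
    unfolding U_def H_def
    by (intro stopping_time_min T debut_stopping_time l W_adapted W_rc)
  have pointwise: "ennreal (Y (enn2real (T \<omega>)) \<omega>) * indicator {\<omega>. T \<omega> \<le> ennreal (real k)} \<omega> +
      min (Z \<omega>) (ennreal (real k)) * indicator {\<omega>. T \<omega> = \<infinity>} \<omega> \<le>
      ennreal (exp (- r * enn2real (U \<omega>))) * V (X (enn2real (U \<omega>)) \<omega>) * indicator {\<omega>. U \<omega> < \<infinity>} \<omega> +
      (ennreal \<epsilon> + ennreal c * ennreal \<bar>z \<omega> - \<xi> \<omega>\<bar>)" (is "?L \<le> ?R") if \<omega>: "\<omega> \<in> \<Omega>" for \<omega>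
  proof -
    have Y_le: "ennreal (Y t \<omega>) \<le> ennreal (exp (- r * t)) * V (X t \<omega>)" for t
      unfolding Y_def using majorant by (simp add: ennreal_mult g_nonneg mult_left_mono)
    have Y_nonneg: "0 \<le> Y t \<omega>" for t by (simp add: Y_def g_nonneg)
    consider "T \<omega> \<le> ennreal (real k)" | "T \<omega> = \<infinity>" | "ennreal (real k) < T \<omega>" "T \<omega> < \<infinity>"
      by (metis infinity_ennreal_def less_top not_le)
    then show ?thesis
    proof cases
      case 1
      have "ennreal (real k) \<le> H \<omega>"
        using debut_ge[of l W \<omega>] by (auto simp: H_def l_def elim!: order_trans[rotated] intro!: ennreal_leI)
      with 1 have "U \<omega> = T \<omega>" by (auto simp: U_def min_def)
      moreover have "T \<omega> < top" using 1 by (rule order.strict_trans1) simp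
      moreover have "?L = ennreal (Y (enn2real (T \<omega>)) \<omega>)"
        using 1 calculation(2) by auto
      ultimately have "?L \<le> ennreal (exp (- r * enn2real (U \<omega>))) * V (X (enn2real (U \<omega>)) \<omega>) * indicator {\<omega>. U \<omega> < \<infinity>} \<omega>"
        using Y_le by simp
      then show ?thesis by (rule add_increasing2[rotated]) simp
    next
      case 2
      then have UH: "U \<omega> = H \<omega>" and L: "?L = ennreal (z \<omega>)"
        by (auto simp: U_def z top_unique)
      show ?thesis
      proof (cases "\<epsilon> \<le> \<bar>z \<omega> - \<xi> \<omega>\<bar>")
        case True
        have "z \<omega> \<le> real k / \<epsilon> * \<epsilon>" using z(3) \<epsilon> by simp
        also have "\<dots> \<le> c * \<bar>z \<omega> - \<xi> \<omega>\<bar>"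
          using True \<epsilon> by (intro mult_mono) (auto simp: c_def)
        finally have "ennreal (z \<omega>) \<le> ennreal c * ennreal \<bar>z \<omega> - \<xi> \<omega>\<bar>"
          using c by (simp add: ennreal_mult[symmetric] ennreal_leI)
        then show ?thesis
          unfolding L by (intro add_increasing) auto
      next
        case False
        have "\<exists>t\<ge>l. 0 < W t \<omega>"
        proof (rule ccontr)
          assume "\<not> (\<exists>t\<ge>l. 0 < W t \<omega>)"
          then have le: "Y t \<omega> \<le> \<xi> \<omega> - \<epsilon>" if "l \<le> t" for t
            using that by (force simp: W_def)
          have "\<forall>\<^sub>F t in at_top. ennreal (Y t \<omega>) \<le> ennreal (\<xi> \<omega> - \<epsilon>)"
            using eventually_ge_at_top[of l] by eventually_elim (intro ennreal_leI le)
          then have "Z \<omega> \<le> ennreal (\<xi> \<omega> - \<epsilon>)"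
            unfolding Z_def by (rule Limsup_bounded)
          moreover have "ennreal (z \<omega>) \<le> Z \<omega>" unfolding z(1)[symmetric] by simp
          ultimately have "ennreal (z \<omega>) \<le> ennreal (\<xi> \<omega> - \<epsilon>)" by simp
          moreover have "0 \<le> \<xi> \<omega> - \<epsilon>" using le[of l] Y_nonneg[of l] by simp
          ultimately show False using False by (simp add: ennreal_le_iff)
        qed
        then obtain t where "l \<le> t" "0 < W t \<omega>" by blast
        then have "H \<omega> \<le> ennreal t" unfolding H_def by (rule debut_le)
        also have "ennreal t < \<infinity>" by simp
        finally have fin: "H \<omega> < \<infinity>" .
        then have "0 \<le> W (enn2real (H \<omega>)) \<omega>"
          unfolding H_def by (intro debut_value_nonneg l W_rc \<omega>)
        then have "z \<omega> \<le> Y (enn2real (H \<omega>)) \<omega> + (\<epsilon> + \<bar>z \<omega> - \<xi> \<omega>\<bar>)"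
          by (simp add: W_def)
        also have "\<bar>z \<omega> - \<xi> \<omega>\<bar> \<le> c * \<bar>z \<omega> - \<xi> \<omega>\<bar>"
          using c by (simp add: mult_le_cancel_right1)
        finally have "ennreal (z \<omega>) \<le> ennreal (Y (enn2real (H \<omega>)) \<omega> + (\<epsilon> + c * \<bar>z \<omega> - \<xi> \<omega>\<bar>))"
          by (simp add: ennreal_leI)
        also have "\<dots> = ennreal (Y (enn2real (H \<omega>)) \<omega>) + (ennreal \<epsilon> + ennreal c * ennreal \<bar>z \<omega> - \<xi> \<omega>\<bar>)"
          using Y_nonneg \<epsilon> c by (simp add: ennreal_plus ennreal_mult)
        also have "\<dots> \<le> ?R"
          using fin Y_le[of "enn2real (H \<omega>)"] by (intro add_right_mono) (simp add: UH)
        finally show ?thesis unfolding L .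
      qed
    next
      case 3
      then have "?L = 0" by (auto simp: not_le)
      then show ?thesis by (simp only: zero_le)
    qed
  qed
  have [measurable]: "V \<in> borel_measurable borel" using V_cont by (rule borel_measurable_continuous_onI)
  have [measurable]: "U \<in> borel_measurable (completion (P x))"
    by (rule natural_stopping_time_measurable[OF U])
  have [measurable]: "(\<lambda>\<omega>. X (enn2real (U \<omega>)) \<omega>) \<in> borel_measurable (completion (P x))"
    by (rule X_at_random_time) auto
  have [measurable]: "(\<lambda>\<omega>. ennreal \<bar>z \<omega> - \<xi> \<omega>\<bar>) \<in> borel_measurable (completion (P x))"
    by (rule measurable_completion) measurable
  have "(\<integral>\<^sup>+\<omega>. ennreal (Y (enn2real (T \<omega>)) \<omega>) * indicator {\<omega>. T \<omega> \<le> ennreal (real k)} \<omega> +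
      min (Z \<omega>) (ennreal (real k)) * indicator {\<omega>. T \<omega> = \<infinity>} \<omega> \<partial>completion (P x)) \<le>
      (\<integral>\<^sup>+\<omega>. (ennreal (exp (- r * enn2real (U \<omega>))) * V (X (enn2real (U \<omega>)) \<omega>) * indicator {\<omega>. U \<omega> < \<infinity>} \<omega> +
      (ennreal \<epsilon> + ennreal c * ennreal \<bar>z \<omega> - \<xi> \<omega>\<bar>)) \<partial>completion (P x))"
    by (intro nn_integral_mono pointwise) (simp add: space_P)
  also have "\<dots> = (\<integral>\<^sup>+\<omega>\<in>{\<omega>. U \<omega> < \<infinity>}. ennreal (exp (- r * enn2real (U \<omega>))) * V (X (enn2real (U \<omega>)) \<omega>) \<partial>completion (P x)) +
      (ennreal \<epsilon> + ennreal c * (\<integral>\<^sup>+\<omega>. ennreal \<bar>z \<omega> - \<xi> \<omega>\<bar> \<partial>P x))"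
  proof (subst nn_integral_add)
    have "(\<integral>\<^sup>+\<omega>. (ennreal \<epsilon> + ennreal c * ennreal \<bar>z \<omega> - \<xi> \<omega>\<bar>) \<partial>completion (P x)) =
        ennreal \<epsilon> + ennreal c * (\<integral>\<^sup>+\<omega>. ennreal \<bar>z \<omega> - \<xi> \<omega>\<bar> \<partial>P x)"
      unfolding nn_integral_completion by (simp add: nn_integral_add nn_integral_cmult emeasure_space_1)
    then show "(\<integral>\<^sup>+\<omega>\<in>{\<omega>. U \<omega> < \<infinity>}. ennreal (exp (- r * enn2real (U \<omega>))) * V (X (enn2real (U \<omega>)) \<omega>) \<partial>completion (P x)) +
        (\<integral>\<^sup>+\<omega>. (ennreal \<epsilon> + ennreal c * ennreal \<bar>z \<omega> - \<xi> \<omega>\<bar>) \<partial>completion (P x)) =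
        (\<integral>\<^sup>+\<omega>\<in>{\<omega>. U \<omega> < \<infinity>}. ennreal (exp (- r * enn2real (U \<omega>))) * V (X (enn2real (U \<omega>)) \<omega>) \<partial>completion (P x)) +
        (ennreal \<epsilon> + ennreal c * (\<integral>\<^sup>+\<omega>. ennreal \<bar>z \<omega> - \<xi> \<omega>\<bar> \<partial>P x))"
      by (simp only:)
  qed measurable
  also have "\<dots> \<le> V x + (ennreal \<epsilon> + ennreal c * ennreal (\<epsilon> / c))"
    by (intro add_mono mult_left_mono order_refl less_imp_le[OF \<xi>(2)] optional_stopping[OF V_cont supermedian U]) auto
  also have "ennreal \<epsilon> + ennreal c * ennreal (\<epsilon> / c) = ennreal e"
    using \<epsilon> c by (simp add: ennreal_mult[symmetric] ennreal_plus[symmetric] \<epsilon>_def del: ennreal_plus)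
  finally show "(\<integral>\<^sup>+\<omega>. ennreal (Y (enn2real (T \<omega>)) \<omega>) * indicator {\<omega>. T \<omega> \<le> ennreal (real k)} \<omega> +
      min (Limsup at_top (\<lambda>t. ennreal (Y t \<omega>))) (ennreal (real k)) * indicator {\<omega>. T \<omega> = \<infinity>} \<omega>
      \<partial>completion (P x)) \<le> V x + ennreal e"
    unfolding Z_def .
qed

text \<open>
The truncated rewards of \<open>stopped_or_truncated_limsup_le\<close> increase to the reward of \<open>T\<close>.
\<close>

lemma expected_reward_le:
  assumes T: "stopping_time natural T"
  shows "expected_reward X P r g x T \<le> V x"
proof -
  define Y where "Y t \<omega> = exp (- r * t) * g (X t \<omega>)" for t \<omega>
  define Z where "Z \<omega> = Limsup at_top (\<lambda>t. ennreal (Y t \<omega>))" for \<omega>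
  define u where "u k \<omega> = ennreal (Y (enn2real (T \<omega>)) \<omega>) * indicator {\<omega>. T \<omega> \<le> ennreal (real k)} \<omega> +
      min (Z \<omega>) (ennreal (real k)) * indicator {\<omega>. T \<omega> = \<infinity>} \<omega>" for k :: nat and \<omega>
  have [measurable]: "g \<in> borel_measurable borel"
    using g_cont by (rule borel_measurable_continuous_onI)
  have [measurable]: "T \<in> borel_measurable (completion (P x))"
    by (rule natural_stopping_time_measurable[OF T])
  have [measurable]: "(\<lambda>\<omega>. X (enn2real (T \<omega>)) \<omega>) \<in> borel_measurable (completion (P x))"
    by (rule X_at_random_time) auto
  have [measurable]: "Z \<in> borel_measurable (completion (P x))"
    unfolding Z_def[abs_def] Y_def by (intro measurable_completion Limsup_discounted_measurable)
  have u_meas: "u k \<in> borel_measurable (completion (P x))" for k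
    unfolding u_def[abs_def] Y_def by measurable
  have u_mono: "incseq u"
    unfolding incseq_def le_fun_def
  proof (intro allI impI)
    fix m n :: nat and \<omega> assume "m \<le> n"
    then have le: "ennreal (real m) \<le> ennreal (real n)" by (simp add: ennreal_leI)
    then have "indicator {\<omega>. T \<omega> \<le> ennreal (real m)} \<omega> \<le> (indicator {\<omega>. T \<omega> \<le> ennreal (real n)} \<omega> :: ennreal)"
      using order_trans[OF _ le, of "T \<omega>"] by (auto simp: indicator_def simp del: ennreal_le_iff)
    with le show "u m \<omega> \<le> u n \<omega>"
      unfolding u_def by (intro add_mono mult_left_mono mult_right_mono min.mono) auto
  qed
  have "discounted_reward X r g T \<omega> = (SUP k. u k \<omega>)" for \<omega>
  proof (cases "T \<omega> = \<infinity>")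
    case True
    have "(SUP k. min (Z \<omega>) (ennreal (real k))) = min (Z \<omega>) (SUP k. ennreal (real k))"
      by (simp add: inf_min[symmetric] inf_SUP)
    also have "(SUP k. ennreal (real k)) = top"
      using ennreal_SUP_of_nat_eq_top by (simp add: ennreal_of_nat_eq_real_of_nat)
    finally show ?thesis
      using True by (simp add: discounted_reward_def u_def Z_def Y_def top_unique)
  next
    case False
    then obtain t where t: "T \<omega> = ennreal t" "0 \<le> t" by (cases "T \<omega>") auto
    obtain n :: nat where n: "t \<le> real n" using real_arch_simple by blast
    have "(SUP k. u k \<omega>) = ennreal (Y t \<omega>)"
    proof (rule antisym)
      show "(SUP k. u k \<omega>) \<le> ennreal (Y t \<omega>)"
        using t by (intro SUP_least) (auto simp: u_def indicator_def)
      show "ennreal (Y t \<omega>) \<le> (SUP k. u k \<omega>)"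
        using t n by (intro SUP_upper2[of n]) (auto simp: u_def indicator_def ennreal_leI)
    qed
    with t show ?thesis by (simp add: discounted_reward_def Y_def)
  qed
  then have "expected_reward X P r g x T = (\<integral>\<^sup>+\<omega>. (SUP k. u k \<omega>) \<partial>completion (P x))"
    by (simp add: expected_reward_def)
  also have "\<dots> = (SUP k. \<integral>\<^sup>+\<omega>. u k \<omega> \<partial>completion (P x))"
    by (rule nn_integral_monotone_convergence_SUP[OF u_mono u_meas])
  also have "\<dots> \<le> V x"
    using stopped_or_truncated_limsup_le[OF T] unfolding u_def Z_def Y_def by (intro SUP_least) auto
  finally show ?thesis .
qed

end

end

end

section \<open>The resolvent\<close>

context hunt_process
begin

lemma semigroup_measurable:
  assumes "f \<in> borel_measurable borel"
  shows "(\<lambda>(z, t). (\<integral>\<^sup>+\<eta>. f (X t \<eta>) \<partial>P z) * indicator {0..} t) \<in> borel_measurable (borel \<Otimes>\<^sub>M (borel :: real measure))"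
proof -
  note [measurable] = transition_measurable_joint[OF assms]
  have "(\<lambda>p. (\<lambda>(z, t). \<integral>\<^sup>+\<eta>. f (X (max 0 t) \<eta>) \<partial>P z) p * indicator {0..} (snd p))
      \<in> borel_measurable (borel \<Otimes>\<^sub>M (borel :: real measure))"
    by measurable
  then show ?thesis
    by (rule measurable_cong[THEN iffD1, rotated]) (auto simp: split_beta' indicator_def max_def)
qed

lemma sets_resolvent[measurable_cong, simp]: "sets (resolvent \<Omega> X P r x) = sets borel"
  unfolding resolvent_def
  by (subst sets_measure_of) (auto simp: sets.sigma_sets_eq[of borel, simplified])

text \<open>
Links the resolvent, which is defined by its values on Borel sets, to the transition semigroup, by a
monotone class argument.
\<close>

lemma nn_integral_resolvent:
  assumes "f \<in> borel_measurable borel"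
  shows "(\<integral>\<^sup>+y. f y \<partial>resolvent \<Omega> X P r x) =
    (\<integral>\<^sup>+t. ennreal (exp (- r * t)) * ((\<integral>\<^sup>+\<omega>. f (X t \<omega>) \<partial>P x) * indicator {0..} t) \<partial>lborel)"
  using assms
proof (induction f rule: borel_measurable_induct)
  case (cong f g)
  then show ?case by simp
next
  case (set A)
  have "(\<integral>\<^sup>+\<omega>. indicator A (X t \<omega>) \<partial>P x) = emeasure (P x) {\<omega> \<in> \<Omega>. X t \<omega> \<in> A}" if "0 \<le> t" for t
  proof -
    have "{\<omega> \<in> \<Omega>. X t \<omega> \<in> A} \<in> sets (P x)"
      using measurable_sets[OF X_measurable[OF that] set]
      by (simp add: space_P vimage_def Int_def conj_commute)
    from nn_integral_indicator[OF this]
    have "emeasure (P x) {\<omega> \<in> \<Omega>. X t \<omega> \<in> A} = (\<integral>\<^sup>+\<omega>. indicator {\<omega> \<in> \<Omega>. X t \<omega> \<in> A} \<omega> \<partial>P x)"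
      by (rule sym)
    also have "\<dots> = (\<integral>\<^sup>+\<omega>. indicator A (X t \<omega>) \<partial>P x)"
      by (rule nn_integral_cong) (auto simp: space_P indicator_def)
    finally show ?thesis by (rule sym)
  qed
  then show ?case
    using set by (subst nn_integral_indicator) (auto simp: emeasure_resolvent ac_simps indicator_def intro!: nn_integral_cong)
next
  case (mult u c)
  note [measurable] = mult(2)
  have [measurable]: "(\<lambda>t. (\<integral>\<^sup>+\<omega>. u (X t \<omega>) \<partial>P x) * indicator {0..} t) \<in> borel_measurable borel"
    using measurable_compose[OF measurable_Pair1' semigroup_measurable[OF mult(2)], of x] by simp
  have "(\<integral>\<^sup>+\<omega>. c * u (X t \<omega>) \<partial>P x) * indicator {0..} t = c * ((\<integral>\<^sup>+\<omega>. u (X t \<omega>) \<partial>P x) * indicator {0..} t)" for t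
    using measurable_compose[OF X_measurable mult(2), of t x]
    by (cases "0 \<le> t") (auto simp: nn_integral_cmult)
  then show ?case
    using mult by (simp add: nn_integral_cmult mult.left_commute[of _ c])
next
  case (add u v)
  note [measurable] = add.hyps(1,3)
  have [measurable]: "(\<lambda>t. (\<integral>\<^sup>+\<omega>. h (X t \<omega>) \<partial>P x) * indicator {0..} t) \<in> borel_measurable borel"
    if "h \<in> borel_measurable borel" for h
    using measurable_compose[OF measurable_Pair1' semigroup_measurable[OF that], of x] by simp
  have "(\<integral>\<^sup>+\<omega>. v (X t \<omega>) + u (X t \<omega>) \<partial>P x) * indicator {0..} t =
      (\<integral>\<^sup>+\<omega>. v (X t \<omega>) \<partial>P x) * indicator {0..} t + (\<integral>\<^sup>+\<omega>. u (X t \<omega>) \<partial>P x) * indicator {0..} t" for t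
    using measurable_compose[OF X_measurable add.hyps(1), of t x] measurable_compose[OF X_measurable add.hyps(3), of t x]
    by (cases "0 \<le> t") (auto simp: nn_integral_add)
  then show ?case
    using add by (simp add: nn_integral_add distrib_left)
next
  case (seq U)
  note [measurable] = seq.hyps(1)
  have [measurable]: "(\<lambda>t. (\<integral>\<^sup>+\<omega>. h (X t \<omega>) \<partial>P x) * indicator {0..} t) \<in> borel_measurable borel"
    if "h \<in> borel_measurable borel" for h
    using measurable_compose[OF measurable_Pair1' semigroup_measurable[OF that], of x] by simp
  have inc: "incseq (\<lambda>i \<omega>. U i (X t \<omega>))" for t
    using seq.hyps(3) by (auto simp: incseq_def le_fun_def)
  have "(\<integral>\<^sup>+\<omega>. (SUP i. U i) (X t \<omega>) \<partial>P x) * indicator {0..} t =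
      (SUP i. (\<integral>\<^sup>+\<omega>. U i (X t \<omega>) \<partial>P x) * indicator {0..} t)" for t
  proof (cases "0 \<le> t")
    case True
    have "(\<integral>\<^sup>+\<omega>. (SUP i. U i (X t \<omega>)) \<partial>P x) = (SUP i. \<integral>\<^sup>+\<omega>. U i (X t \<omega>) \<partial>P x)"
      using measurable_compose[OF X_measurable seq.hyps(1), OF True]
      by (intro nn_integral_monotone_convergence_SUP[OF inc])
    then show ?thesis using True by (simp add: SUP_apply image_comp)
  qed simp
  then have "(\<integral>\<^sup>+t. ennreal (exp (- r * t)) * ((\<integral>\<^sup>+\<omega>. (SUP i. U i) (X t \<omega>) \<partial>P x) * indicator {0..} t) \<partial>lborel) =
      (\<integral>\<^sup>+t. (SUP i. ennreal (exp (- r * t)) * ((\<integral>\<^sup>+\<omega>. U i (X t \<omega>) \<partial>P x) * indicator {0..} t)) \<partial>lborel)"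
    by (simp add: SUP_mult_left_ennreal)
  also have "\<dots> = (SUP i. \<integral>\<^sup>+t. ennreal (exp (- r * t)) * ((\<integral>\<^sup>+\<omega>. U i (X t \<omega>) \<partial>P x) * indicator {0..} t) \<partial>lborel)"
  proof (rule nn_integral_monotone_convergence_SUP)
    show "incseq (\<lambda>i t. ennreal (exp (- r * t)) * ((\<integral>\<^sup>+\<omega>. U i (X t \<omega>) \<partial>P x) * indicator {0..} t))"
      using inc by (auto simp: incseq_def le_fun_def intro!: mult_left_mono mult_right_mono nn_integral_mono)
  qed measurable
  also have "\<dots> = (SUP i. \<integral>\<^sup>+y. U i y \<partial>resolvent \<Omega> X P r x)"
    by (simp only: seq.IH)
  also have "\<dots> = (\<integral>\<^sup>+y. (SUP i. U i y) \<partial>resolvent \<Omega> X P r x)"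
    by (rule nn_integral_monotone_convergence_SUP[symmetric]) (use seq in auto)
  finally show ?case using seq by (simp add: SUP_apply image_comp)
qed

lemma nn_integral_exponential:
  assumes "0 < n" "0 \<le> \<delta>"
  shows "(\<integral>\<^sup>+t. ennreal (n * exp (- n * t)) * indicator {0..\<delta>} t \<partial>lborel) = ennreal (1 - exp (- n * \<delta>))"
    and "(\<integral>\<^sup>+t. ennreal (n * exp (- n * t)) * indicator {0..} t \<partial>lborel) = 1"
proof -
  have deriv: "((\<lambda>t. - exp (- n * t)) has_real_derivative n * exp (- n * t)) (at t within A)" for t A
    by (auto intro!: derivative_eq_intros)
  show "(\<integral>\<^sup>+t. ennreal (n * exp (- n * t)) * indicator {0..\<delta>} t \<partial>lborel) = ennreal (1 - exp (- n * \<delta>))"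
    using assms by (subst nn_integral_FTC_Icc[where F="\<lambda>t. - exp (- n * t)"])
      (auto intro!: deriv[simplified])
  have "((\<lambda>t. - exp (- n * t)) \<longlongrightarrow> - 0) at_top"
    using assms(1)
    by (intro tendsto_minus filterlim_compose[OF exp_at_bot] filterlim_tendsto_neg_mult_at_bot[OF tendsto_const])
      (auto simp: filterlim_ident)
  then show "(\<integral>\<^sup>+t. ennreal (n * exp (- n * t)) * indicator {0..} t \<partial>lborel) = 1"
    using assms by (subst nn_integral_FTC_atLeast[where F="\<lambda>t. - exp (- n * t)" and T=0])
      (auto intro!: deriv[simplified])
qed

text \<open>
The measure \<open>n e\<^sup>-\<^sup>n\<^sup>t dt\<close> is a probability, so \<open>n G (r + n) h\<close> averages the values
\<open>e\<^sup>-\<^sup>r\<^sup>t E y (h (X t))\<close>, each of which is at most \<open>h y\<close>.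
\<close>

lemma resolvent_supermedian_le:
  assumes h: "h \<in> borel_measurable borel" and n: "0 < n"
    and le: "\<And>t. 0 \<le> t \<Longrightarrow> ennreal (exp (- r * t)) * (\<integral>\<^sup>+\<omega>. h (X t \<omega>) \<partial>P y) \<le> h y"
  shows "ennreal n * (\<integral>\<^sup>+z. h z \<partial>resolvent \<Omega> X P (r + n) y) \<le> h y"
proof -
  have [measurable]: "(\<lambda>t. (\<integral>\<^sup>+\<omega>. h (X t \<omega>) \<partial>P y) * indicator {0..} t) \<in> borel_measurable borel"
    using measurable_compose[OF measurable_Pair1' semigroup_measurable[OF h], of y] by simp
  have exp: "ennreal n * ennreal (exp (- (r + n) * t)) = ennreal (n * exp (- n * t)) * ennreal (exp (- r * t))" for t
    using n by (simp add: ennreal_mult[symmetric] exp_add[symmetric] algebra_simps)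
  have "ennreal n * (\<integral>\<^sup>+z. h z \<partial>resolvent \<Omega> X P (r + n) y) =
      (\<integral>\<^sup>+t. ennreal n * ennreal (exp (- (r + n) * t)) * ((\<integral>\<^sup>+\<omega>. h (X t \<omega>) \<partial>P y) * indicator {0..} t) \<partial>lborel)"
    unfolding nn_integral_resolvent[OF h] by (simp add: nn_integral_cmult mult.assoc)
  also have "\<dots> \<le> (\<integral>\<^sup>+t. (ennreal (n * exp (- n * t)) * indicator {0..} t) * h y \<partial>lborel)"
    unfolding exp
  proof (rule nn_integral_mono)
    fix t
    show "ennreal (n * exp (- n * t)) * ennreal (exp (- r * t)) * ((\<integral>\<^sup>+\<omega>. h (X t \<omega>) \<partial>P y) * indicator {0..} t)
        \<le> (ennreal (n * exp (- n * t)) * indicator {0..} t) * h y"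
      using mult_left_mono[OF le[of t], of "ennreal (n * exp (- n * t))"]
      by (cases "0 \<le> t") (auto simp: mult.assoc)
  qed
  also have "\<dots> = h y"
    using nn_integral_exponential(2)[OF n order_refl] by (simp add: nn_integral_multc)
  finally show ?thesis .
qed

text \<open>
As \<open>n\<close> grows, the average \<open>n G (r + n) h\<close> concentrates at small times.
\<close>

lemma resolvent_approximation:
  assumes h: "h \<in> borel_measurable borel"
    and lim: "\<forall>\<^sub>F t in at_right 0. d \<le> ennreal (exp (- r * t)) * (\<integral>\<^sup>+\<omega>. h (X t \<omega>) \<partial>P y)"
    and d: "c < d" "d < \<infinity>"
  obtains n :: nat where "0 < n" "c < ennreal (real n) * (\<integral>\<^sup>+z. h z \<partial>resolvent \<Omega> X P (r + real n) y)"
proof -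
  obtain \<delta> where \<delta>: "0 < \<delta>"
    "\<And>t. 0 < t \<Longrightarrow> t < \<delta> \<Longrightarrow> d \<le> ennreal (exp (- r * t)) * (\<integral>\<^sup>+\<omega>. h (X t \<omega>) \<partial>P y)"
    using lim unfolding eventually_at_right_field by auto
  have lower: "d * ennreal (1 - exp (- n * (\<delta> / 2))) \<le> ennreal n * (\<integral>\<^sup>+z. h z \<partial>resolvent \<Omega> X P (r + n) y)"
    if n: "0 < n" for n
  proof -
    have [measurable]: "(\<lambda>t. (\<integral>\<^sup>+\<omega>. h (X t \<omega>) \<partial>P y) * indicator {0..} t) \<in> borel_measurable borel"
      using measurable_compose[OF measurable_Pair1' semigroup_measurable[OF h], of y] by simp
    have exp: "ennreal n * ennreal (exp (- (r + n) * t)) = ennreal (n * exp (- n * t)) * ennreal (exp (- r * t))" for t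
      using n by (simp add: ennreal_mult[symmetric] exp_add[symmetric] algebra_simps)
    have "d * ennreal (1 - exp (- n * (\<delta> / 2))) =
        (\<integral>\<^sup>+t. d * (ennreal (n * exp (- n * t)) * indicator {0..\<delta> / 2} t) \<partial>lborel)"
      using nn_integral_exponential(1)[OF n, of "\<delta> / 2"] \<delta>(1) by (simp add: nn_integral_cmult)
    also have "\<dots> \<le> (\<integral>\<^sup>+t. ennreal n * ennreal (exp (- (r + n) * t)) * ((\<integral>\<^sup>+\<omega>. h (X t \<omega>) \<partial>P y) * indicator {0..} t) \<partial>lborel)"
      unfolding exp
    proof (rule nn_integral_mono_AE)
      have "AE t in lborel. t \<noteq> (0 :: real)" by (rule AE_lborel_singleton)
      then show "AE t in lborel. d * (ennreal (n * exp (- n * t)) * indicator {0..\<delta> / 2} t) \<le>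
          ennreal (n * exp (- n * t)) * ennreal (exp (- r * t)) * ((\<integral>\<^sup>+\<omega>. h (X t \<omega>) \<partial>P y) * indicator {0..} t)"
      proof eventually_elim
        case (elim t)
        then show ?case
          using mult_left_mono[OF \<delta>(2)[of t], of "ennreal (n * exp (- n * t))"] \<delta>(1)
          by (cases "0 < t \<and> t < \<delta>") (auto simp: mult_ac indicator_def)
      qed
    qed
    also have "\<dots> = ennreal n * (\<integral>\<^sup>+z. h z \<partial>resolvent \<Omega> X P (r + n) y)"
      unfolding nn_integral_resolvent[OF h] by (simp add: nn_integral_cmult mult.assoc)
    finally show ?thesis .
  qed
  have "((\<lambda>n::nat. exp (- real n * (\<delta> / 2))) \<longlonglongrightarrow> 0)"
  proof -
    have "(\<lambda>n. exp (- (\<delta> / 2)) ^ n) \<longlonglongrightarrow> 0"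
      using \<delta>(1) by (intro LIMSEQ_realpow_zero) auto
    then show ?thesis by (simp add: exp_of_nat_mult[symmetric])
  qed
  then have "(\<lambda>n::nat. d * ennreal (1 - exp (- real n * (\<delta> / 2)))) \<longlonglongrightarrow> d * ennreal (1 - 0)"
    using d(2) by (intro ennreal_tendsto_cmult tendsto_ennrealI tendsto_intros) (auto simp: less_top)
  then have "\<forall>\<^sub>F n in sequentially. c < d * ennreal (1 - exp (- real n * (\<delta> / 2)))"
    using d(1) by (intro order_tendstoD) auto
  moreover have "\<forall>\<^sub>F n::nat in sequentially. 0 < n" by (rule eventually_gt_at_top)
  ultimately have "\<forall>\<^sub>F n in sequentially. 0 < n \<and> c < d * ennreal (1 - exp (- real n * (\<delta> / 2)))"
    by eventually_elim simp
  then obtain n where "0 < n" "c < d * ennreal (1 - exp (- real n * (\<delta> / 2)))"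
    by (auto simp: eventually_sequentially)
  with lower[of "real n"] that show ?thesis by (metis of_nat_0_less_iff order.strict_trans2)
qed

lemma initially_in_open:
  assumes W: "open W" "y \<in> W"
  shows "((\<lambda>t. \<integral>\<^sup>+\<omega>. indicator W (X t \<omega>) \<partial>P y) \<longlongrightarrow> 1) (at_right 0)"
proof (rule tendsto_at_right_sequentially[of 0 1])
  fix s :: "nat \<Rightarrow> real" assume s: "\<And>n. 0 < s n" "s \<longlonglongrightarrow> 0"
  interpret prob_space "P y" by (rule prob_space_P)
  have "(\<lambda>n. \<integral>\<^sup>+\<omega>. indicator W (X (s n) \<omega>) \<partial>P y) \<longlonglongrightarrow> (\<integral>\<^sup>+\<omega>. 1 \<partial>P y)"
  proof (rule nn_integral_dominated_convergence[where w="\<lambda>_. 1"])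
    fix n
    have [measurable]: "X (s n) \<in> borel_measurable (P y)" "W \<in> sets borel"
      using s(1)[of n] W by (auto intro: X_measurable)
    show "(\<lambda>\<omega>. indicator W (X (s n) \<omega>)) \<in> borel_measurable (P y)" by measurable
  next
    show "AE \<omega> in P y. (\<lambda>n. indicator W (X (s n) \<omega>)) \<longlonglongrightarrow> (1 :: ennreal)"
      using normal[of y] AE_space
    proof eventually_elim
      case (elim \<omega>)
      have "((\<lambda>t. X t \<omega>) \<longlongrightarrow> y) (at_right 0)"
        using right_continuous_paths[of \<omega> 0] elim by (simp add: continuous_within space_P)
      moreover have "filterlim s (at_right 0) sequentially"
        by (rule tendsto_imp_filterlim_at_right[OF s(2)]) (simp add: s(1))
      ultimately have "(\<lambda>n. X (s n) \<omega>) \<longlonglongrightarrow> y" by (rule filterlim_compose)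
      then have "\<forall>\<^sub>F n in sequentially. X (s n) \<omega> \<in> W" using W by (rule topological_tendstoD)
      then have "\<forall>\<^sub>F n in sequentially. indicator W (X (s n) \<omega>) = (1 :: ennreal)"
        by eventually_elim simp
      then show ?case by (rule tendsto_eventually)
    qed
  qed (auto simp: emeasure_space_1 indicator_def)
  then show "(\<lambda>n. \<integral>\<^sup>+\<omega>. indicator W (X (s n) \<omega>) \<partial>P y) \<longlonglongrightarrow> 1" by (simp add: emeasure_space_1)
qed simp

text \<open>
If \<open>f\<close> vanishes where \<open>\<phi> \<le> 0\<close>, nothing is collected before \<open>T\<close>; the strong Markov property at \<open>T\<close>
evaluates what is collected afterwards.
\<close>

lemma resolvent_at_debut:
  fixes \<phi> :: "real \<Rightarrow> real"
  assumes \<phi>: "continuous_on UNIV \<phi>" and f: "f \<in> borel_measurable borel"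
    and supp: "\<And>z. \<phi> z \<le> 0 \<Longrightarrow> f z = (0 :: ennreal)"
  defines "T \<equiv> debut 0 (\<lambda>t \<omega>. \<phi> (X t \<omega>))"
  shows "(\<integral>\<^sup>+y. f y \<partial>resolvent \<Omega> X P r x) =
    (\<integral>\<^sup>+\<omega>. ennreal (exp (- r * enn2real (T \<omega>))) *
      ((\<integral>\<^sup>+y. f y \<partial>resolvent \<Omega> X P r (X (enn2real (T \<omega>)) \<omega>)) * indicator {\<omega>. T \<omega> < \<infinity>} \<omega>) \<partial>P x)"
proof -
  have T: "stopping_time natural T"
    unfolding T_def by (rule entrance_stopping_time[OF \<phi>])
  have [measurable]: "T \<in> borel_measurable (P x)"
    and XT[measurable]: "(\<lambda>\<omega>. X (enn2real (T \<omega>)) \<omega>) \<in> borel_measurable (P x)"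
    using entrance_measurable_raw[OF \<phi>] entrance_position_measurable_raw[OF \<phi>] unfolding T_def
    by (simp_all cong: measurable_cong_sets add: sets_P)
  note [measurable] = X_jointly_measurable[of x] f
  interpret prob_space "P x" by (rule prob_space_P)
  interpret pair_sigma_finite "lborel :: real measure" "P x"
    by (intro pair_sigma_finite.intro sigma_finite_lborel sigma_finite_measure_axioms)
  define F where "F t \<omega> = ennreal (exp (- r * t)) * (f (X (max 0 t) \<omega>) * indicator {0..} t)" for t \<omega>
  have F_meas[measurable]: "(\<lambda>(t, \<omega>). F t \<omega>) \<in> borel_measurable (lborel \<Otimes>\<^sub>M P x)"
  proof -
    have "(\<lambda>p. ennreal (exp (- r * fst p)) * (f ((\<lambda>(t, \<omega>). X (max 0 t) \<omega>) p) * indicator {0..} (fst p)))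
        \<in> borel_measurable (borel \<Otimes>\<^sub>M P x)" by measurable
    then show ?thesis by (simp add: F_def split_beta' cong: measurable_cong_sets sets_pair_measure_cong)
  qed
  define w where "w u = ennreal (exp (- r * enn2real u))" for u
  have [measurable]: "w \<in> borel_measurable borel" unfolding w_def[abs_def] by measurable
  define K where "K s \<omega> = ennreal (exp (- r * s)) * (w (T \<omega>) * (f (X (enn2real (T \<omega>) + max 0 s) \<omega>) *
      indicator {\<omega>. T \<omega> < \<infinity>} \<omega>)) * indicator {0..} s" for s \<omega>
  have K_meas[measurable]: "(\<lambda>(s, \<omega>). K s \<omega>) \<in> borel_measurable (lborel \<Otimes>\<^sub>M P x)"
  proof -
    have "(\<lambda>p. ennreal (exp (- r * fst p)) * (w (T (snd p)) * (f ((\<lambda>(t, \<omega>). X (max 0 t) \<omega>) (enn2real (T (snd p)) + max 0 (fst p), snd p)) *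
        indicator {\<omega>. \<omega> < \<infinity>} (T (snd p)))) * indicator {0..} (fst p))
        \<in> borel_measurable (borel \<Otimes>\<^sub>M P x)" by measurable
    then show ?thesis by (simp add: K_def split_beta' indicator_def cong: measurable_cong_sets sets_pair_measure_cong)
  qed
  define Q where "Q z s = (\<integral>\<^sup>+\<eta>. f (X s \<eta>) \<partial>P z) * indicator {0..} s" for z s
  have Q_meas[measurable]: "(\<lambda>(z, s). Q z s) \<in> borel_measurable (borel \<Otimes>\<^sub>M borel)"
    unfolding Q_def by (rule semigroup_measurable[OF f])
  \<comment> \<open>\<open>F\<close> is the discounted rate at which \<open>f\<close> is collected at time \<open>t\<close>, \<open>K\<close> the same rate at time \<open>s\<close>
     after \<open>T\<close>, and \<open>Q\<close> the transition semigroup applied to \<open>f\<close>.\<close>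
  have "(\<integral>\<^sup>+y. f y \<partial>resolvent \<Omega> X P r x) = (\<integral>\<^sup>+t. \<integral>\<^sup>+\<omega>. F t \<omega> \<partial>P x \<partial>lborel)"
    unfolding nn_integral_resolvent[OF f]
  proof (rule nn_integral_cong)
    fix t :: real
    show "ennreal (exp (- r * t)) * ((\<integral>\<^sup>+\<omega>. f (X t \<omega>) \<partial>P x) * indicator {0..} t) = (\<integral>\<^sup>+\<omega>. F t \<omega> \<partial>P x)"
      using measurable_compose[OF X_measurable f, of t x]
      by (cases "0 \<le> t") (auto simp: F_def nn_integral_cmult)
  qed
  also have "\<dots> = (\<integral>\<^sup>+\<omega>. \<integral>\<^sup>+t. F t \<omega> \<partial>lborel \<partial>P x)"
    using Fubini[OF F_meas] by simp
  also have "\<dots> = (\<integral>\<^sup>+\<omega>. \<integral>\<^sup>+s. K s \<omega> \<partial>lborel \<partial>P x)"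
  proof (rule nn_integral_cong)
    fix \<omega> assume "\<omega> \<in> space (P x)"
    then have \<omega>: "\<omega> \<in> \<Omega>" by (simp add: space_P)
    have before: "f (X t \<omega>) = 0" if "0 \<le> t" "ennreal t < T \<omega>" for t
    proof (intro supp, rule ccontr)
      assume "\<not> \<phi> (X t \<omega>) \<le> 0"
      then have "T \<omega> \<le> ennreal t" unfolding T_def using that(1) by (intro debut_le) auto
      with that(2) show False by simp
    qed
    show "(\<integral>\<^sup>+t. F t \<omega> \<partial>lborel) = (\<integral>\<^sup>+s. K s \<omega> \<partial>lborel)"
    proof (cases "T \<omega> = \<infinity>")
      case True
      then have "F t \<omega> = 0" "K t \<omega> = 0" for t
        using before[of t] by (auto simp: F_def K_def indicator_def max_def)
      then show ?thesis by simp
    next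
      case False
      then obtain u where u: "T \<omega> = ennreal u" "0 \<le> u" by (cases "T \<omega>") auto
      have "(\<lambda>t. (\<lambda>(t, \<omega>). F t \<omega>) (t, \<omega>)) \<in> borel_measurable lborel"
        using \<omega> by (intro measurable_compose[OF _ F_meas]) (simp add: space_P)
      then have [measurable]: "(\<lambda>t. F t \<omega>) \<in> borel_measurable borel" by simp
      have "(\<integral>\<^sup>+t. F t \<omega> \<partial>lborel) = (\<integral>\<^sup>+t. F t \<omega> * indicator {u..} t \<partial>lborel)"
        using before u by (intro nn_integral_cong) (auto simp: F_def indicator_def max_def ennreal_less_iff)
      also have "\<dots> = (\<integral>\<^sup>+s. F (u + s) \<omega> * indicator {u..} (u + s) \<partial>lborel)"
        using nn_integral_real_affine[of "\<lambda>t. F t \<omega> * indicator {u..} t" 1 u] by simp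
      also have "\<dots> = (\<integral>\<^sup>+s. K s \<omega> \<partial>lborel)"
      proof (rule nn_integral_cong)
        fix s :: real
        have "ennreal (exp (- r * (u + s))) = ennreal (exp (- r * s)) * ennreal (exp (- r * u))"
          by (simp add: ennreal_mult[symmetric] exp_add[symmetric] algebra_simps)
        then show "F (u + s) \<omega> * indicator {u..} (u + s) = K s \<omega>"
          using u by (auto simp: F_def K_def w_def indicator_def mult.assoc)
      qed
      finally show ?thesis .
    qed
  qed
  also have "\<dots> = (\<integral>\<^sup>+s. \<integral>\<^sup>+\<omega>. K s \<omega> \<partial>P x \<partial>lborel)"
    using Fubini[OF K_meas] by simp
  also have "\<dots> = (\<integral>\<^sup>+s. \<integral>\<^sup>+\<omega>. ennreal (exp (- r * s)) * (w (T \<omega>) * (Q (X (enn2real (T \<omega>)) \<omega>) s *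
      indicator {\<omega>. T \<omega> < \<infinity>} \<omega>)) \<partial>P x \<partial>lborel)"
  proof (rule nn_integral_cong)
    fix s :: real
    show "(\<integral>\<^sup>+\<omega>. K s \<omega> \<partial>P x) = (\<integral>\<^sup>+\<omega>. ennreal (exp (- r * s)) * (w (T \<omega>) * (Q (X (enn2real (T \<omega>)) \<omega>) s *
      indicator {\<omega>. T \<omega> < \<infinity>} \<omega>)) \<partial>P x)"
    proof (cases "0 \<le> s")
      case True
      have [measurable]: "(\<lambda>\<omega>. X (enn2real (T \<omega>) + s) \<omega>) \<in> borel_measurable (P x)"
      proof -
        have "(\<lambda>\<omega>. (\<lambda>(t, \<omega>). X (max 0 t) \<omega>) (enn2real (T \<omega>) + s, \<omega>)) \<in> borel_measurable (P x)" by measurable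
        then show ?thesis using True by simp
      qed
      note [measurable] = transition_measurable[OF f True]
      have "(\<integral>\<^sup>+\<omega>. w (T \<omega>) * (f (X (enn2real (T \<omega>) + s) \<omega>) * indicator {\<omega>. T \<omega> < \<infinity>} \<omega>) \<partial>P x) =
          (\<integral>\<^sup>+\<omega>. w (T \<omega>) * ((\<integral>\<^sup>+\<eta>. f (X s \<eta>) \<partial>P (X (enn2real (T \<omega>)) \<omega>)) * indicator {\<omega>. T \<omega> < \<infinity>} \<omega>) \<partial>P x)"
        using strong_markov_weighted[OF T True f, of w x] by (simp add: nn_integral_completion)
      then show ?thesis
        using True unfolding K_def Q_def by (simp add: nn_integral_cmult)
    qed (simp add: K_def Q_def)
  qed
  also have "\<dots> = (\<integral>\<^sup>+\<omega>. \<integral>\<^sup>+s. ennreal (exp (- r * s)) * (w (T \<omega>) * (Q (X (enn2real (T \<omega>)) \<omega>) s *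
      indicator {\<omega>. T \<omega> < \<infinity>} \<omega>)) \<partial>lborel \<partial>P x)"
  proof -
    have "(\<lambda>p. ennreal (exp (- r * fst p)) * (w (T (snd p)) * ((\<lambda>(z, s). Q z s) (X (enn2real (T (snd p))) (snd p), fst p) *
        indicator {\<omega>. \<omega> < \<infinity>} (T (snd p))))) \<in> borel_measurable (lborel \<Otimes>\<^sub>M P x)"
      by measurable
    from Fubini'[of "\<lambda>s \<omega>. ennreal (exp (- r * s)) * (w (T \<omega>) * (Q (X (enn2real (T \<omega>)) \<omega>) s *
        indicator {\<omega>. T \<omega> < \<infinity>} \<omega>))"] this
    show ?thesis by (simp add: split_beta' indicator_def)
  qed
  also have "\<dots> = (\<integral>\<^sup>+\<omega>. w (T \<omega>) * ((\<integral>\<^sup>+y. f y \<partial>resolvent \<Omega> X P r (X (enn2real (T \<omega>)) \<omega>)) *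
      indicator {\<omega>. T \<omega> < \<infinity>} \<omega>) \<partial>P x)"
  proof (rule nn_integral_cong)
    fix \<omega>
    let ?z = "X (enn2real (T \<omega>)) \<omega>"
    have "(\<lambda>s. (\<lambda>(z, s). Q z s) (?z, s)) \<in> borel_measurable borel"
      by (intro measurable_compose[OF _ Q_meas]) simp
    then have [measurable]: "(\<lambda>s. Q ?z s) \<in> borel_measurable borel" by simp
    have "(\<integral>\<^sup>+s. ennreal (exp (- r * s)) * (w (T \<omega>) * (Q ?z s * indicator {\<omega>. T \<omega> < \<infinity>} \<omega>)) \<partial>lborel) =
        (\<integral>\<^sup>+s. (w (T \<omega>) * indicator {\<omega>. T \<omega> < \<infinity>} \<omega>) * (ennreal (exp (- r * s)) * Q ?z s) \<partial>lborel)"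
      by (simp add: ac_simps)
    also have "\<dots> = (w (T \<omega>) * indicator {\<omega>. T \<omega> < \<infinity>} \<omega>) * (\<integral>\<^sup>+s. ennreal (exp (- r * s)) * Q ?z s \<partial>lborel)"
      by (rule nn_integral_cmult) measurable
    also have "(\<integral>\<^sup>+s. ennreal (exp (- r * s)) * Q ?z s \<partial>lborel) = (\<integral>\<^sup>+y. f y \<partial>resolvent \<Omega> X P r ?z)"
      unfolding nn_integral_resolvent[OF f] Q_def ..
    finally show "(\<integral>\<^sup>+s. ennreal (exp (- r * s)) * (w (T \<omega>) * (Q ?z s * indicator {\<omega>. T \<omega> < \<infinity>} \<omega>)) \<partial>lborel) =
        w (T \<omega>) * ((\<integral>\<^sup>+y. f y \<partial>resolvent \<Omega> X P r ?z) * indicator {\<omega>. T \<omega> < \<infinity>} \<omega>)"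
      by (simp add: ac_simps)
  qed
  finally show ?thesis unfolding w_def .
qed

end

section \<open>Coexcessive functions and balayage of the Green kernel\<close>

context green_duality
begin

text \<open>
An excessive function for the dual process is the supremum of the functions \<open>n G (r + n) h\<^sub>N\<close> formed with
the dual resolvent, where \<open>h\<^sub>N\<close> is \<open>h\<close> truncated to be bounded with compact support. Each of these is
continuous by assumption \<open>h3\<close>, and a supremum of continuous functions is lower semicontinuous.
\<close>

lemma coexcessive_lower_semicontinuous:
  assumes r: "0 \<le> r" and h: "excessive X' P' r h" and c: "c < h y"
  obtains W where "open W" "y \<in> W" "\<And>z. z \<in> W \<Longrightarrow> c < h z"
proof -
  have [measurable]: "h \<in> borel_measurable borel"
    and supermedian: "\<And>z t. 0 \<le> t \<Longrightarrow> ennreal (exp (- r * t)) * (\<integral>\<^sup>+\<omega>. h (X' t \<omega>) \<partial>P' z) \<le> h z"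
    and lim: "((\<lambda>t. ennreal (exp (- r * t)) * (\<integral>\<^sup>+\<omega>. h (X' t \<omega>) \<partial>P' y)) \<longlongrightarrow> h y) (at_right 0)"
    using h by (auto simp: excessive_def)
  obtain d where d: "c < d" "d < h y" using dense[OF c] by auto
  have "\<forall>\<^sub>F t in at_right 0. d \<le> ennreal (exp (- r * t)) * (\<integral>\<^sup>+\<omega>. h (X' t \<omega>) \<partial>P' y)"
    using order_tendstoD(1)[OF lim d(2)] by eventually_elim (rule less_imp_le)
  moreover have "d < \<infinity>" using d(2) by (metis infinity_ennreal_def order.strict_trans2 top_greatest)
  ultimately obtain n :: nat where n: "0 < n"
    "c < ennreal (real n) * (\<integral>\<^sup>+z. h z \<partial>resolvent \<Omega>' X' P' (r + real n) y)"
    using dual.resolvent_approximation[of h d r y c] d(1) by auto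
  define hN where "hN N z = enn2real (min (h z) (ennreal (real N))) * indicator {- real N..real N} z" for N :: nat and z
  have hN: "ennreal (hN N z) = min (h z) (ennreal (real N)) * indicator {- real N..real N} z" for N z
    unfolding hN_def by (auto simp: indicator_def min_less_iff_disj)
  have hN_meas[measurable]: "hN N \<in> borel_measurable borel" for N
    unfolding hN_def[abs_def] by measurable
  have hN_nonneg: "0 \<le> hN N z" for N z by (simp add: hN_def)
  have hN_Bo: "hN N \<in> B\<^sub>o" for N
  proof -
    have "hN N z \<le> real N" for z
    proof -
      have "ennreal (hN N z) \<le> ennreal (real N)" unfolding hN by (auto simp: indicator_def)
      then show ?thesis by (subst (asm) ennreal_le_iff) auto
    qed
    with hN_nonneg have "bounded (range (hN N))" by (intro boundedI[of _ "real N"]) auto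
    moreover have "bounded {z. hN N z \<noteq> 0}"
      by (rule bounded_subset[of "{- real N..real N}"]) (auto simp: hN_def indicator_def split: if_splits)
    ultimately show ?thesis by (simp add: B\<^sub>o_def hN_meas compact_closure)
  qed
  have inc: "incseq (\<lambda>N z. ennreal (hN N z))"
  proof (unfold incseq_def le_fun_def, intro allI impI)
    fix M N :: nat and z assume "M \<le> N"
    then have "ennreal (real M) \<le> ennreal (real N)" "{- real M..real M} \<subseteq> {- real N..real N}"
      by (auto simp: ennreal_leI)
    then show "ennreal (hN M z) \<le> ennreal (hN N z)"
      unfolding hN by (intro mult_mono min.mono) (auto simp: indicator_def)
  qed
  have sup: "(SUP N. ennreal (hN N z)) = h z" for z
  proof (rule antisym)
    show "(SUP N. ennreal (hN N z)) \<le> h z"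
      unfolding hN by (intro SUP_least) (auto simp: indicator_def)
    have "(SUP N. ennreal (real N)) = top"
      using ennreal_SUP_of_nat_eq_top by (simp add: ennreal_of_nat_eq_real_of_nat)
    then have "h z = min (h z) (SUP N. ennreal (real N))"
      by (simp only: min_top2)
    also have "\<dots> = (SUP N. min (h z) (ennreal (real N)))"
      by (simp add: inf_min[symmetric] inf_SUP)
    also have "\<dots> \<le> (SUP N. ennreal (hN N z))"
    proof (rule SUP_least)
      fix N :: nat
      obtain k :: nat where k: "\<bar>z\<bar> \<le> real k" using real_arch_simple by blast
      have "min (h z) (ennreal (real N)) \<le> min (h z) (ennreal (real (max N k)))"
        by (intro min.mono order_refl ennreal_leI) simp
      also have "\<dots> = ennreal (hN (max N k) z)"
        using k unfolding hN by (auto simp: indicator_def)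
      also have "\<dots> \<le> (SUP N. ennreal (hN N z))" by (rule SUP_upper) simp
      finally show "min (h z) (ennreal (real N)) \<le> (SUP N. ennreal (hN N z))" .
    qed
    finally show "h z \<le> (SUP N. ennreal (hN N z))" .
  qed
  let ?R = "\<lambda>z. resolvent \<Omega>' X' P' (r + real n) z"
  have "(\<integral>\<^sup>+z. h z \<partial>?R y) = (SUP N. \<integral>\<^sup>+z. ennreal (hN N z) \<partial>?R y)"
    unfolding sup[symmetric] by (rule nn_integral_monotone_convergence_SUP[OF inc]) measurable
  then have "c < (SUP N. ennreal (real n) * (\<integral>\<^sup>+z. ennreal (hN N z) \<partial>?R y))"
    using n(2) by (simp add: SUP_mult_left_ennreal)
  then obtain N where N: "c < ennreal (real n) * (\<integral>\<^sup>+z. ennreal (hN N z) \<partial>?R y)"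
    by (auto simp: less_SUP_iff)
  have integrable: "integrable (?R z) (hN N)" and cont: "continuous_on UNIV (\<lambda>z. \<integral>y. hN N y \<partial>?R z)" for z
    using h3[OF _ hN_Bo, of "r + real n" N] r by auto
  have eq: "ennreal (real n) * (\<integral>\<^sup>+y. ennreal (hN N y) \<partial>?R z) = ennreal (real n * (\<integral>y. hN N y \<partial>?R z))" for z
    using nn_integral_eq_integral[OF integrable] hN_nonneg by (simp add: ennreal_mult)
  show ?thesis
  proof (rule that[of "{z. c < ennreal (real n * (\<integral>y. hN N y \<partial>?R z))}"])
    show "open {z. c < ennreal (real n * (\<integral>y. hN N y \<partial>?R z))}"
      by (intro open_Collect_less continuous_intros continuous_on_ennreal cont)
    show "y \<in> {z. c < ennreal (real n * (\<integral>y. hN N y \<partial>?R z))}" using N eq by simp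
    fix z assume "z \<in> {z. c < ennreal (real n * (\<integral>y. hN N y \<partial>?R z))}"
    then have "c < ennreal (real n) * (\<integral>\<^sup>+y. ennreal (hN N y) \<partial>?R z)" using eq by simp
    also have "\<dots> \<le> ennreal (real n) * (\<integral>\<^sup>+y. h y \<partial>?R z)"
      unfolding hN by (intro mult_left_mono nn_integral_mono) (auto simp: indicator_def)
    also have "\<dots> \<le> h z"
      using n(1) by (intro dual.resolvent_supermedian_le supermedian) auto
    finally show "c < h z" .
  qed
qed

text \<open>
If \<open>h y > e\<close>, then \<open>h > e\<close> near \<open>y\<close>, so \<open>k \<ge> e\<close> almost everywhere near \<open>y\<close>. The dual resolvent does not
charge \<open>m\<close>-null sets, and the dual process stays near \<open>y\<close> for a while, so that averaging \<open>k\<close> over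
short times gives a value above any \<open>c < e\<close>; supermedianity of \<open>k\<close> bounds this average by \<open>k y\<close>.
\<close>

lemma coexcessive_domination_on_open:
  assumes r: "0 \<le> r" and h: "excessive X' P' r h"
    and k[measurable]: "k \<in> borel_measurable borel"
    and supermedian: "\<And>t. 0 \<le> t \<Longrightarrow> ennreal (exp (- r * t)) * (\<integral>\<^sup>+\<omega>. k (X' t \<omega>) \<partial>P' y) \<le> k y"
    and U: "open U" "y \<in> U" and AE: "AE z in m. z \<in> U \<longrightarrow> h z \<le> k z"
  shows "h y \<le> k y"
proof (rule dense_le)
  fix c assume "c < h y"
  then obtain e where e: "c < e" "e < h y" using dense by blast
  obtain d where d: "c < d" "d < e" using dense[OF e(1)] by auto
  have e_fin: "e < \<infinity>" and d_fin: "d < \<infinity>"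
    using e(2) d(2) by (metis infinity_ennreal_def order.strict_trans2 top_greatest)+
  obtain W where W: "open W" "y \<in> W" "\<And>z. z \<in> W \<Longrightarrow> e < h z"
    using coexcessive_lower_semicontinuous[OF r h e(2)] by blast
  define l where "l z = e * indicator (W \<inter> U) z" for z
  have [measurable]: "W \<inter> U \<in> sets borel" using W U by auto
  have [measurable]: "l \<in> borel_measurable borel" unfolding l_def[abs_def] by measurable
  have int_l: "(\<integral>\<^sup>+\<omega>. l (X' t \<omega>) \<partial>P' y) = e * (\<integral>\<^sup>+\<omega>. indicator (W \<inter> U) (X' t \<omega>) \<partial>P' y)" if "0 < t" for t
  proof -
    have [measurable]: "X' t \<in> borel_measurable (P' y)" using that by (intro dual.X_measurable) simp
    show ?thesis unfolding l_def by (intro nn_integral_cmult) measurable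
  qed
  have "((\<lambda>t. \<integral>\<^sup>+\<omega>. indicator (W \<inter> U) (X' t \<omega>) \<partial>P' y) \<longlongrightarrow> 1) (at_right 0)"
    using W U by (intro dual.initially_in_open) auto
  then have "((\<lambda>t. ennreal (exp (- r * t)) * (e * (\<integral>\<^sup>+\<omega>. indicator (W \<inter> U) (X' t \<omega>) \<partial>P' y))) \<longlongrightarrow>
      ennreal (exp (- r * 0)) * (e * 1)) (at_right 0)"
    using e_fin by (intro tendsto_mult_ennreal tendsto_ennrealI tendsto_intros) auto
  then have "\<forall>\<^sub>F t in at_right 0. d < ennreal (exp (- r * t)) * (e * (\<integral>\<^sup>+\<omega>. indicator (W \<inter> U) (X' t \<omega>) \<partial>P' y))"
    using d(2) by (intro order_tendstoD) auto
  moreover have "\<forall>\<^sub>F t in at_right 0. 0 < (t :: real)" by (rule eventually_at_right_less)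
  ultimately have "\<forall>\<^sub>F t in at_right 0. d \<le> ennreal (exp (- r * t)) * (\<integral>\<^sup>+\<omega>. l (X' t \<omega>) \<partial>P' y)"
    by eventually_elim (simp add: int_l less_imp_le)
  then obtain n :: nat where n: "0 < n" "c < ennreal (real n) * (\<integral>\<^sup>+z. l z \<partial>resolvent \<Omega>' X' P' (r + real n) y)"
    using dual.resolvent_approximation[of l d r y c] d(1) d_fin by auto
  note n(2)
  also have "ennreal (real n) * (\<integral>\<^sup>+z. l z \<partial>resolvent \<Omega>' X' P' (r + real n) y) \<le>
      ennreal (real n) * (\<integral>\<^sup>+z. k z \<partial>resolvent \<Omega>' X' P' (r + real n) y)"
  proof (intro mult_left_mono nn_integral_mono_AE)
    have G[measurable]: "(\<lambda>x. G (r + real n) x y) \<in> borel_measurable m"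
      using green_coexcessive green_excessive[of "r + real n" y] r sets_m
      by (simp add: excessive_def cong: measurable_cong_sets)
    have "AE z in m. l z \<le> k z"
      using AE by eventually_elim (use W(3) in \<open>force simp: l_def indicator_def\<close>)
    then show "AE z in resolvent \<Omega>' X' P' (r + real n) y. l z \<le> k z"
      using r by (subst green_dual) (auto simp: AE_density)
  qed simp
  also have "\<dots> \<le> k y"
    using n(1) by (intro dual.resolvent_supermedian_le supermedian) auto
  finally show "c \<le> k y" by (rule less_imp_le)
qed

text \<open>
Balayage of the Green kernel onto an open neighbourhood of \<open>y\<close>. Both sides are densities, on the set
where \<open>\<phi>\<close> is positive, of the two measures that \<open>resolvent_at_debut\<close> identifies, so they agree
almost everywhere there. The right-hand side is a mixture of coexcessive functions of \<open>y\<close>, and the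
domination principle removes the exceptional set.
\<close>

lemma green_kernel_le_at_debut:
  fixes \<phi> :: "real \<Rightarrow> real"
  assumes r: "0 \<le> r" and \<phi>: "continuous_on UNIV \<phi>" and y: "0 < \<phi> y"
  defines "T \<equiv> debut 0 (\<lambda>t \<omega>. \<phi> (X t \<omega>))"
  shows "G r x y \<le> (\<integral>\<^sup>+\<omega>. ennreal (exp (- r * enn2real (T \<omega>))) *
      (G r (X (enn2real (T \<omega>)) \<omega>) y * indicator {\<omega>. T \<omega> < \<infinity>} \<omega>) \<partial>P x)"
proof -
  have [measurable]: "T \<in> borel_measurable (P x)" "(\<lambda>\<omega>. X (enn2real (T \<omega>)) \<omega>) \<in> borel_measurable (P x)"
    using X.entrance_measurable_raw[OF \<phi>] X.entrance_position_measurable_raw[OF \<phi>] unfolding T_def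
    by (simp_all cong: measurable_cong_sets add: X.sets_P)
  interpret Px: prob_space "P x" by (rule X.prob_space_P)
  interpret m: sigma_finite_measure m by (rule sigma_finite_m)
  define w where "w \<omega> = ennreal (exp (- r * enn2real (T \<omega>))) * indicator {\<omega>. T \<omega> < \<infinity>} \<omega>" for \<omega>
  have [measurable]: "w \<in> borel_measurable (P x)" unfolding w_def[abs_def] by measurable
  have G_meas[measurable]: "(\<lambda>p. G r (fst p) (snd p)) \<in> borel_measurable (borel \<Otimes>\<^sub>M borel)"
    using green_measurable[OF r] by (simp add: split_beta')
  have G_section: "(\<lambda>y. G r z y) \<in> borel_measurable borel" for z
    using green_coexcessive[OF r, of z] by (simp add: excessive_def)
  define k where "k y = (\<integral>\<^sup>+\<omega>. w \<omega> * G r (X (enn2real (T \<omega>)) \<omega>) y \<partial>P x)" for y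
  have joint: "(\<lambda>(y, \<omega>). w \<omega> * G r (X (enn2real (T \<omega>)) \<omega>) y) \<in> borel_measurable (borel \<Otimes>\<^sub>M P x)"
  proof -
    have "(\<lambda>p. w (snd p) * (\<lambda>p. G r (fst p) (snd p)) (X (enn2real (T (snd p))) (snd p), fst p))
        \<in> borel_measurable (borel \<Otimes>\<^sub>M P x)" by measurable
    then show ?thesis by (simp add: split_beta')
  qed
  have k_meas[measurable]: "k \<in> borel_measurable borel"
    unfolding k_def[abs_def] using joint by (rule Px.borel_measurable_nn_integral)
  have Fubini: "(\<integral>\<^sup>+y. k y * f y \<partial>M) = (\<integral>\<^sup>+\<omega>. w \<omega> * (\<integral>\<^sup>+y. G r (X (enn2real (T \<omega>)) \<omega>) y * f y \<partial>M) \<partial>P x)"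
    if "sigma_finite_measure M" and M: "sets M = sets borel" and f: "f \<in> borel_measurable M" for M f
  proof -
    interpret M: sigma_finite_measure M by fact
    interpret pair_sigma_finite "P x" M ..
    have [measurable]: "f \<in> borel_measurable borel" using f M by (simp cong: measurable_cong_sets)
    have [measurable]: "(\<lambda>y. G r z y) \<in> borel_measurable M" for z
      using G_section M by (simp cong: measurable_cong_sets)
    note f[measurable]
    have "(\<lambda>p. (w (fst p) * (\<lambda>p. G r (fst p) (snd p)) (X (enn2real (T (fst p))) (fst p), snd p)) * f (snd p))
        \<in> borel_measurable (P x \<Otimes>\<^sub>M borel)" by measurable
    then have J: "(\<lambda>(\<omega>, y). w \<omega> * G r (X (enn2real (T \<omega>)) \<omega>) y * f y) \<in> borel_measurable (P x \<Otimes>\<^sub>M M)"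
      using M by (simp add: split_beta' cong: measurable_cong_sets sets_pair_measure_cong)
    have [measurable]: "(\<lambda>\<omega>. G r (X (enn2real (T \<omega>)) \<omega>) y) \<in> borel_measurable (P x)" for y
    proof -
      have "(\<lambda>\<omega>. (\<lambda>p. G r (fst p) (snd p)) (X (enn2real (T \<omega>)) \<omega>, y)) \<in> borel_measurable (P x)" by measurable
      then show ?thesis by simp
    qed
    have "(\<integral>\<^sup>+y. k y * f y \<partial>M) = (\<integral>\<^sup>+y. \<integral>\<^sup>+\<omega>. w \<omega> * G r (X (enn2real (T \<omega>)) \<omega>) y * f y \<partial>P x \<partial>M)"
      unfolding k_def by (intro nn_integral_cong nn_integral_multc[symmetric]) measurable
    also have "\<dots> = (\<integral>\<^sup>+\<omega>. \<integral>\<^sup>+y. w \<omega> * G r (X (enn2real (T \<omega>)) \<omega>) y * f y \<partial>M \<partial>P x)"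
      by (rule Fubini'[OF J])
    also have "\<dots> = (\<integral>\<^sup>+\<omega>. w \<omega> * (\<integral>\<^sup>+y. G r (X (enn2real (T \<omega>)) \<omega>) y * f y \<partial>M) \<partial>P x)"
      by (simp add: mult.assoc nn_integral_cmult)
    finally show ?thesis .
  qed
  have "G r x y \<le> k y"
  proof (rule coexcessive_domination_on_open[OF r green_coexcessive[OF r] k_meas])
    fix t :: real assume t: "0 \<le> t"
    \<comment> \<open>Integrating against the law of the dual process at time \<open>t\<close> reduces supermedianity to \<open>Fubini\<close>.\<close>
    define D where "D = distr (P' y) borel (X' t)"
    have X't[measurable]: "X' t \<in> borel_measurable (P' y)" using t by (rule dual.X_measurable)
    interpret D: prob_space D
      unfolding D_def by (intro prob_space.prob_space_distr dual.prob_space_P X't)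
    have "(\<integral>\<^sup>+\<eta>. k (X' t \<eta>) \<partial>P' y) = (\<integral>\<^sup>+z. k z * 1 \<partial>D)"
      unfolding D_def by (simp add: nn_integral_distr)
    also have "\<dots> = (\<integral>\<^sup>+\<omega>. w \<omega> * (\<integral>\<^sup>+z. G r (X (enn2real (T \<omega>)) \<omega>) z * 1 \<partial>D) \<partial>P x)"
      by (rule Fubini) (auto simp: D_def D.sigma_finite_measure_axioms[unfolded D_def])
    also have "\<dots> = (\<integral>\<^sup>+\<omega>. w \<omega> * (\<integral>\<^sup>+\<eta>. G r (X (enn2real (T \<omega>)) \<omega>) (X' t \<eta>) \<partial>P' y) \<partial>P x)"
      unfolding D_def using G_section by (simp add: nn_integral_distr)
    finally have "ennreal (exp (- r * t)) * (\<integral>\<^sup>+\<eta>. k (X' t \<eta>) \<partial>P' y) =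
        ennreal (exp (- r * t)) * (\<integral>\<^sup>+\<omega>. w \<omega> * (\<integral>\<^sup>+\<eta>. G r (X (enn2real (T \<omega>)) \<omega>) (X' t \<eta>) \<partial>P' y) \<partial>P x)"
      by simp
    also have "\<dots> = (\<integral>\<^sup>+\<omega>. ennreal (exp (- r * t)) * (w \<omega> * (\<integral>\<^sup>+\<eta>. G r (X (enn2real (T \<omega>)) \<omega>) (X' t \<eta>) \<partial>P' y)) \<partial>P x)"
    proof (rule nn_integral_cmult[symmetric])
      interpret P'y: prob_space "P' y" by (rule dual.prob_space_P)
      have "(\<lambda>p. (\<lambda>p. G r (fst p) (snd p)) (X (enn2real (T (fst p))) (fst p), X' t (snd p))) \<in> borel_measurable (P x \<Otimes>\<^sub>M P' y)"
        by measurable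
      then have "(\<lambda>(\<omega>, \<eta>). G r (X (enn2real (T \<omega>)) \<omega>) (X' t \<eta>)) \<in> borel_measurable (P x \<Otimes>\<^sub>M P' y)"
        by (simp add: split_beta')
      note [measurable] = P'y.borel_measurable_nn_integral[OF this]
      show "(\<lambda>\<omega>. w \<omega> * (\<integral>\<^sup>+\<eta>. G r (X (enn2real (T \<omega>)) \<omega>) (X' t \<eta>) \<partial>P' y)) \<in> borel_measurable (P x)"
        by measurable
    qed
    also have "\<dots> \<le> k y"
      unfolding k_def
    proof (rule nn_integral_mono)
      fix \<omega>
      have "ennreal (exp (- r * t)) * (\<integral>\<^sup>+\<eta>. G r (X (enn2real (T \<omega>)) \<omega>) (X' t \<eta>) \<partial>P' y) \<le> G r (X (enn2real (T \<omega>)) \<omega>) y"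
        using green_coexcessive[OF r] t by (auto simp: excessive_def)
      from mult_left_mono[OF this, of "w \<omega>"]
      show "ennreal (exp (- r * t)) * (w \<omega> * (\<integral>\<^sup>+\<eta>. G r (X (enn2real (T \<omega>)) \<omega>) (X' t \<eta>) \<partial>P' y)) \<le>
          w \<omega> * G r (X (enn2real (T \<omega>)) \<omega>) y"
        by (simp add: mult.left_commute)
    qed
    finally show "ennreal (exp (- r * t)) * (\<integral>\<^sup>+\<eta>. k (X' t \<eta>) \<partial>P' y) \<le> k y" .
  next
    define U where "U = {z. 0 < \<phi> z}"
    show U_open: "open U" unfolding U_def by (intro open_Collect_less continuous_intros \<phi>)
    show "y \<in> U" using y by (simp add: U_def)
    have [measurable]: "k \<in> borel_measurable m" "(\<lambda>y. G r z y) \<in> borel_measurable m" "U \<in> sets m" for z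
      using k_meas G_section U_open sets_m by (auto cong: measurable_cong_sets)
    have "density m (\<lambda>y. G r x y * indicator U y) = density m (\<lambda>y. k y * indicator U y)"
    proof (rule measure_eqI)
      fix A assume "A \<in> sets (density m (\<lambda>y. G r x y * indicator U y))"
      then have [measurable]: "A \<in> sets m" by simp
      define f :: "real \<Rightarrow> ennreal" where "f = indicator (A \<inter> U)"
      have f_meas: "f \<in> borel_measurable borel"
        unfolding f_def using U_open \<open>A \<in> sets m\<close> by (intro borel_measurable_indicator) (auto simp: sets_m)
      have [measurable]: "f \<in> borel_measurable m" unfolding f_def by measurable
      have res: "(\<integral>\<^sup>+y. f y \<partial>resolvent \<Omega> X P r z) = (\<integral>\<^sup>+y. G r z y * f y \<partial>m)" for z
        using r by (simp add: h1 nn_integral_density)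
      have "(\<integral>\<^sup>+y. G r x y * f y \<partial>m) = (\<integral>\<^sup>+\<omega>. w \<omega> * (\<integral>\<^sup>+y. G r (X (enn2real (T \<omega>)) \<omega>) y * f y \<partial>m) \<partial>P x)"
        using X.resolvent_at_debut[OF \<phi> f_meas, of r x] unfolding res T_def[symmetric] w_def
        by (auto simp: f_def U_def indicator_def mult_ac)
      also have "\<dots> = (\<integral>\<^sup>+y. k y * f y \<partial>m)"
        by (rule Fubini[symmetric]) (auto simp: sets_m m.sigma_finite_measure_axioms)
      finally show "emeasure (density m (\<lambda>y. G r x y * indicator U y)) A =
          emeasure (density m (\<lambda>y. k y * indicator U y)) A"
        unfolding f_def by (simp add: emeasure_density indicator_inter_arith mult_ac)
    qed simp
    then have "AE z in m. G r x z * indicator U z = k z * indicator U z"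
      by (intro m.density_unique) measurable
    then show "AE z in m. z \<in> U \<longrightarrow> G r x z \<le> k z"
      by eventually_elim (auto simp: indicator_def)
  qed
  then show ?thesis unfolding k_def w_def by (simp add: mult_ac)
qed

lemma green_measurable_pair:
  assumes r: "0 \<le> r" and M: "sets M' = sets borel" and f: "f \<in> borel_measurable N"
  shows "(\<lambda>p. G r (f (fst p)) (snd p)) \<in> borel_measurable (N \<Otimes>\<^sub>M M')"
proof -
  have [measurable]: "(\<lambda>p. G r (fst p) (snd p)) \<in> borel_measurable (borel \<Otimes>\<^sub>M borel)"
    using green_measurable[OF r] by (simp add: split_beta')
  note f[measurable]
  have "(\<lambda>p. (\<lambda>p. G r (fst p) (snd p)) (f (fst p), snd p)) \<in> borel_measurable (N \<Otimes>\<^sub>M borel)"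
    by measurable
  then show ?thesis using M by (simp cong: measurable_cong_sets sets_pair_measure_cong)
qed

context
  fixes \<sigma> :: "real measure" and S :: "real set" and r :: real
  assumes sigma_finite_\<sigma>: "sigma_finite_measure \<sigma>" and sets_\<sigma>: "sets \<sigma> = sets borel"
    and S_borel: "S \<in> sets borel" and r: "0 \<le> r"
begin

lemma integral_of_potential:
  assumes "sigma_finite_measure N" and w[measurable]: "w \<in> borel_measurable N" and f[measurable]: "f \<in> borel_measurable N"
  shows "(\<integral>\<^sup>+\<omega>. w \<omega> * (\<integral>\<^sup>+y\<in>S. G r (f \<omega>) y \<partial>\<sigma>) \<partial>N) = (\<integral>\<^sup>+y\<in>S. (\<integral>\<^sup>+\<omega>. w \<omega> * G r (f \<omega>) y \<partial>N) \<partial>\<sigma>)"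
proof -
  interpret N: sigma_finite_measure N by fact
  interpret \<sigma>: sigma_finite_measure \<sigma> by (rule sigma_finite_\<sigma>)
  interpret pair_sigma_finite N \<sigma> ..
  have [measurable]: "S \<in> sets \<sigma>" using S_borel by (simp add: sets_\<sigma>)
  note J[measurable] = green_measurable_pair[OF r sets_\<sigma> f]
  have [measurable]: "(\<lambda>y. G r z y) \<in> borel_measurable \<sigma>" for z
    using green_coexcessive[OF r, of z] by (simp add: excessive_def sets_\<sigma> cong: measurable_cong_sets)
  have [measurable]: "(\<lambda>\<omega>. G r (f \<omega>) y) \<in> borel_measurable N" for y
    using green_excessive[OF r, of y] by (intro measurable_compose[OF f]) (simp add: excessive_def)
  have "(\<integral>\<^sup>+\<omega>. w \<omega> * (\<integral>\<^sup>+y\<in>S. G r (f \<omega>) y \<partial>\<sigma>) \<partial>N) = (\<integral>\<^sup>+\<omega>. \<integral>\<^sup>+y. w \<omega> * G r (f \<omega>) y * indicator S y \<partial>\<sigma> \<partial>N)"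
    by (simp add: nn_integral_cmult mult.assoc)
  also have "\<dots> = (\<integral>\<^sup>+y. \<integral>\<^sup>+\<omega>. w \<omega> * G r (f \<omega>) y * indicator S y \<partial>N \<partial>\<sigma>)"
    by (rule Fubini'[symmetric]) (simp add: split_beta')
  also have "\<dots> = (\<integral>\<^sup>+y\<in>S. (\<integral>\<^sup>+\<omega>. w \<omega> * G r (f \<omega>) y \<partial>N) \<partial>\<sigma>)"
    by (simp add: nn_integral_multc)
  finally show ?thesis .
qed

lemma potential_supermedian:
  assumes t: "0 \<le> t"
  shows "ennreal (exp (- r * t)) * (\<integral>\<^sup>+\<omega>. (\<integral>\<^sup>+y\<in>S. G r (X t \<omega>) y \<partial>\<sigma>) \<partial>P x) \<le> (\<integral>\<^sup>+y\<in>S. G r x y \<partial>\<sigma>)"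
proof -
  interpret Px: prob_space "P x" by (rule X.prob_space_P)
  have Xt: "X t \<in> borel_measurable (P x)" using t by (rule X.X_measurable)
  have "(\<integral>\<^sup>+\<omega>. (\<integral>\<^sup>+y\<in>S. G r (X t \<omega>) y \<partial>\<sigma>) \<partial>P x) = (\<integral>\<^sup>+y\<in>S. (\<integral>\<^sup>+\<omega>. G r (X t \<omega>) y \<partial>P x) \<partial>\<sigma>)"
    using integral_of_potential[OF Px.sigma_finite_measure_axioms borel_measurable_const Xt, of 1] by simp
  also have "ennreal (exp (- r * t)) * \<dots> = (\<integral>\<^sup>+y. ennreal (exp (- r * t)) * ((\<integral>\<^sup>+\<omega>. G r (X t \<omega>) y \<partial>P x) * indicator S y) \<partial>\<sigma>)"
  proof (rule nn_integral_cmult[symmetric])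
    have [measurable]: "S \<in> sets \<sigma>" using S_borel by (simp add: sets_\<sigma>)
    have [measurable]: "(\<lambda>p. G r (fst p) (snd p)) \<in> borel_measurable (borel \<Otimes>\<^sub>M borel)"
      using green_measurable[OF r] by (simp add: split_beta')
    note Xt[measurable]
    have "(\<lambda>p. (\<lambda>p. G r (fst p) (snd p)) (X t (snd p), fst p)) \<in> borel_measurable (borel \<Otimes>\<^sub>M P x)"
      by measurable
    then have "(\<lambda>(y, \<omega>). G r (X t \<omega>) y) \<in> borel_measurable (\<sigma> \<Otimes>\<^sub>M P x)"
      by (simp add: split_beta' sets_\<sigma> cong: measurable_cong_sets sets_pair_measure_cong)
    note [measurable] = Px.borel_measurable_nn_integral[OF this]
    show "(\<lambda>y. (\<integral>\<^sup>+\<omega>. G r (X t \<omega>) y \<partial>P x) * indicator S y) \<in> borel_measurable \<sigma>" by measurable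
  qed
  also have "\<dots> \<le> (\<integral>\<^sup>+y\<in>S. G r x y \<partial>\<sigma>)"
    using green_excessive[OF r] t
    by (intro nn_integral_mono) (auto simp: excessive_def indicator_def)
  finally show ?thesis .
qed

text \<open>
Balayage of the kernel is inherited by the potential through the Tonelli theorem, as every point that
carries mass of \<open>\<sigma>\<close> on \<open>S\<close> lies in the open set where \<open>\<phi>\<close> is positive.
\<close>

lemma potential_le_at_debut:
  fixes \<phi> :: "real \<Rightarrow> real"
  assumes \<phi>: "continuous_on UNIV \<phi>" and S: "\<And>y. y \<in> S \<Longrightarrow> 0 < \<phi> y"
  defines "T \<equiv> debut 0 (\<lambda>t \<omega>. \<phi> (X t \<omega>))"
  shows "(\<integral>\<^sup>+y\<in>S. G r x y \<partial>\<sigma>) \<le> (\<integral>\<^sup>+\<omega>\<in>{\<omega>. T \<omega> < \<infinity>}. ennreal (exp (- r * enn2real (T \<omega>))) *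
      (\<integral>\<^sup>+y\<in>S. G r (X (enn2real (T \<omega>)) \<omega>) y \<partial>\<sigma>) \<partial>P x)"
proof -
  interpret Px: prob_space "P x" by (rule X.prob_space_P)
  have [measurable]: "T \<in> borel_measurable (P x)" and XT: "(\<lambda>\<omega>. X (enn2real (T \<omega>)) \<omega>) \<in> borel_measurable (P x)"
    using X.entrance_measurable_raw[OF \<phi>] X.entrance_position_measurable_raw[OF \<phi>] unfolding T_def
    by (simp_all cong: measurable_cong_sets add: X.sets_P)
  define w where "w \<omega> = ennreal (exp (- r * enn2real (T \<omega>))) * indicator {\<omega>. T \<omega> < \<infinity>} \<omega>" for \<omega>
  have w: "w \<in> borel_measurable (P x)" unfolding w_def[abs_def] by measurable
  have "(\<integral>\<^sup>+y\<in>S. G r x y \<partial>\<sigma>) \<le> (\<integral>\<^sup>+y\<in>S. (\<integral>\<^sup>+\<omega>. w \<omega> * G r (X (enn2real (T \<omega>)) \<omega>) y \<partial>P x) \<partial>\<sigma>)"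
  proof (rule nn_integral_mono)
    fix y
    show "G r x y * indicator S y \<le> (\<integral>\<^sup>+\<omega>. w \<omega> * G r (X (enn2real (T \<omega>)) \<omega>) y \<partial>P x) * indicator S y"
      using green_kernel_le_at_debut[OF r \<phi> S, of y x] unfolding T_def[symmetric] w_def
      by (auto simp: indicator_def mult_ac)
  qed
  also have "\<dots> = (\<integral>\<^sup>+\<omega>. w \<omega> * (\<integral>\<^sup>+y\<in>S. G r (X (enn2real (T \<omega>)) \<omega>) y \<partial>\<sigma>) \<partial>P x)"
    by (rule integral_of_potential[symmetric]) (auto simp: Px.sigma_finite_measure_axioms w XT)
  finally show ?thesis unfolding w_def by (simp add: mult_ac)
qed

end

end

section \<open>Entrance into a closed set\<close>

lemma nonneg_slack_imp_mem_closed: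
  fixes S :: "real set"
  assumes "closed S" "S \<noteq> {}" and "\<And>n::nat. 0 \<le> 1 / (real n + 1) - infdist z S"
  shows "z \<in> S"
proof -
  have "(\<lambda>n. 1 / (real n + 1)) \<longlonglongrightarrow> 0"
    using LIMSEQ_inverse_real_of_nat by (simp add: inverse_eq_divide add.commute)
  then have "infdist z S \<le> 0"
    using assms(3) by (intro LIMSEQ_le_const[of _ 0 "infdist z S"]) (auto simp: diff_ge_0_iff_ge)
  then have "infdist z S = 0" using infdist_nonneg[of z S] by simp
  then show ?thesis using in_closed_iff_infdist_zero[OF assms(1,2)] by simp
qed

text \<open>
Positive exactly at the points at distance less than \<open>1 / (n + 1)\<close> from \<open>S\<close>. Describing the shrinking
neighbourhoods by continuous functions makes their entrance times debuts.
\<close>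

definition slack :: "real set \<Rightarrow> nat \<Rightarrow> real \<Rightarrow> real" where
  "slack S n z = 1 / (real n + 1) - infdist z S"

definition approach_time :: "(real \<Rightarrow> 'a \<Rightarrow> real) \<Rightarrow> real set \<Rightarrow> nat \<Rightarrow> 'a \<Rightarrow> ennreal" where
  "approach_time X S n = debut 0 (\<lambda>t \<omega>. slack S n (X t \<omega>))"

definition approach_limit :: "(real \<Rightarrow> 'a \<Rightarrow> real) \<Rightarrow> real set \<Rightarrow> 'a \<Rightarrow> ennreal" where
  "approach_limit X S \<omega> = (SUP n. approach_time X S n \<omega>)"

text \<open>
The paths that come arbitrarily close to \<open>S\<close> before a finite time without being in \<open>S\<close> at that time.
Only on them can the limit of the approach times differ from the entrance time of \<open>S\<close>.
\<close>

definition missing_paths :: "'a set \<Rightarrow> (real \<Rightarrow> 'a \<Rightarrow> real) \<Rightarrow> real set \<Rightarrow> 'a set" where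
  "missing_paths \<Omega> X S =
    {\<omega> \<in> \<Omega>. approach_limit X S \<omega> < \<infinity> \<and> X (enn2real (approach_limit X S \<omega>)) \<omega> \<notin> S}"

lemma slack_continuous: "continuous_on UNIV (slack S n)"
  unfolding slack_def[abs_def] by (intro continuous_intros)

lemma slack_pos: "z \<in> S \<Longrightarrow> 0 < slack S n z"
  by (simp add: slack_def)

lemma slack_antimono: "m \<le> n \<Longrightarrow> slack S n z \<le> slack S m z"
  by (auto simp: slack_def intro!: frac_le)

lemma approach_time_mono: "approach_time X S n \<omega> \<le> approach_time X S (Suc n) \<omega>"
  unfolding approach_time_def debut_def
  using slack_antimono[of n "Suc n" S] by (intro Inf_superset_mono) (auto intro: less_le_trans)

lemma approach_time_le_entrance_time: "approach_time X S n \<omega> \<le> entrance_time X S \<omega>"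
  unfolding approach_time_def debut_def entrance_time_def
  using slack_pos by (intro Inf_superset_mono) auto

context hunt_process
begin

lemma approach_time_measurable: "approach_time X S n \<in> borel_measurable (raw \<infinity>)"
  unfolding approach_time_def by (rule entrance_measurable_raw[OF slack_continuous])

lemma approach_limit_measurable: "approach_limit X S \<in> borel_measurable (raw \<infinity>)"
  unfolding approach_limit_def[abs_def] using approach_time_measurable by measurable

lemma approach_positions_converge:
  "AE \<omega> in P x. approach_limit X S \<omega> < \<infinity> \<longrightarrow>
    (\<lambda>n. X (enn2real (approach_time X S n \<omega>)) \<omega>) \<longlonglongrightarrow> X (enn2real (approach_limit X S \<omega>)) \<omega>"
  unfolding approach_limit_def
  by (intro quasi_left_continuous approach_time_mono)
     (simp add: approach_time_def entrance_stopping_time[OF slack_continuous])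

context
  fixes S :: "real set"
  assumes closed: "closed S" and nonempty: "S \<noteq> {}"
begin

lemma missing_paths_measurable: "missing_paths \<Omega> X S \<in> sets (raw \<infinity>)"
proof -
  note [measurable] = approach_limit_measurable
  have [measurable]: "(\<lambda>\<omega>. X (enn2real (approach_limit X S \<omega>)) \<omega>) \<in> borel_measurable (raw \<infinity>)"
    by (rule X_at_random_time_raw, rule measurable_compose[OF approach_limit_measurable]) simp_all
  have [measurable]: "S \<in> sets borel" using closed by simp
  have "{\<omega> \<in> space (raw \<infinity>). approach_limit X S \<omega> < \<infinity> \<and> X (enn2real (approach_limit X S \<omega>)) \<omega> \<notin> S} \<in> sets (raw \<infinity>)"
    by measurable
  then show ?thesis by (simp add: missing_paths_def space_raw_filtration)
qed

text \<open>
By quasi-left-continuity the positions at the approach times converge to the position at their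
limit, and the neighbourhoods shrink to the closed set \<open>S\<close>.
\<close>

lemma AE_not_missing: "AE \<omega> in P x. \<omega> \<notin> missing_paths \<Omega> X S"
  using approach_positions_converge[of S x] AE_space
proof eventually_elim
  case (elim \<omega>)
  show ?case
  proof
    assume "\<omega> \<in> missing_paths \<Omega> X S"
    then have \<omega>: "\<omega> \<in> \<Omega>" and fin: "approach_limit X S \<omega> < \<infinity>"
      and notin: "X (enn2real (approach_limit X S \<omega>)) \<omega> \<notin> S" by (auto simp: missing_paths_def)
    have lim: "(\<lambda>n. X (enn2real (approach_time X S n \<omega>)) \<omega>) \<longlonglongrightarrow> X (enn2real (approach_limit X S \<omega>)) \<omega>"
      using elim(1) fin by simp
    have "approach_time X S n \<omega> < \<infinity>" for n
      using fin unfolding approach_limit_def by (meson SUP_upper UNIV_I le_less_trans)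
    then have nonneg: "0 \<le> slack S n (X (enn2real (approach_time X S n \<omega>)) \<omega>)" for n
      using entrance_position_nonneg[OF slack_continuous[of S n] \<omega>] by (simp add: approach_time_def)
    have "0 \<le> slack S m (X (enn2real (approach_limit X S \<omega>)) \<omega>)" for m
    proof (rule LIMSEQ_le_const)
      show "(\<lambda>n. slack S m (X (enn2real (approach_time X S n \<omega>)) \<omega>)) \<longlonglongrightarrow> slack S m (X (enn2real (approach_limit X S \<omega>)) \<omega>)"
        by (rule continuous_on_tendsto_compose[OF slack_continuous lim]) auto
      show "\<exists>N. \<forall>n\<ge>N. 0 \<le> slack S m (X (enn2real (approach_time X S n \<omega>)) \<omega>)"
        using order_trans[OF nonneg slack_antimono] by blast
    qed
    then have "X (enn2real (approach_limit X S \<omega>)) \<omega> \<in> S"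
      unfolding slack_def by (rule nonneg_slack_imp_mem_closed[OF closed nonempty])
    with notin show False by simp
  qed
qed

lemma approach_limit_eq_entrance_time:
  assumes "\<omega> \<in> \<Omega>" "\<omega> \<notin> missing_paths \<Omega> X S"
  shows "approach_limit X S \<omega> = entrance_time X S \<omega>"
proof (rule antisym)
  show "approach_limit X S \<omega> \<le> entrance_time X S \<omega>"
    unfolding approach_limit_def by (intro SUP_least approach_time_le_entrance_time)
  show "entrance_time X S \<omega> \<le> approach_limit X S \<omega>"
  proof (cases "approach_limit X S \<omega> < \<infinity>")
    case True
    then have "X (enn2real (approach_limit X S \<omega>)) \<omega> \<in> S" using assms by (auto simp: missing_paths_def)
    then have "entrance_time X S \<omega> \<le> ennreal (enn2real (approach_limit X S \<omega>))"
      unfolding entrance_time_def by (intro Inf_lower) auto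
    then show ?thesis using True by simp
  qed (simp add: less_top[symmetric])
qed

text \<open>
Outside the set of missing paths, which is raw measurable and null for every initial law, the entrance
time is a limit of debuts, and those are observable in the right limit of the raw filtration.
\<close>

lemma entrance_time_stopping_time: "stopping_time natural (entrance_time X S)"
proof (rule stopping_timeI)
  fix t
  have "{\<omega> \<in> \<Omega>. entrance_time X S \<omega> \<le> t} \<in> sets (natural t)"
    unfolding sets_natural_filtration
  proof (intro CollectI conjI allI impI)
    fix \<mu> :: "real measure" assume \<mu>: "prob_space \<mu> \<and> sets \<mu> = sets borel"
    define B where "B = {\<omega> \<in> \<Omega>. approach_limit X S \<omega> \<le> t}"
    have B_inf: "B \<in> sets (raw \<infinity>)"
    proof -
      note [measurable] = approach_limit_measurable
      have "{\<omega> \<in> space (raw \<infinity>). approach_limit X S \<omega> \<le> t} \<in> sets (raw \<infinity>)" by measurable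
      then show ?thesis by (simp add: B_def space_raw_filtration)
    qed
    have "{\<omega> \<in> \<Omega>. approach_time X S n \<omega> \<le> t} \<in> sets (raw u)" if "t < u" for u n
      unfolding approach_time_def using that
      by (intro debut_le_raw order_refl continuous_image_adapted continuous_image_right_continuous slack_continuous)
    moreover have "B = (\<Inter>n. {\<omega> \<in> \<Omega>. approach_time X S n \<omega> \<le> t})"
      by (auto simp: B_def approach_limit_def SUP_le_iff)
    ultimately have B_u: "\<forall>u>t. B \<in> sets (raw u)" by auto
    have "missing_paths \<Omega> X S \<in> null_sets (\<mu> \<bind> P)"
    proof -
      have kernel_\<mu>: "P \<in> \<mu> \<rightarrow>\<^sub>M subprob_algebra (raw \<infinity>)"
        using kernel_subprob \<mu> by (simp cong: measurable_cong_sets)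
      have "space \<mu> \<noteq> {}" using \<mu> by (intro prob_space.not_empty) simp
      then have sets_bind: "sets (\<mu> \<bind> P) = sets (raw \<infinity>)"
        by (intro sets_bind[OF sets_kernel[OF kernel_\<mu>]]) auto
      have "Measurable.pred (raw \<infinity>) (\<lambda>\<omega>. \<omega> \<notin> missing_paths \<Omega> X S)"
        using missing_paths_measurable by measurable
      then have "AE \<omega> in \<mu> \<bind> P. \<omega> \<notin> missing_paths \<Omega> X S"
        by (subst AE_bind[OF kernel_\<mu>]) (auto intro: AE_not_missing)
      then show ?thesis
        using missing_paths_measurable sets_bind by (intro AE_iff_null_sets[THEN iffD2]) simp_all
    qed
    then have "missing_paths \<Omega> X S \<in> null_sets (completion (\<mu> \<bind> P))" by (rule null_sets_completionI)
    moreover have "({\<omega> \<in> \<Omega>. entrance_time X S \<omega> \<le> t} - B) \<union> (B - {\<omega> \<in> \<Omega>. entrance_time X S \<omega> \<le> t}) \<subseteq> missing_paths \<Omega> X S"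
      using approach_limit_eq_entrance_time by (auto simp: B_def)
    ultimately have "({\<omega> \<in> \<Omega>. entrance_time X S \<omega> \<le> t} - B) \<union> (B - {\<omega> \<in> \<Omega>. entrance_time X S \<omega> \<le> t})
        \<in> null_sets (completion (\<mu> \<bind> P))"
      by (rule null_sets_completion_subset[rotated])
    then show "\<exists>B. B \<in> sets (raw \<infinity>) \<and> (\<forall>u>t. B \<in> sets (raw u)) \<and>
        ({\<omega> \<in> \<Omega>. entrance_time X S \<omega> \<le> t} - B) \<union> (B - {\<omega> \<in> \<Omega>. entrance_time X S \<omega> \<le> t})
          \<in> null_sets (completion (\<mu> \<bind> P))"
      using B_inf B_u by blast
  qed auto
  then show "Measurable.pred (natural t) (\<lambda>\<omega>. entrance_time X S \<omega> \<le> t)"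
    by (simp add: pred_def space_natural)
qed

text \<open>
Letting the neighbourhoods of \<open>S\<close> shrink. When \<open>S\<close> is entered, the stopped values converge to the
reward by continuity. When it is not, the approach times are eventually infinite or tend to infinity;
in the second case the positions are close to \<open>S\<close>, where \<open>V\<close> hardly exceeds \<open>g\<close>, and this gives the
upper limit in the definition of the reward.
\<close>

lemma reward_at_entrance_ge:
  fixes V :: "real \<Rightarrow> ennreal" and g :: "real \<Rightarrow> real" and C :: ennreal
  assumes r: "0 \<le> r" and g_cont: "continuous_on UNIV g" and g_nonneg: "\<And>z. 0 \<le> g z"
    and sup_integrable: "(\<integral>\<^sup>+\<omega>. (SUP t\<in>{0..}. ennreal (exp (- r * t) * g (X t \<omega>))) \<partial>P x) < \<infinity>"
    and V_cont: "continuous_on UNIV V" and V_eq: "\<And>z. z \<in> S \<Longrightarrow> V z = ennreal (g z)"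
    and bound: "\<And>z. V z \<le> ennreal (g z) + C" "C < \<infinity>"
    and near: "\<And>e. 0 < e \<Longrightarrow> \<exists>n. \<forall>z. 0 \<le> slack S n z \<longrightarrow> V z \<le> ennreal (g z) + ennreal e"
    and v: "\<And>n. v \<le> (\<integral>\<^sup>+\<omega>\<in>{\<omega>. approach_time X S n \<omega> < \<infinity>}.
        ennreal (exp (- r * enn2real (approach_time X S n \<omega>))) * V (X (enn2real (approach_time X S n \<omega>)) \<omega>) \<partial>P x)"
  shows "v \<le> expected_reward X P r g x (entrance_time X S)"
proof -
  interpret prob_space "P x" by (rule prob_space_P)
  have [measurable]: "V \<in> borel_measurable borel" using V_cont by (rule borel_measurable_continuous_onI)
  have [measurable]: "approach_time X S n \<in> borel_measurable (P x)"
    "(\<lambda>\<omega>. X (enn2real (approach_time X S n \<omega>)) \<omega>) \<in> borel_measurable (P x)" for n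
    using entrance_measurable_raw[OF slack_continuous] entrance_position_measurable_raw[OF slack_continuous]
    unfolding approach_time_def by (simp_all cong: measurable_cong_sets add: sets_P)
  define D where "D \<omega> = (SUP t\<in>{0..}. ennreal (exp (- r * t) * g (X t \<omega>)))" for \<omega>
  have D_meas[measurable]: "D \<in> borel_measurable (P x)"
    unfolding D_def[abs_def] by (rule SUP_discounted_measurable[OF g_cont order_refl])
  define u where "u n \<omega> = ennreal (exp (- r * enn2real (approach_time X S n \<omega>))) *
      V (X (enn2real (approach_time X S n \<omega>)) \<omega>) * indicator {\<omega>. approach_time X S n \<omega> < \<infinity>} \<omega>" for n \<omega>
  have u_meas: "u n \<in> borel_measurable (P x)" for n
    unfolding u_def[abs_def] by measurable
  have discount: "ennreal (exp (- r * t)) \<le> 1" if "0 \<le> t" for t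
    using r that by (auto intro!: ennreal_le_1[THEN iffD2])
  have split: "ennreal (exp (- r * t)) * V z \<le> ennreal (exp (- r * t) * g z) + K"
    if "V z \<le> ennreal (g z) + K" "0 \<le> t" for t z K
  proof -
    have "ennreal (exp (- r * t)) * V z \<le> ennreal (exp (- r * t)) * (ennreal (g z) + K)"
      using that(1) by (rule mult_left_mono) simp
    also have "\<dots> = ennreal (exp (- r * t) * g z) + ennreal (exp (- r * t)) * K"
      by (simp add: distrib_left ennreal_mult g_nonneg)
    also have "\<dots> \<le> ennreal (exp (- r * t) * g z) + 1 * K"
      by (intro add_left_mono mult_right_mono discount that) simp
    finally show ?thesis by simp
  qed
  have u_le: "u n \<omega> \<le> D \<omega> + C" for n \<omega>
  proof -
    have "u n \<omega> \<le> ennreal (exp (- r * enn2real (approach_time X S n \<omega>))) * V (X (enn2real (approach_time X S n \<omega>)) \<omega>)"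
      by (auto simp: u_def indicator_def)
    also have "\<dots> \<le> ennreal (exp (- r * enn2real (approach_time X S n \<omega>)) * g (X (enn2real (approach_time X S n \<omega>)) \<omega>)) + C"
      by (rule split[OF bound(1)]) simp
    also have "\<dots> \<le> D \<omega> + C"
      unfolding D_def by (intro add_right_mono SUP_upper) simp
    finally show ?thesis .
  qed
  have "v \<le> limsup (\<lambda>n. \<integral>\<^sup>+\<omega>. u n \<omega> \<partial>P x)"
    using v unfolding u_def[symmetric] by (intro le_Limsup) (auto intro: always_eventually)
  also have "\<dots> \<le> (\<integral>\<^sup>+\<omega>. limsup (\<lambda>n. u n \<omega>) \<partial>P x)"
  proof (rule nn_integral_limsup)
    show "(\<integral>\<^sup>+\<omega>. D \<omega> + C \<partial>P x) < \<infinity>"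
      using sup_integrable bound(2) unfolding D_def[symmetric] by (simp add: nn_integral_add emeasure_space_1)
  qed (auto simp: u_meas u_le)
  also have "\<dots> \<le> (\<integral>\<^sup>+\<omega>. discounted_reward X r g (entrance_time X S) \<omega> \<partial>P x)"
  proof (rule nn_integral_mono_AE)
    show "AE \<omega> in P x. limsup (\<lambda>n. u n \<omega>) \<le> discounted_reward X r g (entrance_time X S) \<omega>"
      using AE_not_missing[of x] approach_positions_converge[of S x] AE_space
    proof eventually_elim
      case (elim \<omega>)
      then have \<omega>: "\<omega> \<in> \<Omega>" by (simp add: space_P)
      have eq: "approach_limit X S \<omega> = entrance_time X S \<omega>"
        by (rule approach_limit_eq_entrance_time[OF \<omega> elim(1)])
      have mono: "incseq (\<lambda>n. approach_time X S n \<omega>)"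
        by (rule incseq_SucI) (rule approach_time_mono)
      have lim_T: "(\<lambda>n. approach_time X S n \<omega>) \<longlonglongrightarrow> entrance_time X S \<omega>"
        using LIMSEQ_SUP[OF mono] by (simp add: eq[symmetric] approach_limit_def)
      show ?case
      proof (cases "entrance_time X S \<omega> = \<infinity>")
        case False
        define t where "t = enn2real (entrance_time X S \<omega>)"
        have fin: "approach_limit X S \<omega> < \<infinity>" using False eq by (simp add: less_top)
        have T_fin: "approach_time X S n \<omega> < \<infinity>" for n
          using fin unfolding approach_limit_def by (meson SUP_upper UNIV_I le_less_trans)
        have "X t \<omega> \<in> S"
          using elim(1) \<omega> fin eq by (auto simp: missing_paths_def t_def)
        have "(\<lambda>n. enn2real (approach_time X S n \<omega>)) \<longlonglongrightarrow> t"
          unfolding t_def using False lim_T by (intro tendsto_enn2real) (auto simp: less_top)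
        moreover have "(\<lambda>n. V (X (enn2real (approach_time X S n \<omega>)) \<omega>)) \<longlonglongrightarrow> V (X t \<omega>)"
          using elim(2) fin by (intro continuous_on_tendsto_compose[OF V_cont]) (auto simp: t_def eq)
        ultimately have "(\<lambda>n. u n \<omega>) \<longlonglongrightarrow> ennreal (exp (- r * t)) * V (X t \<omega>)"
          using T_fin V_eq[OF \<open>X t \<omega> \<in> S\<close>] unfolding u_def
          by (auto intro!: tendsto_mult_ennreal tendsto_ennrealI tendsto_intros)
        then have "limsup (\<lambda>n. u n \<omega>) = ennreal (exp (- r * t)) * V (X t \<omega>)"
          by (intro lim_imp_Limsup) auto
        also have "\<dots> = discounted_reward X r g (entrance_time X S) \<omega>"
          using False V_eq[OF \<open>X t \<omega> \<in> S\<close>]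
          by (simp add: discounted_reward_def t_def[symmetric] ennreal_mult g_nonneg)
        finally show ?thesis by simp
      next
        case True
        define Z where "Z = Limsup at_top (\<lambda>t. ennreal (exp (- r * t) * g (X t \<omega>)))"
        have reward: "discounted_reward X r g (entrance_time X S) \<omega> = Z"
          using True by (simp add: discounted_reward_def Z_def)
        show ?thesis
        proof (cases "\<forall>n. approach_time X S n \<omega> < \<infinity>")
          case T_fin: True
          define s where "s n = enn2real (approach_time X S n \<omega>)" for n
          have s: "approach_time X S n \<omega> = ennreal (s n)" "0 \<le> s n" for n
            using T_fin by (auto simp: s_def less_top)
          have s_lim: "filterlim s at_top sequentially"
            using lim_T unfolding s True by (simp add: ennreal_tendsto_top_eq_at_top)
          have "limsup (\<lambda>n. u n \<omega>) \<le> Z + ennreal e" if e: "0 < e" for e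
          proof -
            obtain N where N: "\<And>z. 0 \<le> slack S N z \<Longrightarrow> V z \<le> ennreal (g z) + ennreal e"
              using near[OF e] by blast
            have "u n \<omega> \<le> ennreal (exp (- r * s n) * g (X (s n) \<omega>)) + ennreal e" if "N \<le> n" for n
            proof -
              have "0 \<le> slack S n (X (s n) \<omega>)"
                using entrance_position_nonneg[OF slack_continuous[of S n] \<omega>] T_fin
                by (simp add: approach_time_def s_def)
              then have "0 \<le> slack S N (X (s n) \<omega>)"
                using slack_antimono[OF that] by (rule order_trans)
              from split[OF N[OF this] s(2)[of n]] show ?thesis
                using T_fin by (simp add: u_def s_def)
            qed
            note u_le' = this
            have "limsup (\<lambda>n. u n \<omega>) \<le> (SUP t\<in>{real k..}. ennreal (exp (- r * t) * g (X t \<omega>))) + ennreal e" for k :: nat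
            proof (rule Limsup_bounded)
              have "\<forall>\<^sub>F n in sequentially. real k \<le> s n"
                using s_lim by (simp add: filterlim_at_top)
              then show "\<forall>\<^sub>F n in sequentially. u n \<omega> \<le>
                  (SUP t\<in>{real k..}. ennreal (exp (- r * t) * g (X t \<omega>))) + ennreal e"
                using eventually_ge_at_top[of N]
              proof eventually_elim
                case (elim n)
                have "ennreal (exp (- r * s n) * g (X (s n) \<omega>)) \<le> (SUP t\<in>{real k..}. ennreal (exp (- r * t) * g (X t \<omega>)))"
                  using elim(1) by (intro SUP_upper) simp
                then show ?case using u_le'[OF elim(2)] by (meson add_right_mono order_trans)
              qed
            qed
            then show ?thesis
              unfolding Z_def Limsup_at_top_eq_INF_SUP INF_ennreal_add_const[symmetric] by (intro INF_greatest)
          qed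
          note le_epsilon = this
          have "limsup (\<lambda>n. u n \<omega>) \<le> Z"
          proof (rule ennreal_le_epsilon)
            fix e :: real assume "0 < e"
            then show "limsup (\<lambda>n. u n \<omega>) \<le> Z + ennreal e" by (rule le_epsilon)
          qed
          then show ?thesis by (simp add: reward)
        next
          case False
          then obtain N where "\<not> approach_time X S N \<omega> < \<infinity>" by blast
          then have N: "approach_time X S N \<omega> = \<infinity>" by (simp add: not_less top_unique)
          have "u n \<omega> = 0" if "N \<le> n" for n
          proof -
            have "approach_time X S n \<omega> = \<infinity>"
              using incseqD[OF mono that] by (simp add: N top_unique)
            then show ?thesis by (simp add: u_def)
          qed
          then have "limsup (\<lambda>n. u n \<omega>) \<le> 0"
            by (intro Limsup_bounded) (auto simp: eventually_sequentially)
          then show ?thesis by simp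
        qed
      qed
    qed
  qed
  also have "\<dots> = expected_reward X P r g x (entrance_time X S)"
    by (simp add: expected_reward_def nn_integral_completion)
  finally show ?thesis .
qed

end

end

section \<open>The two-sided stopping problem\<close>

lemma radon_measure_sigma_finite:
  assumes "radon_measure \<sigma>"
  shows "sigma_finite_measure \<sigma>"
proof
  let ?A = "range (\<lambda>n::nat. {- real n..real n})"
  have "(\<Union>n::nat. {- real n..real n}) = UNIV"
  proof (intro equalityI subsetI UNIV_I)
    fix z :: real
    obtain n :: nat where "\<bar>z\<bar> \<le> real n" using real_arch_simple by blast
    then show "z \<in> (\<Union>n::nat. {- real n..real n})" by (auto intro!: exI[of _ n])
  qed
  moreover have "space \<sigma> = UNIV"
    using assms sets_eq_imp_space_eq[of \<sigma> borel] by (simp add: radon_measure_def)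
  moreover have "emeasure \<sigma> {- real n..real n} \<noteq> \<infinity>" for n
    using assms by (auto simp: radon_measure_def less_top)
  ultimately show "\<exists>A. countable A \<and> A \<subseteq> sets \<sigma> \<and> \<Union>A = space \<sigma> \<and> (\<forall>a\<in>A. emeasure \<sigma> a \<noteq> \<infinity>)"
    using assms by (intro exI[of _ ?A]) (auto simp: radon_measure_def)
qed

lemma close_to_two_half_lines:
  fixes a b z d :: real
  assumes "infdist z ({..a} \<union> {b..}) \<le> d" "z \<notin> {..a} \<union> {b..}"
  shows "\<bar>z - a\<bar> \<le> d \<or> \<bar>z - b\<bar> \<le> d"
proof -
  obtain s where "s \<in> {..a} \<union> {b..}" "infdist z ({..a} \<union> {b..}) = dist z s"
    by (rule infdist_attains_inf[of "{..a} \<union> {b..}" z]) auto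
  with assms show ?thesis by (auto simp: dist_real_def)
qed

theorem theorem3p3:
  fixes \<Omega> :: "'a set" and X :: "real \<Rightarrow> 'a \<Rightarrow> real" and P :: "real \<Rightarrow> 'a measure"
    and \<Omega>' :: "'b set" and X' :: "real \<Rightarrow> 'b \<Rightarrow> real" and P' :: "real \<Rightarrow> 'b measure"
    and m :: "real measure" and G :: "real \<Rightarrow> real \<Rightarrow> real \<Rightarrow> ennreal"
    and g :: "real \<Rightarrow> real" and r x_lower x_upper :: real and \<sigma> :: "real measure"
    and S :: "real set" and V :: "real \<Rightarrow> ennreal"
  assumes setting: "green_duality \<Omega> X P \<Omega>' X' P' m G"
    and g_cont: "continuous_on UNIV g" and g_nonneg: "\<And>x. 0 \<le> g x"
    and r_nonneg: "0 \<le> r"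
    and sup_integrable:
      "\<And>x. (\<integral>\<^sup>+\<omega>. (SUP t\<in>{0..}. ennreal (exp (- r * t) * g (X t \<omega>))) \<partial>P x) < \<infinity>"
    and "x_lower < x_upper"
    and S_def: "S = {..x_lower} \<union> {x_upper..}"
    and radon: "radon_measure \<sigma>" and support: "emeasure \<sigma> (- S) = 0"
    and V_def: "\<And>x. V x = (\<integral>\<^sup>+y\<in>S. G r x y \<partial>\<sigma>)"
    and a: "(\<forall>x. V x < \<infinity>) \<and> continuous_on UNIV V"
    and b: "\<And>x. x \<in> S \<Longrightarrow> V x = ennreal (g x)"
    and c: "\<And>x. x \<notin> S \<Longrightarrow> V x \<ge> ennreal (g x)"
  shows "entrance_time X S \<in> stopping_times \<Omega> X P \<and>
    (\<forall>x. V x = (SUP \<tau>\<in>stopping_times \<Omega> X P. expected_reward X P r g x \<tau>) \<and>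
         (SUP \<tau>\<in>stopping_times \<Omega> X P. expected_reward X P r g x \<tau>) =
           expected_reward X P r g x (entrance_time X S))"
proof -
  interpret green_duality \<Omega> X P \<Omega>' X' P' m G by (rule setting)
  have V_cont: "continuous_on UNIV V" and V_fin: "\<And>x. V x < \<infinity>" using a by auto
  have closed: "closed S" and nonempty: "S \<noteq> {}" unfolding S_def by auto
  have majorant: "ennreal (g x) \<le> V x" for x using b c by (cases "x \<in> S") auto
  have \<sigma>: "sigma_finite_measure \<sigma>" "sets \<sigma> = sets borel" "S \<in> sets borel"
    using radon_measure_sigma_finite[OF radon] radon closed by (auto simp: radon_measure_def)
  have supermedian: "ennreal (exp (- r * t)) * (\<integral>\<^sup>+\<omega>. V (X t \<omega>) \<partial>P x) \<le> V x" if "0 \<le> t" for x t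
    unfolding V_def by (rule potential_supermedian[OF \<sigma> r_nonneg that])
  have stopping: "entrance_time X S \<in> stopping_times \<Omega> X P"
    using X.entrance_time_stopping_time[OF closed nonempty] by (simp add: stopping_times_def)
  have upper: "expected_reward X P r g x \<tau> \<le> V x" if "\<tau> \<in> stopping_times \<Omega> X P" for x \<tau>
  proof -
    have "stopping_time X.natural \<tau>" using that by (simp add: stopping_times_def)
    then show ?thesis by (intro X.expected_reward_le g_cont g_nonneg V_cont supermedian majorant)
  qed
  have near_endpoint: "\<exists>d>0. \<forall>z. \<bar>z - s\<bar> < d \<longrightarrow> V z \<le> ennreal (g z) + ennreal e"
    if "s \<in> S" "0 < e" for s e
  proof -
    have "((\<lambda>z. ennreal (g z) + ennreal e) \<longlongrightarrow> ennreal (g s) + ennreal e) (at s)"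
      using g_cont by (intro tendsto_intros tendsto_ennrealI) (auto simp: continuous_on_def)
    then have lim: "((\<lambda>z. ennreal (g z) + ennreal e) \<longlongrightarrow> V s + ennreal e) (at s)"
      using b[OF that(1)] by simp
    have V_lim: "(V \<longlongrightarrow> V s) (at s)" using V_cont by (auto simp: continuous_on_def)
    have "V s < V s + ennreal e"
      using that(2) g_nonneg[of s]
      by (simp add: b[OF that(1)] ennreal_less_iff ennreal_plus[symmetric] del: ennreal_plus)
    then obtain q where q: "V s < q" "q < V s + ennreal e" using dense by blast
    have "\<forall>\<^sub>F z in at s. V z \<le> ennreal (g z) + ennreal e"
      using order_tendstoD(2)[OF V_lim q(1)] order_tendstoD(1)[OF lim q(2)]
      by eventually_elim simp
    then obtain d where d: "0 < d" "\<And>z. z \<noteq> s \<Longrightarrow> dist z s < d \<Longrightarrow> V z \<le> ennreal (g z) + ennreal e"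
      unfolding eventually_at by auto
    have "V z \<le> ennreal (g z) + ennreal e" if "\<bar>z - s\<bar> < d" for z
      using d(2)[of z] that b[OF \<open>s \<in> S\<close>] by (cases "z = s") (auto simp: dist_real_def)
    with d(1) show ?thesis by blast
  qed
  \<comment> \<open>Points close to \<open>S\<close> but outside it are close to one of the two end points, where \<open>V = g\<close>.\<close>
  have near: "\<exists>n. \<forall>z. 0 \<le> slack S n z \<longrightarrow> V z \<le> ennreal (g z) + ennreal e"
    if e: "0 < e" for e
  proof -
    obtain d1 d2 where d: "0 < d1" "\<And>z. \<bar>z - x_lower\<bar> < d1 \<Longrightarrow> V z \<le> ennreal (g z) + ennreal e"
      "0 < d2" "\<And>z. \<bar>z - x_upper\<bar> < d2 \<Longrightarrow> V z \<le> ennreal (g z) + ennreal e"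
      using near_endpoint[OF _ e, of x_lower] near_endpoint[OF _ e, of x_upper] by (auto simp: S_def)
    obtain n where n: "inverse (real (Suc n)) < min d1 d2"
      using reals_Archimedean[of "min d1 d2"] d by auto
    have "V z \<le> ennreal (g z) + ennreal e" if z: "0 \<le> slack S n z" for z
    proof (cases "z \<in> S")
      case False
      have "infdist z S \<le> inverse (real (Suc n))"
        using z slack_def by (simp add: inverse_eq_divide add.commute)
      then have "\<bar>z - x_lower\<bar> \<le> inverse (real (Suc n)) \<or> \<bar>z - x_upper\<bar> \<le> inverse (real (Suc n))"
        using False unfolding S_def by (rule close_to_two_half_lines)
      with d n show ?thesis by fastforce
    qed (simp add: b)
    then show ?thesis by blast
  qed
  \<comment> \<open>\<open>V\<close> exceeds \<open>g\<close> only on a compact interval, so \<open>V - g\<close> is bounded.\<close>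
  obtain z0 where z0: "\<forall>z\<in>{x_lower..x_upper}. V z \<le> V z0"
    using continuous_attains_sup[of "{x_lower..x_upper}" V] continuous_on_subset[OF V_cont] \<open>x_lower < x_upper\<close>
    by auto
  have bound: "V z \<le> ennreal (g z) + V z0" for z
    using b[of z] bspec[OF z0, of z] by (cases "z \<in> S") (auto simp: S_def add_increasing)
  have lower: "V x \<le> expected_reward X P r g x (entrance_time X S)" for x
  proof (rule X.reward_at_entrance_ge[OF closed nonempty r_nonneg g_cont g_nonneg sup_integrable V_cont b bound V_fin near])
    fix n
    show "V x \<le> (\<integral>\<^sup>+\<omega>\<in>{\<omega>. approach_time X S n \<omega> < \<infinity>}.
        ennreal (exp (- r * enn2real (approach_time X S n \<omega>))) *
        V (X (enn2real (approach_time X S n \<omega>)) \<omega>) \<partial>P x)"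
      using potential_le_at_debut[OF \<sigma> r_nonneg slack_continuous[of S n]
          slack_pos]
      unfolding V_def approach_time_def by simp
  qed
  have "V x = (SUP \<tau>\<in>stopping_times \<Omega> X P. expected_reward X P r g x \<tau>)"
    "(SUP \<tau>\<in>stopping_times \<Omega> X P. expected_reward X P r g x \<tau>) = expected_reward X P r g x (entrance_time X S)" for x
  proof -
    have le: "(SUP \<tau>\<in>stopping_times \<Omega> X P. expected_reward X P r g x \<tau>) \<le> V x"
      by (rule SUP_least) (rule upper)
    have ge: "expected_reward X P r g x (entrance_time X S) \<le> (SUP \<tau>\<in>stopping_times \<Omega> X P. expected_reward X P r g x \<tau>)"
      by (rule SUP_upper[OF stopping])
    show "V x = (SUP \<tau>\<in>stopping_times \<Omega> X P. expected_reward X P r g x \<tau>)"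
      using le ge lower[of x] by simp
    then show "(SUP \<tau>\<in>stopping_times \<Omega> X P. expected_reward X P r g x \<tau>) = expected_reward X P r g x (entrance_time X S)"
      using upper[OF stopping, of x] lower[of x] by (metis antisym)
  qed
  with stopping show ?thesis by blast
qed

end
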